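(* Let $(M^3,\mu,\tau,v,g,p)$ be an Aristotelian fluid on a compact oriented three-manifold $M^3$, with one-parameter family of foliations $\mathcal{F}$, $T\mathcal{F}=\ker\tau$, and let $$\mathtt{gv}(\mathcal{F})=\int_{M^3}\alpha_v\wedge\mathrm{d}\alpha_v$$ be its Godbillon-Vey number, where $\alpha_v=\pounds_v\tau-\mathrm{d}\log s_v$ (so that $\mathrm{d}v^\flat=v^\flat\wedge\alpha_v$) and $s_v=g(v,v)$. If $M^3$ is closed, then the Godbillon-Vey number is a conserved quantity along the fluid lines: $$\frac{\mathrm{d}\,\mathtt{gv}(\mathcal{F})}{\mathrm{d}t}=0 .$$ If $\partial M^3\neq\varnothing$, then the same conservation law holds provided that the vorticity vector field $\xi=\mathrm{curl}(v)$ is parallel to the boundary of $M^3$.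
   Context: An ideal incompressible fluid on an oriented manifold $M^n$ consists of a (time-independent) Riemannian metric $g$ with its Levi-Civita connection $\nabla$, a (time-independent) volume form $\mu$, a smooth one-parameter (time $t$) family of vector fields $v$, and a time-dependent function $p$, such that $\frac{\partial v}{\partial t}+\nabla_vv=-(\mathrm{d}p)^\sharp$ and $\pounds_v\mu=0$; if $\partial M^n\neq\varnothing$, $v$ is parallel to the boundary. For $n=3$ the vorticity vector field $\xi=\mathrm{curl}(v)$ is defined by $\iota_\xi\mu=\mathrm{d}v^\flat$, $v^\flat=\iota_vg$. A divergence-free vector field $w$ is parallel to $\partial M^n$ if $(\iota_w\mu)|_{\partial M^n}=0$. An Aristotelian fluid $(M^n,\mu,\tau,v,g,p)$ is an ideal incompressible fluid together with one-parameter families of a nowhere-vanishing one-form $\tau$ with $\iota_v\tau=1$, a corank one positive-semidefinite symmetric tensor $h\in\Gamma(\odot^2T^*M^n)$ with $\iota_vh=0$, and a corank one positive-semidefinite symmetric tensor $\gamma\in\Gamma(\odot^2TM^n)$ with $\iota_\tau\gamma=0$, such that $\ker(\tau)$ and $\mathrm{Span}(v)$ are $g$-orthogonal, $h$ restricts to $g$ on $\ker\tau$, $\gamma$ restricts to $g^{-1}$ on $\mathrm{Ann}(v)$, and $\tau\wedge\mathrm{d}\tau=0$ for all times. In particular $v$ is nowhere-vanishing and $v^\flat=s_v\,\tau$. The time derivative is $\frac{\mathrm{d}\,\mathtt{gv}(\mathcal{F})}{\mathrm{d}t}=\int_{M^3}\big(\frac{\partial}{\partial t}+\pounds_v\big)(\alpha_v\wedge\mathrm{d}\alpha_v)$,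 which agrees with the ordinary time derivative of the integral since $v$ is parallel to $\partial M^3$. *)

theory Defs
  imports "HOL-Analysis.Analysis"
begin

section \<open>Smooth maps\<close>

type_synonym R3 = "real^3"

primrec Ck_on :: "nat \<Rightarrow> 'a::euclidean_space set \<Rightarrow> ('a \<Rightarrow> 'b::real_normed_vector) \<Rightarrow> bool" where
  "Ck_on 0 U f \<longleftrightarrow> continuous_on U f"
| "Ck_on (Suc k) U f \<longleftrightarrow> f differentiable_on U \<and>
     (\<forall>u. Ck_on k U (\<lambda>x. frechet_derivative f (at x within U) u))"

text \<open>On a set that need not be open, smooth means: locally the restriction of a smooth map
  defined on an open set.\<close>

definition smooth_on :: "'a::euclidean_space set \<Rightarrow> ('a \<Rightarrow> 'b::real_normed_vector) \<Rightarrow> bool" where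
  "smooth_on S f \<longleftrightarrow> (\<forall>x\<in>S. \<exists>U F. open U \<and> x \<in> U \<and> (\<forall>k. Ck_on k U F) \<and> (\<forall>y\<in>S \<inter> U. F y = f y))"

text \<open>The sets \<open>S\<close> occurring below are relatively open in the closed half-space, so the
  derivative within \<open>S\<close> is unique, also at boundary points, where it is one-sided.\<close>

abbreviation D :: "R3 set \<Rightarrow> (R3 \<Rightarrow> 'b::real_normed_vector) \<Rightarrow> R3 \<Rightarrow> R3 \<Rightarrow> 'b" where
  "D S f x \<equiv> frechet_derivative f (at x within S)"

section \<open>Oriented smooth three-manifolds with boundary\<close>

datatype 'a chart = Chart (cdom: "'a set") (crd: "'a \<Rightarrow> R3")

definition cimg :: "'a chart \<Rightarrow> R3 set" where
  "cimg c = crd c ` cdom c"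

definition cinv :: "'a chart \<Rightarrow> R3 \<Rightarrow> 'a" where
  "cinv c = inv_into (cdom c) (crd c)"

definition overlap :: "'a chart \<Rightarrow> 'a chart \<Rightarrow> R3 set" where
  "overlap c d = crd c ` (cdom c \<inter> cdom d)"

definition trans_map :: "'a chart \<Rightarrow> 'a chart \<Rightarrow> R3 \<Rightarrow> R3" where
  "trans_map c d = crd d \<circ> cinv c"

definition jac :: "'a chart \<Rightarrow> 'a chart \<Rightarrow> R3 \<Rightarrow> R3 \<Rightarrow> R3" where
  "jac c d x = D (overlap c d) (trans_map c d) x"

definition half_space :: "R3 set" where
  "half_space = {x. 0 \<le> x $ 1}"

definition oriented_3manifold :: "'a topology \<Rightarrow> 'a chart set \<Rightarrow> bool" where
  "oriented_3manifold X A \<longleftrightarrow>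
     Hausdorff_space X \<and> second_countable X \<and>
     (\<Union>c\<in>A. cdom c) = topspace X \<and>
     (\<forall>c\<in>A. openin X (cdom c) \<and> openin (top_of_set half_space) (cimg c) \<and>
        homeomorphic_map (subtopology X (cdom c)) (top_of_set (cimg c)) (crd c)) \<and>
     (\<forall>c\<in>A. \<forall>d\<in>A. smooth_on (overlap c d) (trans_map c d) \<and>
        (\<forall>x\<in>overlap c d. det (matrix (jac c d x)) > 0))"

definition mfd_boundary :: "'a topology \<Rightarrow> 'a chart set \<Rightarrow> 'a set" where
  "mfd_boundary X A = {q \<in> topspace X. \<exists>c\<in>A. q \<in> cdom c \<and> crd c q $ 1 = 0}"

section \<open>Tensor fields\<close>

text \<open>A tensor field assigns to every chart of the atlas its local representative on the image
  of the chart, subject to the usual transformation law. Arguments of a one-parameter family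
  are ordered: time, chart, point. A time-independent field \<open>g\<close> is the constant family
  \<open>\<lambda>_. g\<close>. Functions are genuine functions on the manifold.\<close>

type_synonym form1 = "R3 \<Rightarrow> real"
type_synonym form2 = "R3 \<Rightarrow> R3 \<Rightarrow> real"
type_synonym form3 = "R3 \<Rightarrow> R3 \<Rightarrow> R3 \<Rightarrow> real"
type_synonym covector = "R3 \<Rightarrow>\<^sub>L real"
type_synonym ('a, 't) field = "'a chart \<Rightarrow> R3 \<Rightarrow> 't"

definition smooth_family ::
  "real set \<Rightarrow> 'a chart set \<Rightarrow> (real \<Rightarrow> ('a, 'b::real_normed_vector) field) \<Rightarrow> bool" where
  "smooth_family T A f \<longleftrightarrow> (\<forall>c\<in>A. smooth_on (T \<times> cimg c) (\<lambda>(t, x). f t c x))"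

definition function_family :: "real set \<Rightarrow> 'a chart set \<Rightarrow> (real \<Rightarrow> 'a \<Rightarrow> real) \<Rightarrow> bool" where
  "function_family T A p \<longleftrightarrow> smooth_family T A (\<lambda>t c x. p t (cinv c x))"

definition vector_family :: "real set \<Rightarrow> 'a chart set \<Rightarrow> (real \<Rightarrow> ('a, R3) field) \<Rightarrow> bool" where
  "vector_family T A v \<longleftrightarrow> smooth_family T A v \<and>
     (\<forall>t\<in>T. \<forall>c\<in>A. \<forall>d\<in>A. \<forall>x\<in>overlap c d.
        v t d (trans_map c d x) = jac c d x (v t c x))"

definition form1_family :: "real set \<Rightarrow> 'a chart set \<Rightarrow> (real \<Rightarrow> ('a, form1) field) \<Rightarrow> bool" where
  "form1_family T A \<tau> \<longleftrightarrow>
     (\<forall>t\<in>T. \<forall>c\<in>A. \<forall>x\<in>cimg c. linear (\<tau> t c x)) \<and>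
     (\<forall>u. smooth_family T A (\<lambda>t c x. \<tau> t c x u)) \<and>
     (\<forall>t\<in>T. \<forall>c\<in>A. \<forall>d\<in>A. \<forall>x\<in>overlap c d. \<forall>u.
        \<tau> t c x u = \<tau> t d (trans_map c d x) (jac c d x u))"

definition trilinear :: "form3 \<Rightarrow> bool" where
  "trilinear \<rho> \<longleftrightarrow> (\<forall>a b. linear (\<rho> a b) \<and> linear (\<lambda>u. \<rho> a u b) \<and> linear (\<lambda>u. \<rho> u a b))"

definition alternating3 :: "form3 \<Rightarrow> bool" where
  "alternating3 \<rho> \<longleftrightarrow> (\<forall>a b. \<rho> a a b = 0 \<and> \<rho> a b a = 0 \<and> \<rho> b a a = 0)"

definition form3_family :: "real set \<Rightarrow> 'a chart set \<Rightarrow> (real \<Rightarrow> ('a, form3) field) \<Rightarrow> bool" where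
  "form3_family T A \<rho> \<longleftrightarrow>
     (\<forall>t\<in>T. \<forall>c\<in>A. \<forall>x\<in>cimg c. trilinear (\<rho> t c x) \<and> alternating3 (\<rho> t c x)) \<and>
     (\<forall>a b e. smooth_family T A (\<lambda>t c x. \<rho> t c x a b e)) \<and>
     (\<forall>t\<in>T. \<forall>c\<in>A. \<forall>d\<in>A. \<forall>x\<in>overlap c d. \<forall>a b e.
        \<rho> t c x a b e = \<rho> t d (trans_map c d x) (jac c d x a) (jac c d x b) (jac c d x e))"

definition sym_bilinear :: "('v::real_vector \<Rightarrow> 'v \<Rightarrow> real) \<Rightarrow> bool" where
  "sym_bilinear b \<longleftrightarrow> bilinear b \<and> (\<forall>u w. b u w = b w u)"

definition pos_semidefinite :: "('v \<Rightarrow> 'v \<Rightarrow> real) \<Rightarrow> bool" where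
  "pos_semidefinite b \<longleftrightarrow> (\<forall>u. 0 \<le> b u u)"

definition corank_one :: "('v::real_vector \<Rightarrow> 'v \<Rightarrow> real) \<Rightarrow> bool" where
  "corank_one b \<longleftrightarrow> dim {u. \<forall>w. b u w = 0} = 1"

definition sym_cov2_family :: "real set \<Rightarrow> 'a chart set \<Rightarrow> (real \<Rightarrow> ('a, form2) field) \<Rightarrow> bool" where
  "sym_cov2_family T A h \<longleftrightarrow>
     (\<forall>t\<in>T. \<forall>c\<in>A. \<forall>x\<in>cimg c. sym_bilinear (h t c x)) \<and>
     (\<forall>u w. smooth_family T A (\<lambda>t c x. h t c x u w)) \<and>
     (\<forall>t\<in>T. \<forall>c\<in>A. \<forall>d\<in>A. \<forall>x\<in>overlap c d. \<forall>u w.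
        h t c x u w = h t d (trans_map c d x) (jac c d x u) (jac c d x w))"

text \<open>Sections of the symmetric square of the tangent bundle, as symmetric bilinear forms on
  covectors.\<close>

definition sym_contra2_family ::
  "real set \<Rightarrow> 'a chart set \<Rightarrow> (real \<Rightarrow> ('a, covector \<Rightarrow> covector \<Rightarrow> real) field) \<Rightarrow> bool" where
  "sym_contra2_family T A \<gamma> \<longleftrightarrow>
     (\<forall>t\<in>T. \<forall>c\<in>A. \<forall>x\<in>cimg c. sym_bilinear (\<gamma> t c x)) \<and>
     (\<forall>\<theta> \<kappa>. smooth_family T A (\<lambda>t c x. \<gamma> t c x \<theta> \<kappa>)) \<and>
     (\<forall>t\<in>T. \<forall>c\<in>A. \<forall>d\<in>A. \<forall>x\<in>overlap c d. \<forall>\<theta> \<kappa>.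
        \<gamma> t d (trans_map c d x) \<theta> \<kappa> =
        \<gamma> t c x (\<theta> o\<^sub>L Blinfun (jac c d x)) (\<kappa> o\<^sub>L Blinfun (jac c d x)))"

definition riemannian_metric :: "'a chart set \<Rightarrow> ('a, form2) field \<Rightarrow> bool" where
  "riemannian_metric A g \<longleftrightarrow> sym_cov2_family UNIV A (\<lambda>_. g) \<and>
     (\<forall>c\<in>A. \<forall>x\<in>cimg c. \<forall>u. u \<noteq> 0 \<longrightarrow> 0 < g c x u u)"

definition volume_form :: "'a chart set \<Rightarrow> ('a, form3) field \<Rightarrow> bool" where
  "volume_form A \<mu> \<longleftrightarrow> form3_family UNIV A (\<lambda>_. \<mu>) \<and>
     (\<forall>c\<in>A. \<forall>x\<in>cimg c. \<exists>a b e. \<mu> c x a b e \<noteq> 0)"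

section \<open>Calculus in a chart with image \<open>S\<close>\<close>

text \<open>Since the vector arguments are held constant in the chart, the coordinate vector fields
  commute and the invariant formulas for the exterior derivative, the Lie derivative and the
  Levi-Civita connection reduce to the ones below.\<close>

definition ext_deriv1 :: "R3 set \<Rightarrow> (R3 \<Rightarrow> form1) \<Rightarrow> R3 \<Rightarrow> form2" where
  "ext_deriv1 S \<alpha> x u w = D S (\<lambda>y. \<alpha> y w) x u - D S (\<lambda>y. \<alpha> y u) x w"

definition wedge12 :: "(R3 \<Rightarrow> form1) \<Rightarrow> (R3 \<Rightarrow> form2) \<Rightarrow> R3 \<Rightarrow> form3" where
  "wedge12 \<alpha> \<omega> x a b e = \<alpha> x a * \<omega> x b e + \<alpha> x b * \<omega> x e a + \<alpha> x e * \<omega> x a b"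

definition lie1 :: "R3 set \<Rightarrow> (R3 \<Rightarrow> R3) \<Rightarrow> (R3 \<Rightarrow> form1) \<Rightarrow> R3 \<Rightarrow> form1" where
  "lie1 S v \<tau> x u = D S (\<lambda>y. \<tau> y u) x (v x) + \<tau> x (D S v x u)"

definition lie3 :: "R3 set \<Rightarrow> (R3 \<Rightarrow> R3) \<Rightarrow> (R3 \<Rightarrow> form3) \<Rightarrow> R3 \<Rightarrow> form3" where
  "lie3 S v \<rho> x a b e = D S (\<lambda>y. \<rho> y a b e) x (v x)
     + \<rho> x (D S v x a) b e + \<rho> x a (D S v x b) e + \<rho> x a b (D S v x e)"

definition flat :: "(R3 \<Rightarrow> form2) \<Rightarrow> (R3 \<Rightarrow> R3) \<Rightarrow> R3 \<Rightarrow> form1" where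
  "flat g v x u = g x (v x) u"

definition sharp :: "form2 \<Rightarrow> form1 \<Rightarrow> R3" where
  "sharp b \<theta> = (THE w. \<forall>u. b w u = \<theta> u)"

text \<open>The Christoffel symbols, given by the Koszul formula for coordinate vector fields.\<close>

definition christoffel :: "R3 set \<Rightarrow> (R3 \<Rightarrow> form2) \<Rightarrow> R3 \<Rightarrow> R3 \<Rightarrow> R3 \<Rightarrow> R3" where
  "christoffel S g x u w = (THE z. \<forall>y. 2 * g x z y =
     D S (\<lambda>q. g q w y) x u + D S (\<lambda>q. g q u y) x w - D S (\<lambda>q. g q u w) x y)"

definition cov_deriv :: "R3 set \<Rightarrow> (R3 \<Rightarrow> form2) \<Rightarrow> (R3 \<Rightarrow> R3) \<Rightarrow> (R3 \<Rightarrow> R3) \<Rightarrow> R3 \<Rightarrow> R3" where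
  "cov_deriv S g v w x = D S w x (v x) + christoffel S g x (v x) (w x)"

definition curl :: "('a, form3) field \<Rightarrow> ('a, form2) field \<Rightarrow> ('a, R3) field \<Rightarrow> ('a, R3) field" where
  "curl \<mu> g v c x =
     (THE \<xi>. \<forall>u w. \<mu> c x \<xi> u w = ext_deriv1 (cimg c) (flat (g c) (v c)) x u w)"

text \<open>The restriction of \<open>\<iota>\<^sub>w\<mu>\<close> to the boundary is its pullback, hence is evaluated
  on vectors tangent to the boundary only.\<close>

definition parallel_to_boundary ::
  "'a chart set \<Rightarrow> ('a, form3) field \<Rightarrow> ('a, R3) field \<Rightarrow> bool" where
  "parallel_to_boundary A \<mu> w \<longleftrightarrow>
     (\<forall>c\<in>A. \<forall>x\<in>cimg c. x $ 1 = 0 \<longrightarrow>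
        (\<forall>a b. a $ 1 = 0 \<longrightarrow> b $ 1 = 0 \<longrightarrow> \<mu> c x (w c x) a b = 0))"

section \<open>Integration of three-forms over a compact manifold\<close>

definition partition_of_unity ::
  "'a topology \<Rightarrow> 'a chart set \<Rightarrow> 'a chart set \<Rightarrow> ('a chart \<Rightarrow> 'a \<Rightarrow> real) \<Rightarrow> bool" where
  "partition_of_unity X A F \<phi> \<longleftrightarrow>
     finite F \<and> F \<subseteq> A \<and>
     (\<forall>c\<in>F. (\<forall>d\<in>A. smooth_on (cimg d) (\<lambda>x. \<phi> c (cinv d x))) \<and>
        (\<forall>q\<in>topspace X. 0 \<le> \<phi> c q) \<and>
        X closure_of {q \<in> topspace X. \<phi> c q \<noteq> 0} \<subseteq> cdom c) \<and>
     (\<forall>q\<in>topspace X. (\<Sum>c\<in>F. \<phi> c q) = 1)"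

definition mfd_integral :: "'a topology \<Rightarrow> 'a chart set \<Rightarrow> ('a, form3) field \<Rightarrow> real" where
  "mfd_integral X A \<rho> = (THE I. \<exists>F \<phi>. partition_of_unity X A F \<phi> \<and>
     I = (\<Sum>c\<in>F. integral (cimg c)
            (\<lambda>x. \<phi> c (cinv c x) * \<rho> c x (axis 1 1) (axis 2 1) (axis 3 1))))"

section \<open>Fluids\<close>

definition ideal_fluid ::
  "'a topology \<Rightarrow> 'a chart set \<Rightarrow> real set \<Rightarrow> ('a, form3) field \<Rightarrow> (real \<Rightarrow> ('a, R3) field) \<Rightarrow>
   ('a, form2) field \<Rightarrow> (real \<Rightarrow> 'a \<Rightarrow> real) \<Rightarrow> bool" where
  "ideal_fluid X A T \<mu> v g p \<longleftrightarrow>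
     oriented_3manifold X A \<and> open T \<and> is_interval T \<and> T \<noteq> {} \<and>
     riemannian_metric A g \<and> volume_form A \<mu> \<and>
     vector_family T A v \<and> function_family T A p \<and>
     (\<forall>t\<in>T. \<forall>c\<in>A. \<forall>x\<in>cimg c.
        vector_derivative (\<lambda>s. v s c x) (at t) + cov_deriv (cimg c) (g c) (v t c) (v t c) x
          = - sharp (g c x) (D (cimg c) (\<lambda>y. p t (cinv c y)) x)) \<and>
     (\<forall>t\<in>T. \<forall>c\<in>A. \<forall>x\<in>cimg c. \<forall>a b e. lie3 (cimg c) (v t c) (\<mu> c) x a b e = 0) \<and>
     (mfd_boundary X A \<noteq> {} \<longrightarrow> (\<forall>t\<in>T. parallel_to_boundary A \<mu> (v t)))"

definition aristotelian_fluid ::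
  "'a topology \<Rightarrow> 'a chart set \<Rightarrow> real set \<Rightarrow> ('a, form3) field \<Rightarrow> (real \<Rightarrow> ('a, form1) field) \<Rightarrow>
   (real \<Rightarrow> ('a, R3) field) \<Rightarrow> ('a, form2) field \<Rightarrow> (real \<Rightarrow> 'a \<Rightarrow> real) \<Rightarrow>
   (real \<Rightarrow> ('a, form2) field) \<Rightarrow> (real \<Rightarrow> ('a, covector \<Rightarrow> covector \<Rightarrow> real) field) \<Rightarrow> bool" where
  "aristotelian_fluid X A T \<mu> \<tau> v g p h \<gamma> \<longleftrightarrow>
     ideal_fluid X A T \<mu> v g p \<and>
     form1_family T A \<tau> \<and> sym_cov2_family T A h \<and> sym_contra2_family T A \<gamma> \<and>
     (\<forall>t\<in>T. \<forall>c\<in>A. \<forall>x\<in>cimg c.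
        (\<exists>u. \<tau> t c x u \<noteq> 0) \<and>
        \<tau> t c x (v t c x) = 1 \<and>
        pos_semidefinite (h t c x) \<and> corank_one (h t c x) \<and>
        (\<forall>u. h t c x (v t c x) u = 0) \<and>
        pos_semidefinite (\<gamma> t c x) \<and> corank_one (\<gamma> t c x) \<and>
        (\<forall>\<kappa>. \<gamma> t c x (Blinfun (\<tau> t c x)) \<kappa> = 0) \<and>
        (\<forall>u. \<tau> t c x u = 0 \<longrightarrow> g c x (v t c x) u = 0) \<and>
        (\<forall>u w. \<tau> t c x u = 0 \<longrightarrow> \<tau> t c x w = 0 \<longrightarrow> h t c x u w = g c x u w) \<and>
        (\<forall>\<theta> \<kappa>. blinfun_apply \<theta> (v t c x) = 0 \<longrightarrow> blinfun_apply \<kappa> (v t c x) = 0 \<longrightarrow>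
           \<gamma> t c x \<theta> \<kappa> =
             g c x (sharp (g c x) (blinfun_apply \<theta>)) (sharp (g c x) (blinfun_apply \<kappa>))) \<and>
        (\<forall>a b e. wedge12 (\<tau> t c) (ext_deriv1 (cimg c) (\<tau> t c)) x a b e = 0))"

section \<open>The Godbillon-Vey number\<close>

definition alpha_form ::
  "('a, form1) field \<Rightarrow> ('a, R3) field \<Rightarrow> ('a, form2) field \<Rightarrow> ('a, form1) field" where
  "alpha_form \<tau> v g c x u =
     lie1 (cimg c) (v c) (\<tau> c) x u - D (cimg c) (\<lambda>y. ln (g c y (v c y) (v c y))) x u"

definition gv_form ::
  "('a, form1) field \<Rightarrow> ('a, R3) field \<Rightarrow> ('a, form2) field \<Rightarrow> ('a, form3) field" where
  "gv_form \<tau> v g c = wedge12 (alpha_form \<tau> v g c) (ext_deriv1 (cimg c) (alpha_form \<tau> v g c))"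

definition gv_number ::
  "'a topology \<Rightarrow> 'a chart set \<Rightarrow> ('a, form1) field \<Rightarrow> ('a, R3) field \<Rightarrow> ('a, form2) field \<Rightarrow> real" where
  "gv_number X A \<tau> v g = mfd_integral X A (gv_form \<tau> v g)"

text \<open>The operator \<open>\<partial>/\<partial>t + L\<^sub>v\<close> on three-forms.\<close>

definition material_deriv3 ::
  "(real \<Rightarrow> ('a, R3) field) \<Rightarrow> (real \<Rightarrow> ('a, form3) field) \<Rightarrow> real \<Rightarrow> ('a, form3) field" where
  "material_deriv3 v \<rho> t c x a b e =
     deriv (\<lambda>s. \<rho> s c x a b e) t + lie3 (cimg c) (v t c) (\<rho> t c) x a b e"

definition gv_rate ::
  "'a topology \<Rightarrow> 'a chart set \<Rightarrow> (real \<Rightarrow> ('a, form1) field) \<Rightarrow> (real \<Rightarrow> ('a, R3) field) \<Rightarrow>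
   ('a, form2) field \<Rightarrow> real \<Rightarrow> real" where
  "gv_rate X A \<tau> v g t =
     mfd_integral X A (material_deriv3 v (\<lambda>s. gv_form (\<tau> s) (v s) g) t)"

end

theory Submission
  imports Defs
begin

text \<open>Write \<open>\<theta> = v\<^sup>\<flat>\<close>, \<open>s = g(v, v)\<close> and normalise \<open>\<alpha>\<close> by \<open>\<alpha>(v) = 0\<close>, so that \<open>d\<theta> = \<theta> \<and> \<alpha>\<close> and
  \<open>d\<alpha> = \<theta> \<and> \<beta>\<close>; the form \<open>\<alpha>\<^sub>v\<close> differs from \<open>\<alpha>\<close> by a multiple of \<open>\<theta>\<close>, which changes
  \<open>\<alpha> \<and> d\<alpha>\<close> by an exact form only. The Euler equation reads \<open>(\<partial>\<^sub>t + L\<^sub>v)\<theta> = dP\<close> with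
  \<open>P = s/2 - p\<close>. Hence \<open>\<xi>(P) = 0\<close>, and \<open>\<partial>\<^sub>t(\<alpha> \<and> d\<alpha>)\<close> equals
  \<open>2 dP \<and> \<alpha> \<and> \<beta> = -2a \<alpha> \<and> d\<alpha>\<close> up to an exact form, where \<open>dP = a\<theta> + b\<alpha>\<close> at points with
  \<open>\<xi> \<noteq> 0\<close>.

  The integral of \<open>a \<alpha> \<and> d\<alpha>\<close> vanishes, although the form has no evident smooth primitive. From
  \<open>d(dP) = 0\<close> one gets \<open>b \<alpha> \<and> d\<alpha> = -da \<and> d\<theta>\<close> and \<open>\<xi>(b) = 0\<close>. So where \<open>b \<noteq> 0\<close> the form is
  \<open>-d(a\<^sup>2/(2b) d\<theta>)\<close>, and the integral over \<open>{b \<noteq> 0}\<close> is the limit of integrals of exact forms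
  with cut-off functions of \<open>b\<close>. On \<open>{b = 0}\<close> the equation \<open>d(da) = 0\<close> gives
  \<open>a \<alpha> \<and> d\<alpha> = -dm \<and> d\<theta> - 2 v(b)/s \<alpha> \<and> d\<alpha>\<close> with \<open>m = v(a)/s\<close>; the first term integrates to zero
  over \<open>{b = 0}\<close> by cutting off in \<open>b\<close> again, the second because \<open>v\<close> preserves the volume and
  derivatives of \<open>b\<close> integrate to zero over the zero set of \<open>b\<close>. Where \<open>\<xi> = 0\<close> one has
  \<open>\<alpha> = 0\<close>. If there is a boundary, \<open>v\<close> and \<open>\<xi>\<close> are tangent to it, so \<open>\<alpha>\<close> restricts to zero on it and
  no boundary terms occur.\<close>

section \<open>Smooth maps\<close>

text \<open>The coefficient b is not smooth at the zeros of \<xi>, so it is carried as a quotient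
  M/N of globally smooth functions, N being a squared length of \<xi>. Since N \<xi>(M) = M
  \<xi>(N), functions of (M, N) that are homogeneous of degree zero are formally constant along
  \<xi>; this is what makes the cut-offs in b compatible with integration by parts along \<xi>. All
  pointwise identities are cleared of denominators, so that they also hold where \<xi> = 0. The zero
  set of b may have positive measure and cannot be discarded; there a^2/(2b) is meaningless, and one
  more derivative, d(da) = 0, has to be used.

  The function P arises by lowering the index in the Euler equation: the covector of \<nabla>v along
  v is the Lie derivative of \<theta> along v minus d(s/2). That \<xi>(P) = 0 comes from
  differentiating the integrability condition \<theta> \<and> d\<theta> = 0 in time.

  The integral over the manifold is a definite description ranging over all partitions of unity, so
  existence of a partition and independence of its choice come before any evaluation.\<close>

lemma has_derivative_within_cong:
  assumes "\<And>y. y \<in> S \<Longrightarrow> f y = g y" "x \<in> S"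
  shows "(f has_derivative F) (at x within S) \<longleftrightarrow> (g has_derivative F) (at x within S)"
  using assms has_derivative_transform[of x S f g F] has_derivative_transform[of x S g f F] by auto

lemma frechet_derivative_within_cong:
  assumes "\<And>y. y \<in> S \<Longrightarrow> f y = g y" "x \<in> S"
  shows "frechet_derivative f (at x within S) = frechet_derivative g (at x within S)"
  using has_derivative_within_cong[OF assms] by (simp add: frechet_derivative_def)

lemma frechet_within_open:
  assumes "open U" "x \<in> U" "(f has_derivative f') (at x)"
  shows "frechet_derivative f (at x within U) = f'"
  using assms by (metis at_within_open frechet_derivative_at)

lemma Ck_on_cong:
  assumes "\<And>y. y \<in> U \<Longrightarrow> f y = g y"
  shows "Ck_on k U f = Ck_on k U g"
  using assms
proof (induction k arbitrary: f g)
  case 0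
  then show ?case by (simp cong: continuous_on_cong)
next
  case (Suc k)
  have "f differentiable_on U \<longleftrightarrow> g differentiable_on U"
    unfolding differentiable_on_def differentiable_def
    by (rule ball_cong) (use Suc.prems has_derivative_within_cong[of U f g] in auto)
  moreover have "Ck_on k U (\<lambda>x. frechet_derivative f (at x within U) u)
      = Ck_on k U (\<lambda>x. frechet_derivative g (at x within U) u)" for u
    by (rule Suc.IH) (rule fun_cong[OF frechet_derivative_within_cong[OF Suc.prems]])
  ultimately show ?case by simp
qed

lemma Ck_on_SucI:
  assumes "open U" "\<And>x. x \<in> U \<Longrightarrow> (f has_derivative f' x) (at x)"
    "\<And>u. Ck_on k U (\<lambda>x. f' x u)"
  shows "Ck_on (Suc k) U f"
proof -
  have "f differentiable_on U"
    using assms(2) by (meson differentiable_at_imp_differentiable_on differentiable_def)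
  moreover have "Ck_on k U (\<lambda>x. frechet_derivative f (at x within U) u)" for u
    using assms frechet_within_open[OF assms(1) _ assms(2)] by (subst Ck_on_cong[where g="\<lambda>x. f' x u"]) auto
  ultimately show ?thesis by simp
qed

lemma Ck_on_SucD:
  assumes "open U" "Ck_on (Suc k) U f" "x \<in> U"
  shows "(f has_derivative frechet_derivative f (at x)) (at x)"
  using assms by (metis Ck_on.simps(2) at_within_open differentiable_on_def frechet_derivative_works)

lemma Ck_on_frechet:
  assumes "open U" "Ck_on (Suc k) U f"
  shows "Ck_on k U (\<lambda>x. frechet_derivative f (at x) u)"
proof -
  have "Ck_on k U (\<lambda>x. frechet_derivative f (at x within U) u)" using assms by simp
  then show ?thesis
    by (rule Ck_on_cong[THEN iffD1, rotated]) (metis assms(1) at_within_open)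
qed

lemma Ck_on_Suc_imp:
  assumes "Ck_on (Suc k) U f"
  shows "Ck_on k U f"
  using assms
proof (induction k arbitrary: f)
  case 0
  then show ?case by (simp add: differentiable_imp_continuous_on)
next
  case (Suc k)
  then show ?case by (metis Ck_on.simps(2))
qed

lemma Ck_on_subset:
  assumes "open U" "open V" "V \<subseteq> U" "Ck_on k U f"
  shows "Ck_on k V f"
  using assms(4)
proof (induction k arbitrary: f)
  case 0
  then show ?case using assms(3) continuous_on_subset by auto
next
  case (Suc k)
  show ?case
    by (rule Ck_on_SucI[OF assms(2)])
      (use Suc assms Ck_on_SucD Ck_on_frechet in blast)+
qed

lemma Ck_on_const: "open U \<Longrightarrow> Ck_on k U (\<lambda>x. c)"
proof (induction k arbitrary: c)
  case (Suc k)
  show ?case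
    by (rule Ck_on_SucI[OF Suc.prems]) (auto intro!: derivative_eq_intros Suc)
qed auto

lemma Ck_on_bounded_linear:
  assumes "bounded_linear L" "open U" "Ck_on k U f"
  shows "Ck_on k U (\<lambda>x. L (f x))"
  using assms(3)
proof (induction k arbitrary: f)
  case 0
  then show ?case using assms(1) by (simp add: linear_continuous_on_compose bounded_linear.linear bounded_linear.continuous_on)
next
  case (Suc k)
  show ?case
  proof (rule Ck_on_SucI[OF assms(2)])
    show "((\<lambda>x. L (f x)) has_derivative (\<lambda>u. L (frechet_derivative f (at x) u))) (at x)" if "x \<in> U" for x
      using bounded_linear.has_derivative[OF assms(1) Ck_on_SucD[OF assms(2) Suc.prems that]] .
    show "Ck_on k U (\<lambda>x. L (frechet_derivative f (at x) u))" for u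
      using Suc assms by (intro Suc.IH Ck_on_frechet)
  qed
qed

lemma Ck_on_id: "open U \<Longrightarrow> Ck_on k U (\<lambda>x. x)"
proof (cases k)
  case (Suc n)
  assume "open U" then show ?thesis unfolding Suc
    by (intro Ck_on_SucI) (auto intro!: derivative_eq_intros Ck_on_const)
qed auto

lemma Ck_on_add:
  assumes "open U" "Ck_on k U f" "Ck_on k U g"
  shows "Ck_on k U (\<lambda>x. f x + g x)"
  using assms(2,3)
proof (induction k arbitrary: f g)
  case 0
  then show ?case by (simp add: continuous_on_add)
next
  case (Suc k)
  show ?case
  proof (rule Ck_on_SucI[OF assms(1)])
    show "((\<lambda>x. f x + g x) has_derivative (\<lambda>u. frechet_derivative f (at x) u + frechet_derivative g (at x) u)) (at x)"
      if "x \<in> U" for x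
      using that assms(1) Suc.prems by (intro has_derivative_add Ck_on_SucD)
    show "Ck_on k U (\<lambda>x. frechet_derivative f (at x) u + frechet_derivative g (at x) u)" for u
      using Suc assms by (intro Suc.IH Ck_on_frechet)
  qed
qed

lemma Ck_on_bilinear:
  assumes B: "bounded_bilinear B" and "open U" "Ck_on k U f" "Ck_on k U g"
  shows "Ck_on k U (\<lambda>x. B (f x) (g x))"
  using assms(3,4)
proof (induction k arbitrary: f g)
  case 0
  then show ?case using bounded_bilinear.continuous_on[OF B] by simp
next
  case (Suc k)
  show ?case
  proof (rule Ck_on_SucI[OF assms(2)])
    show "((\<lambda>x. B (f x) (g x)) has_derivative (\<lambda>u. B (f x) (frechet_derivative g (at x) u)
        + B (frechet_derivative f (at x) u) (g x))) (at x)"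
      if "x \<in> U" for x
      using that assms Suc.prems by (intro bounded_bilinear.FDERIV[OF B] Ck_on_SucD)
    show "Ck_on k U (\<lambda>x. B (f x) (frechet_derivative g (at x) u) + B (frechet_derivative f (at x) u) (g x))" for u
      using Suc assms by (intro Ck_on_add Suc.IH Ck_on_frechet) (auto intro: Ck_on_Suc_imp simp del: Ck_on.simps)
  qed
qed

lemma Ck_on_sum:
  assumes "open U" "\<And>i. i \<in> I \<Longrightarrow> Ck_on k U (f i)"
  shows "Ck_on k U (\<lambda>x. \<Sum>i\<in>I. f i x)"
proof (cases "finite I")
  case True
  then show ?thesis using assms(2)
    by (induction I) (simp_all add: Ck_on_const Ck_on_add assms(1) del: Ck_on.simps)
qed (simp add: Ck_on_const assms(1) del: Ck_on.simps)

text \<open>The chain rule differentiates \<open>G\<close> in the direction F'(x) u, which varies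
  with x, whereas \<open>Ck_on\<close> controls derivatives in fixed directions only. Expanding that
  direction in the basis gives a sum of products to which the induction hypothesis applies.\<close>

lemma Ck_on_compose:
  fixes G :: "'b::euclidean_space \<Rightarrow> 'c::real_normed_vector" and F :: "'a::euclidean_space \<Rightarrow> 'b"
  assumes "open U" "open V" "F ` U \<subseteq> V" "Ck_on k V G" "Ck_on k U F"
  shows "Ck_on k U (\<lambda>x. G (F x))"
  using assms(4,5)
proof (induction k arbitrary: G)
  case 0
  then show ?case using assms(3) continuous_on_compose2 by fastforce
next
  case (Suc k)
  show ?case
  proof (rule Ck_on_SucI[OF assms(1)])
    fix x assume x: "x \<in> U"
    have G: "(G has_derivative frechet_derivative G (at (F x))) (at (F x))"
      using Ck_on_SucD[OF assms(2) Suc.prems(1)] x assms(3) by blast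
    have F: "(F has_derivative frechet_derivative F (at x)) (at x)"
      using Ck_on_SucD[OF assms(1) Suc.prems(2) x] .
    have lin: "linear (frechet_derivative G (at (F x)))"
      using G has_derivative_linear by blast
    have "frechet_derivative G (at (F x)) (frechet_derivative F (at x) u)
      = (\<Sum>i\<in>Basis. (frechet_derivative F (at x) u \<bullet> i) *\<^sub>R frechet_derivative G (at (F x)) i)" for u
      by (subst (1) euclidean_representation[symmetric, of "frechet_derivative F (at x) u"])
        (simp add: linear_sum[OF lin] linear_cmul[OF lin])
    then show "((\<lambda>x. G (F x)) has_derivative
        (\<lambda>u. \<Sum>i\<in>Basis. (frechet_derivative F (at x) u \<bullet> i) *\<^sub>R frechet_derivative G (at (F x)) i)) (at x)"
      using has_derivative_compose[OF F G] by simp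
  next
    fix u
    show "Ck_on k U (\<lambda>x. \<Sum>i\<in>Basis. (frechet_derivative F (at x) u \<bullet> i) *\<^sub>R frechet_derivative G (at (F x)) i)"
      by (intro Ck_on_sum assms(1) Ck_on_bilinear[OF bounded_bilinear_scaleR] Suc.IH
          Ck_on_bounded_linear[OF bounded_linear_inner_left] Ck_on_frechet assms Suc.prems Ck_on_Suc_imp[OF Suc.prems(2)])
  qed
qed

text \<open>The derivative is a polynomial in the function itself, so the induction closes without a
  formula for the higher derivatives.\<close>

lemma Ck_on_inverse: "Ck_on k (-{0::real}) inverse"
proof (induction k)
  case 0
  then show ?case by (simp add: continuous_on_inverse)
next
  case (Suc k)
  show ?case
  proof (rule Ck_on_SucI)
    show "(inverse has_derivative (\<lambda>u. - (inverse x * inverse x) * u)) (at x)" if "x \<in> -{0}" for x :: real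
      using that by (auto intro!: derivative_eq_intros simp: ac_simps)
    have "Ck_on k (-{0::real}) (\<lambda>x. (-u) *\<^sub>R (inverse x * inverse x))" for u
      by (intro Ck_on_bounded_linear[OF bounded_linear_scaleR_right] Ck_on_bilinear[OF bounded_bilinear_mult] Suc) auto
    then show "Ck_on k (-{0::real}) (\<lambda>x. - (inverse x * inverse x) * u)" for u
      by (simp add: algebra_simps)
  qed auto
qed

section \<open>Smooth functions on sets that need not be open\<close>

lemma smooth_onI:
  assumes "\<And>x. x \<in> S \<Longrightarrow> \<exists>U F. open U \<and> x \<in> U \<and> (\<forall>k. Ck_on k U F) \<and> (\<forall>y\<in>S \<inter> U. F y = f y)"
  shows "smooth_on S f"
  using assms by (simp add: smooth_on_def)

lemma smooth_onE:
  assumes "smooth_on S f" "x \<in> S"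
  obtains U F where "open U" "x \<in> U" "\<And>k. Ck_on k U F" "\<And>y. y \<in> S \<Longrightarrow> y \<in> U \<Longrightarrow> F y = f y"
  using assms unfolding smooth_on_def by (metis IntI)

lemma smooth_on_open:
  assumes "open U" "\<And>k. Ck_on k U F"
  shows "smooth_on U F"
  using assms by (intro smooth_onI) auto

lemma smooth_on_subset:
  assumes "smooth_on S f" "S' \<subseteq> S"
  shows "smooth_on S' f"
proof (rule smooth_onI)
  fix x assume "x \<in> S'"
  then obtain U F where "open U" "x \<in> U" "\<And>k. Ck_on k U F" "\<And>y. y \<in> S \<Longrightarrow> y \<in> U \<Longrightarrow> F y = f y"
    using smooth_onE[OF assms(1)] assms(2) by blast
  then show "\<exists>U F. open U \<and> x \<in> U \<and> (\<forall>k. Ck_on k U F) \<and> (\<forall>y\<in>S' \<inter> U. F y = f y)"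
    using assms(2) by (intro exI[of _ U] exI[of _ F]) auto
qed

lemma smooth_on_cong:
  assumes "\<And>y. y \<in> S \<Longrightarrow> f y = g y"
  shows "smooth_on S f = smooth_on S g"
  using assms unfolding smooth_on_def by simp

lemma smooth_on_const: "smooth_on S (\<lambda>x. c)"
  by (intro smooth_onI exI[of _ UNIV] exI[of _ "\<lambda>x. c"]) (auto intro: Ck_on_const simp del: Ck_on.simps)

lemma smooth_on_id: "smooth_on S (\<lambda>x. x)"
  by (intro smooth_onI exI[of _ UNIV] exI[of _ "\<lambda>x. x"]) (auto intro: Ck_on_id simp del: Ck_on.simps)

lemma smooth_on_bounded_linear:
  assumes "bounded_linear L" "smooth_on S f"
  shows "smooth_on S (\<lambda>x. L (f x))"
proof (rule smooth_onI)
  fix x assume "x \<in> S"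
  then obtain U F where "open U" "x \<in> U" "\<And>k. Ck_on k U F" "\<And>y. y \<in> S \<Longrightarrow> y \<in> U \<Longrightarrow> F y = f y"
    using smooth_onE assms(2) by metis
  then show "\<exists>U F. open U \<and> x \<in> U \<and> (\<forall>k. Ck_on k U F) \<and> (\<forall>y\<in>S \<inter> U. F y = L (f y))"
    using assms(1) by (intro exI[of _ U] exI[of _ "\<lambda>x. L (F x)"]) (auto intro: Ck_on_bounded_linear simp del: Ck_on.simps)
qed

lemma smooth_on_bilinear:
  assumes B: "bounded_bilinear B" and "smooth_on S f" "smooth_on S g"
  shows "smooth_on S (\<lambda>x. B (f x) (g x))"
proof (rule smooth_onI)
  fix x assume x: "x \<in> S"
  obtain U F where U: "open U" "x \<in> U" "\<And>k. Ck_on k U F" "\<And>y. y \<in> S \<Longrightarrow> y \<in> U \<Longrightarrow> F y = f y"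
    using smooth_onE[OF assms(2) x] by metis
  obtain V G where V: "open V" "x \<in> V" "\<And>k. Ck_on k V G" "\<And>y. y \<in> S \<Longrightarrow> y \<in> V \<Longrightarrow> G y = g y"
    using smooth_onE[OF assms(3) x] by metis
  have "Ck_on k (U \<inter> V) (\<lambda>x. B (F x) (G x))" for k
    by (intro Ck_on_bilinear[OF B] open_Int U V Ck_on_subset[OF _ _ _ U(3)] Ck_on_subset[OF _ _ _ V(3)]) auto
  then show "\<exists>U F. open U \<and> x \<in> U \<and> (\<forall>k. Ck_on k U F) \<and> (\<forall>y\<in>S \<inter> U. F y = B (f y) (g y))"
    using U V by (intro exI[of _ "U \<inter> V"] exI[of _ "\<lambda>x. B (F x) (G x)"]) auto
qed

lemma smooth_on_add:
  assumes "smooth_on S f" "smooth_on S g"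
  shows "smooth_on S (\<lambda>x. f x + g x)"
proof (rule smooth_onI)
  fix x assume x: "x \<in> S"
  obtain U F where U: "open U" "x \<in> U" "\<And>k. Ck_on k U F" "\<And>y. y \<in> S \<Longrightarrow> y \<in> U \<Longrightarrow> F y = f y"
    using smooth_onE[OF assms(1) x] by metis
  obtain V G where V: "open V" "x \<in> V" "\<And>k. Ck_on k V G" "\<And>y. y \<in> S \<Longrightarrow> y \<in> V \<Longrightarrow> G y = g y"
    using smooth_onE[OF assms(2) x] by metis
  have "Ck_on k (U \<inter> V) (\<lambda>x. F x + G x)" for k
    by (intro Ck_on_add open_Int U V Ck_on_subset[OF _ _ _ U(3)] Ck_on_subset[OF _ _ _ V(3)]) auto
  then show "\<exists>U F. open U \<and> x \<in> U \<and> (\<forall>k. Ck_on k U F) \<and> (\<forall>y\<in>S \<inter> U. F y = f y + g y)"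
    using U V by (intro exI[of _ "U \<inter> V"] exI[of _ "\<lambda>x. F x + G x"]) auto
qed

lemma smooth_on_imp_continuous_on:
  assumes "smooth_on S f"
  shows "continuous_on S f"
  unfolding continuous_on_eq_continuous_within
proof
  fix x assume x: "x \<in> S"
  obtain U F where U: "open U" "x \<in> U" "\<And>k. Ck_on k U F" "\<And>y. y \<in> S \<Longrightarrow> y \<in> U \<Longrightarrow> F y = f y"
    using smooth_onE[OF assms(1) x] by metis
  have "continuous_on U F" using U(3)[of 0] by simp
  then have "continuous (at x) F" using U by (simp add: continuous_on_eq_continuous_at)
  then have F: "continuous (at x within S) F" using continuous_at_imp_continuous_within by blast
  obtain e where "e > 0" "ball x e \<subseteq> U" using U openE by metis
  then show "continuous (at x within S) f"
    using U x by (intro continuous_transform_within[OF F \<open>e > 0\<close> x]) (auto simp: dist_commute subset_iff)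
qed

lemma smooth_on_compose:
  fixes G :: "'b::euclidean_space \<Rightarrow> 'c::real_normed_vector" and f :: "'a::euclidean_space \<Rightarrow> 'b"
  assumes "smooth_on V G" "smooth_on S f" "f ` S \<subseteq> V"
  shows "smooth_on S (\<lambda>x. G (f x))"
proof (rule smooth_onI)
  fix x assume x: "x \<in> S"
  obtain U F where U: "open U" "x \<in> U" "\<And>k. Ck_on k U F" "\<And>y. y \<in> S \<Longrightarrow> y \<in> U \<Longrightarrow> F y = f y"
    using smooth_onE[OF assms(2) x] by metis
  have "f x \<in> V" using x assms(3) by auto
  then obtain W K where W: "open W" "f x \<in> W" "\<And>k. Ck_on k W K" "\<And>y. y \<in> V \<Longrightarrow> y \<in> W \<Longrightarrow> K y = G y"
    using smooth_onE[OF assms(1)] by metis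
  have "continuous_on U F" using U(3)[of 0] by simp
  then have op: "open (U \<inter> F -` W)" using U W by (simp add: continuous_open_preimage)
  have "Ck_on k (U \<inter> F -` W) (\<lambda>x. K (F x))" for k
    by (rule Ck_on_compose[OF op W(1) _ W(3)]) (auto intro: Ck_on_subset[OF U(1) op _ U(3)] simp del: Ck_on.simps)
  then show "\<exists>U F. open U \<and> x \<in> U \<and> (\<forall>k. Ck_on k U F) \<and> (\<forall>y\<in>S \<inter> U. F y = G (f y))"
    using op U W x assms(3)
    by (intro exI[of _ "U \<inter> F -` W"] exI[of _ "\<lambda>x. K (F x)"]) (fastforce simp del: Ck_on.simps)
qed

lemma smooth_on_mult: "smooth_on S f \<Longrightarrow> smooth_on S g \<Longrightarrow> smooth_on S (\<lambda>x. f x * g x :: real)"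
  by (rule smooth_on_bilinear[OF bounded_bilinear_mult])

lemma smooth_on_scaleR: "smooth_on S f \<Longrightarrow> smooth_on S g \<Longrightarrow> smooth_on S (\<lambda>x. f x *\<^sub>R g x)"
  by (rule smooth_on_bilinear[OF bounded_bilinear_scaleR])

lemma smooth_on_minus: "smooth_on S f \<Longrightarrow> smooth_on S (\<lambda>x. - f x)"
  by (rule smooth_on_bounded_linear[OF bounded_linear_minus[OF bounded_linear_ident]])

lemma smooth_on_diff: "smooth_on S f \<Longrightarrow> smooth_on S g \<Longrightarrow> smooth_on S (\<lambda>x. f x - g x)"
  using smooth_on_add[of S f "\<lambda>x. - g x"] smooth_on_minus by fastforce

lemma smooth_on_sum: "(\<And>i. i \<in> I \<Longrightarrow> smooth_on S (f i)) \<Longrightarrow> smooth_on S (\<lambda>x. \<Sum>i\<in>I. f i x)"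
  by (induction I rule: infinite_finite_induct) (auto intro: smooth_on_const smooth_on_add)

lemma smooth_on_inverse:
  assumes "smooth_on S f" "\<And>x. x \<in> S \<Longrightarrow> f x \<noteq> (0::real)"
  shows "smooth_on S (\<lambda>x. inverse (f x))"
  by (rule smooth_on_compose[OF smooth_on_open[OF _ Ck_on_inverse] assms(1)]) (use assms in auto)

lemma smooth_on_divide:
  "smooth_on S f \<Longrightarrow> smooth_on S g \<Longrightarrow> (\<And>x. x \<in> S \<Longrightarrow> g x \<noteq> (0::real)) \<Longrightarrow> smooth_on S (\<lambda>x. f x / g x)"
  unfolding divide_inverse by (intro smooth_on_mult smooth_on_inverse)

lemma smooth_on_power: "smooth_on S f \<Longrightarrow> smooth_on S (\<lambda>x. f x ^ n :: real)"
  by (induction n) (auto intro: smooth_on_const smooth_on_mult)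

lemma smooth_on_component:
  fixes f :: "_ \<Rightarrow> real^'n"
  shows "smooth_on S f \<Longrightarrow> smooth_on S (\<lambda>x. f x $ i)"
  by (rule smooth_on_bounded_linear[OF bounded_linear_vec_nth])

lemma smooth_on_vec:
  fixes f :: "_ \<Rightarrow> real^'n"
  assumes "\<And>i. smooth_on S (\<lambda>x. f x $ i)"
  shows "smooth_on S f"
proof -
  have eq: "f = (\<lambda>x. \<Sum>i\<in>UNIV. f x $ i *\<^sub>R axis i 1)"
    by (auto simp: basis_expansion scalar_mult_eq_scaleR[symmetric])
  show ?thesis
    by (subst eq) (intro smooth_on_sum smooth_on_scaleR assms smooth_on_const)
qed

lemmas smooth_intros = smooth_on_const smooth_on_id smooth_on_add smooth_on_mult smooth_on_scaleR
  smooth_on_minus smooth_on_diff smooth_on_sum smooth_on_power smooth_on_component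

section \<open>Derivatives on sets with boundary, and one-parameter families\<close>

text \<open>The condition makes derivatives within \<open>S\<close> unique; otherwise \<open>frechet_derivative\<close> would be
  an arbitrary choice.\<close>

definition fat :: "'a::euclidean_space set \<Rightarrow> bool" where
  "fat S \<longleftrightarrow> (\<forall>x\<in>S. \<forall>i\<in>Basis. \<forall>e>0. \<exists>d. 0 < \<bar>d\<bar> \<and> \<bar>d\<bar> < e \<and> x + d *\<^sub>R i \<in> S)"

lemma frechet_fat:
  assumes "fat S" "x \<in> S" "(f has_derivative f') (at x within S)"
  shows "frechet_derivative f (at x within S) = f'"
proof (rule frechet_derivative_unique_within)
  show "(f has_derivative frechet_derivative f (at x within S)) (at x within S)"
    using assms(3) differentiableI frechet_derivative_works by blast
qed (use assms in \<open>auto simp: fat_def\<close>)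

lemma fat_open: "open U \<Longrightarrow> fat U"
  unfolding fat_def
proof (intro ballI allI impI)
  fix x and i :: 'a and e :: real assume *: "open U" "x \<in> U" "i \<in> Basis" "0 < e"
  then obtain r where r: "r > 0" "ball x r \<subseteq> U" by (meson openE)
  then show "\<exists>d. 0 < \<bar>d\<bar> \<and> \<bar>d\<bar> < e \<and> x + d *\<^sub>R i \<in> U"
    using * by (intro exI[of _ "min e r / 2"]) (auto simp: subset_iff dist_norm)
qed

lemma fat_Times:
  assumes "fat S" "fat S'"
  shows "fat (S \<times> S')"
  unfolding fat_def
proof (intro ballI allI impI)
  fix x i :: "'a \<times> 'b" and e :: real assume *: "x \<in> S \<times> S'" "i \<in> Basis" "0 < e"
  from *(2) consider j where "j \<in> Basis" "i = (j, 0)" | j where "j \<in> Basis" "i = (0, j)"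
    by (auto simp: Basis_prod_def)
  then show "\<exists>d. 0 < \<bar>d\<bar> \<and> \<bar>d\<bar> < e \<and> x + d *\<^sub>R i \<in> S \<times> S'"
  proof cases
    case 1
    then obtain d where "0 < \<bar>d\<bar>" "\<bar>d\<bar> < e" "fst x + d *\<^sub>R j \<in> S"
      using assms(1) * unfolding fat_def by (metis mem_Times_iff)
    then show ?thesis using * 1 by (intro exI[of _ d]) (auto simp: mem_Times_iff)
  next
    case 2
    then obtain d where "0 < \<bar>d\<bar>" "\<bar>d\<bar> < e" "snd x + d *\<^sub>R j \<in> S'"
      using assms(2) * unfolding fat_def by (metis mem_Times_iff)
    then show ?thesis using * 2 by (intro exI[of _ d]) (auto simp: mem_Times_iff)
  qed
qed

text \<open>Moving by a positive amount along any coordinate axis never leaves the half-space, so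
  boundary points too are approached along every basis direction.\<close>

lemma fat_half_space:
  assumes "openin (top_of_set half_space) S"
  shows "fat S"
  unfolding fat_def
proof (intro ballI allI impI)
  fix x i :: R3 and e :: real assume *: "x \<in> S" "i \<in> Basis" "0 < e"
  obtain U where U: "open U" "S = half_space \<inter> U" using assms by (auto simp: openin_open)
  then obtain r where r: "r > 0" "ball x r \<subseteq> U" using * by (meson IntD2 openE)
  have "0 \<le> i $ 1" using *(2) by (auto simp: Basis_vec_def axis_def)
  moreover have "0 \<le> x $ 1" using * U by (auto simp: half_space_def)
  ultimately show "\<exists>d. 0 < \<bar>d\<bar> \<and> \<bar>d\<bar> < e \<and> x + d *\<^sub>R i \<in> S"
    using r U(2) * by (intro exI[of _ "min e r / 2"]) (auto simp: subset_iff dist_norm half_space_def)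
qed

lemma has_derivative_extension:
  assumes "open U" "x \<in> U" "x \<in> S" "\<And>y. y \<in> S \<Longrightarrow> y \<in> U \<Longrightarrow> F y = f y" "(F has_derivative F') (at x)"
  shows "(f has_derivative F') (at x within S)"
proof -
  obtain e where e: "e > 0" "ball x e \<subseteq> U" using assms openE by metis
  show ?thesis
    by (rule has_derivative_transform_within[OF has_derivative_at_withinI[OF assms(5)] e(1) assms(3)])
      (use e assms in \<open>auto simp: subset_iff dist_commute\<close>)
qed

lemma smooth_on_has_derivative:
  assumes "smooth_on S f" "x \<in> S"
  shows "(f has_derivative frechet_derivative f (at x within S)) (at x within S)"
proof -
  obtain U F where U: "open U" "x \<in> U" "\<And>k. Ck_on k U F" "\<And>y. y \<in> S \<Longrightarrow> y \<in> U \<Longrightarrow> F y = f y"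
    using smooth_onE[OF assms] by metis
  then show ?thesis
    using has_derivative_extension[OF U(1,2) assms(2) U(4) Ck_on_SucD[OF U(1) U(3) U(2)]]
    using differentiableI frechet_derivative_works by blast
qed

lemma frechet_extension:
  assumes "fat S" "open U" "\<And>k. Ck_on k U F" "\<And>y. y \<in> S \<Longrightarrow> y \<in> U \<Longrightarrow> F y = f y" "x \<in> S" "x \<in> U"
  shows "frechet_derivative f (at x within S) = frechet_derivative F (at x)"
  by (rule frechet_fat[OF assms(1,5) has_derivative_extension[OF assms(2,6,5,4) Ck_on_SucD[OF assms(2,3,6)]]])

text \<open>On a fat set the derivative within the set does not depend on the chosen extension, so
  the derivative of a local smooth extension is a local smooth extension of the derivative.\<close>

lemma smooth_on_frechet:
  assumes "fat S" "smooth_on S f"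
  shows "smooth_on S (\<lambda>x. frechet_derivative f (at x within S) u)"
proof (rule smooth_onI)
  fix x assume x: "x \<in> S"
  obtain U F where U: "open U" "x \<in> U" "\<And>k. Ck_on k U F" "\<And>y. y \<in> S \<Longrightarrow> y \<in> U \<Longrightarrow> F y = f y"
    using smooth_onE[OF assms(2) x] by metis
  have "Ck_on k U (\<lambda>x. frechet_derivative F (at x) u)" for k
    by (rule Ck_on_frechet[OF U(1) U(3)])
  then show "\<exists>U F. open U \<and> x \<in> U \<and> (\<forall>k. Ck_on k U F) \<and> (\<forall>y\<in>S \<inter> U. F y = frechet_derivative f (at y within S) u)"
    using frechet_extension[OF assms(1) U(1) U(3) U(4)] U
    by (intro exI[of _ U] exI[of _ "\<lambda>x. frechet_derivative F (at x) u"]) auto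
qed

text \<open>The mean value theorem is applied twice: in direction \<open>u\<close> to the increment
  of \<open>F\<close> over h w, then in direction \<open>w\<close> to the derivative of
  \<open>F\<close> along \<open>u\<close>. The left side is symmetric in \<open>u\<close> and
  \<open>w\<close>, while the right side is a mixed derivative taken in one order.\<close>

lemma second_difference:
  fixes F :: "'a::euclidean_space \<Rightarrow> real"
  assumes "open U" and Ck: "\<And>k. Ck_on k U F" and "h > 0"
    and box: "\<And>a b. 0 \<le> a \<Longrightarrow> a \<le> h \<Longrightarrow> 0 \<le> b \<Longrightarrow> b \<le> h \<Longrightarrow> x + a *\<^sub>R u + b *\<^sub>R w \<in> U"
  shows "\<exists>a b. 0 \<le> a \<and> a \<le> h \<and> 0 \<le> b \<and> b \<le> h \<and>
    F (x + h *\<^sub>R u + h *\<^sub>R w) - F (x + h *\<^sub>R u) - F (x + h *\<^sub>R w) + F x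
    = h * h * frechet_derivative (\<lambda>y. frechet_derivative F (at y) u) (at (x + a *\<^sub>R u + b *\<^sub>R w)) w"
proof -
  have dF: "(F has_derivative frechet_derivative F (at y)) (at y)" if "y \<in> U" for y
    using Ck_on_SucD[OF assms(1) Ck that] .
  have lin: "linear (frechet_derivative F (at y))" if "y \<in> U" for y
    using dF[OF that] has_derivative_linear by blast
  define G where "G a = F (x + a *\<^sub>R u + h *\<^sub>R w) - F (x + a *\<^sub>R u)" for a
  have "\<exists>z>0. z < h \<and> G h - G 0 = (h - 0) * (frechet_derivative F (at (x + z *\<^sub>R u + h *\<^sub>R w)) u
      - frechet_derivative F (at (x + z *\<^sub>R u)) u)"
  proof (rule MVT2)
    fix a assume a: "0 \<le> a" "a \<le> h"
    have 1: "x + a *\<^sub>R u + h *\<^sub>R w \<in> U" "x + a *\<^sub>R u \<in> U" using box[of a h] box[of a 0] a assms(3) by auto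
    have "((\<lambda>a. F (x + a *\<^sub>R u + h *\<^sub>R w)) has_derivative (\<lambda>b. frechet_derivative F (at (x + a *\<^sub>R u + h *\<^sub>R w)) (b *\<^sub>R u))) (at a)"
      by (rule has_derivative_compose[where g=F and f="\<lambda>a. x + a *\<^sub>R u + h *\<^sub>R w", OF _ dF[OF 1(1)]]) (auto intro!: derivative_eq_intros)
    moreover have "((\<lambda>a. F (x + a *\<^sub>R u)) has_derivative (\<lambda>b. frechet_derivative F (at (x + a *\<^sub>R u)) (b *\<^sub>R u))) (at a)"
      by (rule has_derivative_compose[where g=F and f="\<lambda>a. x + a *\<^sub>R u", OF _ dF[OF 1(2)]]) (auto intro!: derivative_eq_intros)
    ultimately show "(G has_real_derivative frechet_derivative F (at (x + a *\<^sub>R u + h *\<^sub>R w)) u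
      - frechet_derivative F (at (x + a *\<^sub>R u)) u) (at a)"
      unfolding G_def has_field_derivative_def
      by (rule has_derivative_diff[THEN has_derivative_eq_rhs])
        (rule ext, simp add: linear_cmul[OF lin[OF 1(1)]] linear_cmul[OF lin[OF 1(2)]] mult.commute right_diff_distrib)
  qed (use assms in auto)
  then obtain a where a: "0 < a" "a < h" "G h - G 0 = h * (frechet_derivative F (at (x + a *\<^sub>R u + h *\<^sub>R w)) u
      - frechet_derivative F (at (x + a *\<^sub>R u)) u)" by auto
  define F1 where "F1 = (\<lambda>y. frechet_derivative F (at y) u)"
  have Ck1: "Ck_on k U F1" for k unfolding F1_def by (rule Ck_on_frechet[OF assms(1) Ck])
  have dF1: "(F1 has_derivative frechet_derivative F1 (at y)) (at y)" if "y \<in> U" for y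
    using Ck_on_SucD[OF assms(1) Ck1 that] .
  have lin1: "linear (frechet_derivative F1 (at y))" if "y \<in> U" for y
    using dF1[OF that] has_derivative_linear by blast
  have "\<exists>z>0. z < h \<and> F1 (x + a *\<^sub>R u + h *\<^sub>R w) - F1 (x + a *\<^sub>R u + 0 *\<^sub>R w) =
     (h - 0) * frechet_derivative F1 (at (x + a *\<^sub>R u + z *\<^sub>R w)) w"
  proof (rule MVT2)
    fix b assume b: "0 \<le> b" "b \<le> h"
    have 1: "x + a *\<^sub>R u + b *\<^sub>R w \<in> U" using box[of a b] a b by auto
    have "((\<lambda>b. F1 (x + a *\<^sub>R u + b *\<^sub>R w)) has_derivative (\<lambda>c. frechet_derivative F1 (at (x + a *\<^sub>R u + b *\<^sub>R w)) (c *\<^sub>R w))) (at b)"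
      by (rule has_derivative_compose[where g=F1 and f="\<lambda>b. x + a *\<^sub>R u + b *\<^sub>R w", OF _ dF1[OF 1(1)]]) (auto intro!: derivative_eq_intros)
    then show "((\<lambda>b. F1 (x + a *\<^sub>R u + b *\<^sub>R w)) has_real_derivative frechet_derivative F1 (at (x + a *\<^sub>R u + b *\<^sub>R w)) w) (at b)"
      unfolding has_field_derivative_def
      by (rule has_derivative_eq_rhs) (rule ext, simp add: linear_cmul[OF lin1[OF 1(1)]] mult.commute)
  qed (use assms in auto)
  then obtain b where b: "0 < b" "b < h" "F1 (x + a *\<^sub>R u + h *\<^sub>R w) - F1 (x + a *\<^sub>R u) =
     h * frechet_derivative F1 (at (x + a *\<^sub>R u + b *\<^sub>R w)) w" by auto
  have "G h - G 0 = h * h * frechet_derivative F1 (at (x + a *\<^sub>R u + b *\<^sub>R w)) w"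
    using a(3) b(3) by (simp add: F1_def)
  then show ?thesis using a b
    by (intro exI[of _ a] exI[of _ b]) (auto simp: G_def F1_def)
qed

text \<open>The second difference is symmetric, so both orders of differentiation take a common
  value at two points within h (|u| + |w|) of x. If the mixed derivatives differed at x, continuity
  would keep them apart at such points once h is small.\<close>

lemma frechet_symmetric_real:
  fixes F :: "'a::euclidean_space \<Rightarrow> real"
  assumes "open U" and Ck: "\<And>k. Ck_on k U F" and "x \<in> U"
  shows "frechet_derivative (\<lambda>y. frechet_derivative F (at y) u) (at x) w
    = frechet_derivative (\<lambda>y. frechet_derivative F (at y) w) (at x) u" (is "?A u w x = ?A w u x")
proof -
  have cont: "isCont (?A u w) x" for u w
  proof -
    have "Ck_on 0 U (?A u w)" by (rule Ck_on_frechet[OF assms(1) Ck_on_frechet[OF assms(1) Ck]])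
    then show ?thesis using assms by (simp add: continuous_on_eq_continuous_at)
  qed
  obtain r where r: "r > 0" "ball x r \<subseteq> U" using assms openE by metis
  have nb: "\<exists>p q. dist p x \<le> h * (norm u + norm w) \<and> dist q x \<le> h * (norm u + norm w) \<and> ?A u w p = ?A w u q"
    if h: "h > 0" "h * (norm u + norm w) < r" for h
  proof -
    have d: "dist (x + a *\<^sub>R u + b *\<^sub>R w) x \<le> h * (norm u + norm w)" if "0 \<le> a" "a \<le> h" "0 \<le> b" "b \<le> h" for a b u w
    proof -
      have "dist (x + a *\<^sub>R u + b *\<^sub>R w) x = norm (a *\<^sub>R u + b *\<^sub>R w)" by (simp add: dist_norm algebra_simps)
      also have "\<dots> \<le> a * norm u + b * norm w" using norm_triangle_ineq[of "a *\<^sub>R u" "b *\<^sub>R w"] that by simp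
      also have "\<dots> \<le> h * norm u + h * norm w" using that by (intro add_mono mult_right_mono) auto
      finally show ?thesis by (simp add: algebra_simps)
    qed
    have "x + a *\<^sub>R u + b *\<^sub>R w \<in> U" if "0 \<le> a" "a \<le> h" "0 \<le> b" "b \<le> h" for a b
      using d[OF that, of u w] h r by (auto simp: subset_iff dist_commute)
    then obtain a b where 1: "0 \<le> a" "a \<le> h" "0 \<le> b" "b \<le> h" 
      "F (x + h *\<^sub>R u + h *\<^sub>R w) - F (x + h *\<^sub>R u) - F (x + h *\<^sub>R w) + F x = h * h * ?A u w (x + a *\<^sub>R u + b *\<^sub>R w)"
      using second_difference[OF assms(1) Ck h(1), of x u w] by blast
    have "x + a *\<^sub>R w + b *\<^sub>R u \<in> U" if "0 \<le> a" "a \<le> h" "0 \<le> b" "b \<le> h" for a b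
      using d[OF that, of w u] h r by (auto simp: subset_iff dist_commute add.commute)
    then obtain a' b' where 2: "0 \<le> a'" "a' \<le> h" "0 \<le> b'" "b' \<le> h" 
      "F (x + h *\<^sub>R w + h *\<^sub>R u) - F (x + h *\<^sub>R w) - F (x + h *\<^sub>R u) + F x = h * h * ?A w u (x + a' *\<^sub>R w + b' *\<^sub>R u)"
      using second_difference[OF assms(1) Ck h(1), of x w u] by blast
    have "h * h * ?A u w (x + a *\<^sub>R u + b *\<^sub>R w) = h * h * ?A w u (x + a' *\<^sub>R w + b' *\<^sub>R u)"
      using 1(5) 2(5) by (simp add: algebra_simps)
    then have "?A u w (x + a *\<^sub>R u + b *\<^sub>R w) = ?A w u (x + a' *\<^sub>R w + b' *\<^sub>R u)" using h by simp
    then show ?thesis using d[OF 1(1-4), of u w] d[OF 2(1-4), of w u] by (metis add.commute)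
  qed
  show ?thesis
  proof (rule ccontr)
    assume ne: "?A u w x \<noteq> ?A w u x"
    define e where "e = \<bar>?A u w x - ?A w u x\<bar> / 2"
    have e: "e > 0" using ne by (simp add: e_def)
    obtain d1 where d1: "d1 > 0" "\<And>y. dist y x < d1 \<Longrightarrow> dist (?A u w y) (?A u w x) < e"
      using cont[of u w] e unfolding continuous_at_eps_delta by metis
    obtain d2 where d2: "d2 > 0" "\<And>y. dist y x < d2 \<Longrightarrow> dist (?A w u y) (?A w u x) < e"
      using cont[of w u] e unfolding continuous_at_eps_delta by metis
    define m where "m = min r (min d1 d2)"
    have m: "m > 0" using r d1 d2 by (simp add: m_def)
    \<comment> \<open>The summand 1 keeps the denominator positive when \<open>u\<close> and
      \<open>w\<close> both vanish; the factor 2 makes the displacement strictly smaller than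
      \<open>m\<close>.\<close>
    define h where "h = m / (2 * (norm u + norm w + 1))"
    have n: "norm u + norm w + 1 > 0" by (simp add: add_nonneg_pos)
    have h0: "h > 0" using m n by (simp add: h_def)
    have "h * (norm u + norm w) \<le> h * (norm u + norm w + 1)" using h0 by simp
    also have "\<dots> = m / 2"
    proof -
      have "m / (2 * K) * K = m / 2" if "K > 0" for K :: real using that by simp
      from this[OF n] show ?thesis unfolding h_def .
    qed
    finally have hm: "h * (norm u + norm w) < m" using m by simp
    then obtain p q where "dist p x < m" "dist q x < m" "?A u w p = ?A w u q"
      using nb[OF h0] by (force simp: m_def)
    then have "\<bar>?A u w p - ?A u w x\<bar> < e" "\<bar>?A u w p - ?A w u x\<bar> < e"
      using d1(2)[of p] d2(2)[of q] by (auto simp: m_def dist_real_def)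
    moreover have False if "\<bar>P - K\<bar> < \<bar>K - L\<bar> / 2" "\<bar>P - L\<bar> < \<bar>K - L\<bar> / 2" for P K L :: real
      using that by (auto simp: abs_if split: if_splits)
    ultimately show False unfolding e_def by blast
  qed
qed

lemma frechet_bounded_linear:
  assumes "bounded_linear L" "fat S" "smooth_on S f" "x \<in> S"
  shows "frechet_derivative (\<lambda>y. L (f y)) (at x within S) = (\<lambda>u. L (frechet_derivative f (at x within S) u))"
  by (rule frechet_fat[OF assms(2,4) bounded_linear.has_derivative[OF assms(1) smooth_on_has_derivative[OF assms(3,4)]]])

text \<open>Symmetry is inherited from a local extension, whose first and second derivatives agree
  with those within \<open>S\<close>, at boundary points as well. Vector values are reduced to inner
  products with basis vectors.\<close>

lemma frechet_symmetric:
  fixes f :: "'a::euclidean_space \<Rightarrow> 'b::euclidean_space"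
  assumes "fat S" "smooth_on S f" "x \<in> S"
  shows "frechet_derivative (\<lambda>y. frechet_derivative f (at y within S) u) (at x within S) w
    = frechet_derivative (\<lambda>y. frechet_derivative f (at y within S) w) (at x within S) u"
proof -
  have real: "frechet_derivative (\<lambda>y. frechet_derivative f (at y within S) u) (at x within S) w
    = frechet_derivative (\<lambda>y. frechet_derivative f (at y within S) w) (at x within S) u"
    if f: "smooth_on S f" for f :: "'a \<Rightarrow> real"
  proof -
    obtain U F where U: "open U" "x \<in> U" "\<And>k. Ck_on k U F" "\<And>y. y \<in> S \<Longrightarrow> y \<in> U \<Longrightarrow> F y = f y"
      using smooth_onE[OF f assms(3)] by metis
    have "frechet_derivative (\<lambda>y. frechet_derivative f (at y within S) u) (at x within S)
       = frechet_derivative (\<lambda>y. frechet_derivative F (at y) u) (at x)" for u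
      by (rule frechet_extension[OF assms(1) U(1) Ck_on_frechet[OF U(1) U(3)] _ assms(3) U(2)])
        (simp add: frechet_extension[OF assms(1) U(1) U(3) U(4)])
    then show ?thesis using frechet_symmetric_real[OF U(1) U(3) U(2)] by simp
  qed
  have *: "frechet_derivative (\<lambda>y. frechet_derivative f (at y within S) u) (at x within S) w \<bullet> b
    = frechet_derivative (\<lambda>y. frechet_derivative (\<lambda>y. f y \<bullet> b) (at y within S) u) (at x within S) w" for u w b
  proof -
    have "frechet_derivative (\<lambda>y. frechet_derivative (\<lambda>y. f y \<bullet> b) (at y within S) u) (at x within S)
      = frechet_derivative (\<lambda>y. frechet_derivative f (at y within S) u \<bullet> b) (at x within S)"
      by (rule frechet_derivative_within_cong)
        (simp_all add: frechet_bounded_linear[OF bounded_linear_inner_left assms(1,2)] assms)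
    then show ?thesis
      by (simp add: frechet_bounded_linear[OF bounded_linear_inner_left assms(1) smooth_on_frechet[OF assms(1,2)] assms(3)])
  qed
  show ?thesis
    by (rule euclidean_eqI) (simp add: * real smooth_on_bounded_linear[OF bounded_linear_inner_left assms(2)])
qed

subsection \<open>One-parameter families\<close>

text \<open>Time and space derivatives are both directional derivatives of one function on the fat
  set T \<times> C, in the directions (1, 0) and (0, u). This reduces every statement about families
  to the calculus on fat sets.\<close>

lemma
  fixes f :: "real \<Rightarrow> R3 \<Rightarrow> 'b::euclidean_space"
  assumes T: "open T" and C: "fat C" and f: "smooth_on (T \<times> C) (\<lambda>(t, x). f t x)" and t: "t \<in> T"
  shows family_slice: "smooth_on C (f t)"
    and family_D_eq: "x \<in> C \<Longrightarrow> D C (f t) x = (\<lambda>u. frechet_derivative (\<lambda>(t, x). f t x) (at (t, x) within T \<times> C) (0, u))"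
    and family_has_vector_derivative: "x \<in> C \<Longrightarrow> ((\<lambda>s. f s x) has_vector_derivative vector_derivative (\<lambda>s. f s x) (at t)) (at t)"
    and family_dt_eq: "x \<in> C \<Longrightarrow> vector_derivative (\<lambda>s. f s x) (at t) = frechet_derivative (\<lambda>(t, x). f t x) (at (t, x) within T \<times> C) (1, 0)"
proof -
  let ?F = "\<lambda>(t, x). f t x"
  have fat: "fat (T \<times> C)" by (intro fat_Times fat_open T C)
  have lin: "bounded_linear (\<lambda>x::R3. (0::real, x))"
    by (rule bounded_linear_Pair[OF bounded_linear_zero bounded_linear_ident])
  have "smooth_on C (\<lambda>x. (t, 0) + (0, x))"
    by (intro smooth_on_add smooth_on_const smooth_on_bounded_linear[OF lin] smooth_on_id)
  then have "smooth_on C (\<lambda>x. (t, x))" by simp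
  from smooth_on_compose[OF f this] show "smooth_on C (f t)" using t by auto
  fix x assume x: "x \<in> C"
  have dF: "(?F has_derivative frechet_derivative ?F (at (t, x) within T \<times> C)) (at (t, x) within T \<times> C)"
    using smooth_on_has_derivative[OF f] x t by auto
  have "((\<lambda>y. ?F (t, y)) has_derivative (\<lambda>u. frechet_derivative ?F (at (t, x) within T \<times> C) (0, u))) (at x within C)"
    by (rule has_derivative_in_compose2[OF _ _ x, of "T \<times> C" ?F "\<lambda>z. frechet_derivative ?F (at z within T \<times> C)"])
      (use t smooth_on_has_derivative[OF f] in \<open>auto intro!: derivative_eq_intros\<close>)
  then show "D C (f t) x = (\<lambda>u. frechet_derivative ?F (at (t, x) within T \<times> C) (0, u))"
    by (intro frechet_fat[OF C x]) simp
  have "((\<lambda>s. ?F (s, x)) has_derivative (\<lambda>u. frechet_derivative ?F (at (t, x) within T \<times> C) (u, 0))) (at t within T)"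
    by (rule has_derivative_in_compose2[OF _ _ t, of "T \<times> C" ?F "\<lambda>z. frechet_derivative ?F (at z within T \<times> C)"])
      (use x smooth_on_has_derivative[OF f] in \<open>auto intro!: derivative_eq_intros\<close>)
  then have d: "((\<lambda>s. f s x) has_derivative (\<lambda>u. frechet_derivative ?F (at (t, x) within T \<times> C) (u, 0))) (at t)"
    by (simp add: at_within_open[OF t T])
  have l: "linear (frechet_derivative ?F (at (t, x) within T \<times> C))" using dF has_derivative_linear by blast
  have eq: "(u, 0) = u *\<^sub>R (1::real, 0::R3)" for u by simp
  have "((\<lambda>s. f s x) has_vector_derivative frechet_derivative ?F (at (t, x) within T \<times> C) (1, 0)) (at t)"
    unfolding has_vector_derivative_def by (rule has_derivative_eq_rhs[OF d]) (subst eq, simp only: linear_cmul[OF l])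
  then show "vector_derivative (\<lambda>s. f s x) (at t) = frechet_derivative ?F (at (t, x) within T \<times> C) (1, 0)"
    "((\<lambda>s. f s x) has_vector_derivative vector_derivative (\<lambda>s. f s x) (at t)) (at t)"
    by (simp_all add: vector_derivative_at)
qed

lemma
  fixes f :: "real \<Rightarrow> R3 \<Rightarrow> 'b::euclidean_space"
  assumes T: "open T" and C: "fat C" and f: "smooth_on (T \<times> C) (\<lambda>(t, x). f t x)"
  shows family_D_smooth: "smooth_on (T \<times> C) (\<lambda>(t, x). D C (f t) x u)"
    and family_dt_smooth: "smooth_on (T \<times> C) (\<lambda>(t, x). vector_derivative (\<lambda>s. f s x) (at t))"
proof -
  have fat: "fat (T \<times> C)" by (intro fat_Times fat_open T C)
  show "smooth_on (T \<times> C) (\<lambda>(t, x). D C (f t) x u)"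
    by (rule smooth_on_cong[THEN iffD1, OF _ smooth_on_frechet[OF fat f, of "(0, u)"]])
      (auto simp: family_D_eq[OF T C f])
  show "smooth_on (T \<times> C) (\<lambda>(t, x). vector_derivative (\<lambda>s. f s x) (at t))"
    by (rule smooth_on_cong[THEN iffD1, OF _ smooth_on_frechet[OF fat f, of "(1, 0)"]])
      (auto simp: family_dt_eq[OF T C f])
qed

text \<open>Symmetry of second derivatives on T \<times> C, for the directions (1, 0) and (0,
  u).\<close>

lemma family_commute:
  fixes f :: "real \<Rightarrow> R3 \<Rightarrow> 'b::euclidean_space"
  assumes T: "open T" and C: "fat C" and f: "smooth_on (T \<times> C) (\<lambda>(t, x). f t x)" and t: "t \<in> T" and x: "x \<in> C"
  shows "vector_derivative (\<lambda>s. D C (f s) x u) (at t) = D C (\<lambda>y. vector_derivative (\<lambda>s. f s y) (at t)) x u"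
proof -
  let ?F = "\<lambda>(t, x). f t x"
  have fat: "fat (T \<times> C)" by (intro fat_Times fat_open T C)
  have "vector_derivative (\<lambda>s. D C (f s) x u) (at t) =
    frechet_derivative (\<lambda>(t, x). D C (f t) x u) (at (t, x) within T \<times> C) (1, 0)"
    by (rule family_dt_eq[OF T C family_D_smooth[OF T C f] t x])
  also have "\<dots> = frechet_derivative (\<lambda>z. frechet_derivative ?F (at z within T \<times> C) (0, u)) (at (t, x) within T \<times> C) (1, 0)"
    by (rule fun_cong[where x="(1, 0)"], rule frechet_derivative_within_cong) (auto simp: family_D_eq[OF T C f] t x)
  also have "\<dots> = frechet_derivative (\<lambda>z. frechet_derivative ?F (at z within T \<times> C) (1, 0)) (at (t, x) within T \<times> C) (0, u)"
    by (rule frechet_symmetric[OF fat f]) (use t x in auto)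
  also have "\<dots> = frechet_derivative (\<lambda>(t, x). vector_derivative (\<lambda>s. f s x) (at t)) (at (t, x) within T \<times> C) (0, u)"
    by (rule fun_cong[where x="(0, u)"], rule frechet_derivative_within_cong) (auto simp: family_dt_eq[OF T C f] t x)
  also have "\<dots> = D C (\<lambda>y. vector_derivative (\<lambda>s. f s y) (at t)) x u"
    by (simp add: family_D_eq[OF T C family_dt_smooth[OF T C f] t x])
  finally show ?thesis .
qed

section \<open>The divergence theorem on a half-space\<close>

text \<open>The integral over \<open>C\<close> is turned into a Lebesgue integral over the whole
  space, where translation invariance and dominated convergence are at hand.\<close>

lemma
  fixes f :: "'a::euclidean_space \<Rightarrow> real"
  assumes "compact K" "K \<subseteq> C" "continuous_on K f" "\<And>x. x \<in> C \<Longrightarrow> x \<notin> K \<Longrightarrow> f x = 0"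
  shows compact_support_abs_integrable: "f absolutely_integrable_on C"
    and compact_support_integral: "integral C f = (LINT x|lborel. indicator K x * f x)"
proof -
  have int: "integrable lborel (\<lambda>x. indicator K x *\<^sub>R f x)"
    by (rule borel_integrable_compact[OF assms(1,3)])
  have eq: "indicator K x *\<^sub>R f x = (if x \<in> C then f x else 0)" for x
    using assms(2,4) by (auto simp: indicator_def)
  have "integrable lebesgue (\<lambda>x. indicator K x *\<^sub>R f x)"
    using int by (simp add: integrable_completion)
  then have "integrable lebesgue (\<lambda>x. if x \<in> C then f x else 0)" by (simp only: eq)
  then have "(\<lambda>x. if x \<in> C then f x else 0) absolutely_integrable_on UNIV"
    by (simp add: set_integrable_def)
  then show "f absolutely_integrable_on C"
    using absolutely_integrable_restrict_UNIV by blast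
  have "integral C f = integral UNIV (\<lambda>x. if x \<in> C then f x else 0)"
    by (simp add: integral_restrict_UNIV)
  also have "\<dots> = integral UNIV (\<lambda>x. indicator K x *\<^sub>R f x)" by (simp only: eq)
  also have "\<dots> = (LINT x|lborel. indicator K x *\<^sub>R f x)" by (rule integral_lborel[OF int])
  finally show "integral C f = (LINT x|lborel. indicator K x * f x)" by simp
qed

lemma lborel_integral_translation:
  fixes f :: "'a::euclidean_space \<Rightarrow> real"
  assumes "f \<in> borel_measurable borel"
  shows "(LINT x|lborel. f (c + x)) = (LINT x|lborel. f x)"
proof -
  have "(LINT x|lborel. f x) = (LINT x|distr lborel borel ((+) c). f x)"
    by (simp only: lborel_distr_plus)
  also have "\<dots> = (LINT x|lborel. f (c + x))"
    by (rule integral_distr) (use assms in auto)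
  finally show ?thesis by simp
qed

lemma lborel_integrable_translation:
  fixes f :: "'a::euclidean_space \<Rightarrow> real"
  assumes "integrable lborel f"
  shows "integrable lborel (\<lambda>x. f (c + x))"
proof -
  have "integrable (distr lborel borel ((+) c)) f" using assms by (simp only: lborel_distr_plus)
  then show ?thesis by (rule integrable_distr[rotated]) auto
qed

lemma at_within_relatively_open:
  assumes "openin (top_of_set H) C" "x \<in> C"
  shows "at x within C = at x within H"
proof -
  obtain U where "open U" "C = H \<inter> U" using assms by (auto simp: openin_open)
  then show ?thesis using assms(2) by (intro at_within_nhd[of x U]) auto
qed

lemma half_space_closed: "closed half_space"
  unfolding half_space_def by (intro closed_Collect_le continuous_intros)

text \<open>Translation invariance of the Lebesgue integral kills all difference quotients. Across the
  boundary the extension by zero is still Lipschitz in the first direction, because the function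
  vanishes there.\<close>

lemma integral_partial_derivative_zero:
  fixes w :: "R3 \<Rightarrow> real"
  assumes C: "openin (top_of_set half_space) C" and w: "smooth_on C w"
    and K: "compact K" "K \<subseteq> C" "\<And>x. x \<in> C \<Longrightarrow> x \<notin> K \<Longrightarrow> w x = 0"
    and bd: "i = 1 \<Longrightarrow> \<forall>x\<in>C. x $ 1 = 0 \<longrightarrow> w x = 0"
  shows "(\<lambda>x. D C w x (axis i 1)) absolutely_integrable_on C"
    and "integral C (\<lambda>x. D C w x (axis i 1)) = 0"
proof -
  define e :: R3 where "e = axis i 1"
  have fat: "fat C" using C by (rule fat_half_space)
  have CH: "C \<subseteq> half_space" using C openin_imp_subset by blast
  define W where "W x = (if x \<in> C then w x else 0)" for x
  define W' where "W' x = (if x \<in> C then D C w x else (\<lambda>_. 0))" for x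
  have nbhd: "(W has_derivative (\<lambda>_. 0)) (at x within half_space)" if x: "x \<in> half_space" "x \<notin> K" for x
  proof (rule has_derivative_extension[of "- K" x half_space "\<lambda>_. 0"])
    show "open (- K)" using K by (simp add: compact_imp_closed open_Compl)
    show "0 = W y" if "y \<in> half_space" "y \<in> - K" for y using that K by (auto simp: W_def)
  qed (use x in auto)
  have dW: "(W has_derivative W' x) (at x within half_space)" if x: "x \<in> half_space" for x
  proof (cases "x \<in> C")
    case True
    have "(w has_derivative W' x) (at x within C)" using smooth_on_has_derivative[OF w True] True by (simp add: W'_def)
    then have "(W has_derivative W' x) (at x within C)"
      using has_derivative_within_cong[of C W w x "W' x"] True by (simp add: W_def)
    then show ?thesis using at_within_relatively_open[OF C True] by simp
  next
    case False
    then show ?thesis using nbhd[OF x] K(2) by (auto simp: W'_def)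
  qed
  have W'0: "W' x = (\<lambda>_. 0)" if "x \<notin> K" for x
  proof (cases "x \<in> C")
    case True
    then have "x \<in> half_space" using CH by auto
    from nbhd[OF this that] have "(W has_derivative (\<lambda>_. 0)) (at x within C)"
      using at_within_relatively_open[OF C True] by simp
    then have "(w has_derivative (\<lambda>_. 0)) (at x within C)"
      using has_derivative_within_cong[of C W w x "\<lambda>_. 0"] True by (simp add: W_def)
    from frechet_fat[OF fat True this] show ?thesis using True by (simp add: W'_def)
  qed (simp add: W'_def)
  have contD: "continuous_on C (\<lambda>x. D C w x e)"
    by (rule smooth_on_imp_continuous_on[OF smooth_on_frechet[OF fat w]])
  have contK: "continuous_on K (\<lambda>x. D C w x e)" using contD K(2) continuous_on_subset by blast
  have D0: "D C w x e = 0" if "x \<in> C" "x \<notin> K" for x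
    using W'0[OF that(2)] that(1) by (simp add: W'_def)
  show "(\<lambda>x. D C w x (axis i 1)) absolutely_integrable_on C"
    using compact_support_abs_integrable[OF K(1,2) contK D0] by (simp add: e_def)
  have "compact ((\<lambda>x. D C w x e) ` K)" using contK K(1) by (rule compact_continuous_image)
  then obtain B0 where B0: "\<And>x. x \<in> K \<Longrightarrow> norm (D C w x e) \<le> B0"
    using compact_imp_bounded[of "(\<lambda>x. D C w x e) ` K"] unfolding bounded_iff by blast
  define B where "B = max B0 0"
  have B: "norm (W' x e) \<le> B" for x
    using B0[of x] W'0[of x] K(2) by (cases "x \<in> K") (auto simp: B_def W'_def)
  have B0: "B \<ge> 0" by (simp add: B_def)
  have seg: "norm (W (x + h *\<^sub>R e) - W x) \<le> B * h" if h: "h \<ge> 0" and x: "x \<in> half_space" for x h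
  proof -
    have line: "x + r *\<^sub>R e \<in> half_space" if "r \<in> {0..h}" for r
      using x that by (auto simp: half_space_def e_def axis_def)
    have "norm ((\<lambda>r. W (x + r *\<^sub>R e)) h - (\<lambda>r. W (x + r *\<^sub>R e)) 0) \<le> B * norm (h - 0)"
    proof (rule field_differentiable_bound[where S="{0..h}" and f'="\<lambda>r. W' (x + r *\<^sub>R e) e"])
      fix r assume r: "r \<in> {0..h}"
      have l: "linear (W' (x + r *\<^sub>R e))" using dW[OF line[OF r]] has_derivative_linear by blast
      have "((\<lambda>r. W (x + r *\<^sub>R e)) has_derivative (\<lambda>u. W' (x + r *\<^sub>R e) (u *\<^sub>R e))) (at r within {0..h})"
        by (rule has_derivative_in_compose2[where g=W and g'=W' and t=half_space and s="{0..h}" and f="\<lambda>r. x + r *\<^sub>R e"])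
          (use dW line r in \<open>auto intro!: derivative_eq_intros\<close>)
      then show "((\<lambda>r. W (x + r *\<^sub>R e)) has_real_derivative W' (x + r *\<^sub>R e) e) (at r within {0..h})"
        unfolding has_field_derivative_def
        by (rule has_derivative_eq_rhs) (rule ext, simp add: linear_cmul[OF l] mult.commute)
    qed (use B h in auto)
    then show ?thesis using h by simp
  qed
  have lip: "norm (W (x + h *\<^sub>R e) - W x) \<le> B * h" if h: "h \<ge> 0" for x h
  proof (cases "x \<in> half_space")
    case False
    then have x: "x $ 1 < 0" "W x = 0" using CH by (auto simp: half_space_def W_def)
    show ?thesis
    proof (cases "x + h *\<^sub>R e \<in> half_space")
      case True
      then have i: "i = 1" and h1: "x $ 1 + h \<ge> 0" using x by (auto simp: half_space_def e_def axis_def split: if_splits)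
      \<comment> \<open>The point where the segment from \<open>x\<close> enters the half-space.
        \<open>W\<close> vanishes there by the boundary condition, so only the remaining length x $
        1 + h, which is at most \<open>h\<close>, contributes to the growth.\<close>
      define y where "y = x - (x $ 1) *\<^sub>R e"
      have y: "y $ 1 = 0" using i by (simp add: y_def e_def)
      then have "W y = 0" "y \<in> half_space" using bd[OF i] by (auto simp: W_def half_space_def)
      moreover have "x + h *\<^sub>R e = y + (x $ 1 + h) *\<^sub>R e" by (simp add: y_def algebra_simps)
      ultimately have "norm (W (x + h *\<^sub>R e)) \<le> B * (x $ 1 + h)" using seg[OF h1] by fastforce
      also have "\<dots> \<le> B * h" using x B0 by (intro mult_left_mono) auto
      finally show ?thesis using x by simp
    next
      case False
      then have "W (x + h *\<^sub>R e) = 0" using CH by (auto simp: W_def)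
      then show ?thesis using x B0 h by simp
    qed
  qed (use seg h in auto)
  have contw: "continuous_on K w"
    using smooth_on_imp_continuous_on[OF w] K(2) continuous_on_subset by blast
  have Wint: "integrable lborel W"
  proof -
    have "W = (\<lambda>x. indicator K x *\<^sub>R w x)" using K by (auto simp: W_def indicator_def fun_eq_iff)
    then show ?thesis using borel_integrable_compact[OF K(1) contw] by simp
  qed
  have W'eq: "(\<lambda>x. W' x e) = (\<lambda>x. indicator K x *\<^sub>R D C w x e)"
  proof
    show "W' x e = indicator K x *\<^sub>R D C w x e" for x
      using K(2) W'0[of x] by (cases "x \<in> K") (auto simp: W'_def)
  qed
  have W'int: "integrable lborel (\<lambda>x. W' x e)"
    unfolding W'eq by (rule borel_integrable_compact[OF K(1) contK])
  define h where "h n = inverse (real (Suc n))" for n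
  have h: "h n > 0" "h n \<le> 1" for n
    unfolding h_def by (auto simp: field_simps)
  have h0: "h \<longlonglongrightarrow> 0" unfolding h_def by (rule LIMSEQ_inverse_real_of_nat)
  define q where "q n x = (W (h n *\<^sub>R e + x) - W x) / h n" for n x
  have Wm: "W \<in> borel_measurable borel" using Wint by (simp add: borel_measurable_integrable)
  have q0: "(LINT x|lborel. q n x) = 0" for n
    unfolding q_def using lborel_integrable_translation[OF Wint] Wint lborel_integral_translation[OF Wm]
    by simp
  obtain R where R: "\<And>x. x \<in> K \<Longrightarrow> norm x \<le> R" using compact_imp_bounded[OF K(1)] unfolding bounded_iff by auto
  \<comment> \<open>The steps \<open>h n\<close> are at most 1, so every difference quotient
    vanishes outside the ball of radius R + 1, and it is bounded by the Lipschitz constant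
    \<open>B\<close>. This gives the dominating function.\<close>
  have "(\<lambda>n. LINT x|lborel. q n x) \<longlonglongrightarrow> (LINT x|lborel. W' x e)"
  proof (rule integral_dominated_convergence[where w="\<lambda>x. indicator (cball 0 (R + 1)) x *\<^sub>R B"])
    show "integrable lborel (\<lambda>x::R3. indicator (cball 0 (R + 1)) x *\<^sub>R B)"
      by (rule borel_integrable_compact) auto
    show "(\<lambda>x. W' x e) \<in> borel_measurable lborel" using W'int by simp
    show "q n \<in> borel_measurable lborel" for n
      unfolding q_def using lborel_integrable_translation[OF Wint] Wint by simp
    show "AE x in lborel. norm (q n x) \<le> indicator (cball 0 (R + 1)) x *\<^sub>R B" for n
    proof (rule AE_I2)
      fix x :: R3
      have "q n x = 0" if "x \<notin> cball 0 (R + 1)"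
      proof -
        have n: "norm x > R + 1" using that by (simp add: dist_norm)
        then have "x \<notin> K" using R[of x] by auto
        moreover have "h n *\<^sub>R e + x \<notin> K"
        proof
          assume "h n *\<^sub>R e + x \<in> K"
          then have "norm (h n *\<^sub>R e + x) \<le> R" using R by blast
          moreover have "norm (h n *\<^sub>R e) \<le> 1" using h[of n] by (simp add: e_def)
          moreover have "norm x \<le> norm (h n *\<^sub>R e + x) + norm (h n *\<^sub>R e)"
            by (metis add.commute add_diff_cancel_left' norm_triangle_sub norm_triangle_ineq4 add_diff_cancel_right')
          ultimately show False using n by linarith
        qed
        ultimately show ?thesis using K(3) by (simp add: q_def W_def)
      qed
      moreover have "norm (q n x) \<le> B"
        using lip[of "h n" x] h[of n] by (simp add: q_def field_simps add.commute)
      ultimately show "norm (q n x) \<le> indicator (cball 0 (R + 1)) x *\<^sub>R B" by (simp add: indicator_def)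
    qed
    \<comment> \<open>On the boundary plane \<open>W\<close> has at best a one-sided derivative, but
      the plane is a null set. Off it the quotients converge, inside the half-space as well as
      outside.\<close>
    have "AE x in lborel. x \<notin> {x::R3. x $ 1 = 0}"
    proof (rule AE_not_in)
      have "negligible {x::R3. x $ 1 = 0}" by (rule negligible_standard_hyperplane_cart)
      moreover have "closed {x::R3. x $ 1 = 0}" by (intro closed_Collect_eq continuous_intros)
      ultimately show "{x::R3. x $ 1 = 0} \<in> null_sets lborel"
        by (metis borel_closed negligible_iff_null_sets null_sets_completion_iff sets_lborel)
    qed
    then show "AE x in lborel. (\<lambda>n. q n x) \<longlonglongrightarrow> W' x e"
    proof (rule AE_mp, intro AE_I2 impI)
      fix x :: R3 assume "x \<notin> {x. x $ 1 = 0}"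
      then consider "x $ 1 > 0" | "x $ 1 < 0" by fastforce
      then have d: "(W has_derivative W' x) (at x)"
      proof cases
        case 1
        have op: "open {x::R3. 0 < x $ 1}" by (intro open_Collect_less continuous_intros)
        have "(W has_derivative W' x) (at x within half_space)" by (rule dW) (use 1 in \<open>auto simp: half_space_def\<close>)
        then have "(W has_derivative W' x) (at x within {x. 0 < x $ 1})"
          by (rule has_derivative_subset) (auto simp: half_space_def)
        then show ?thesis using at_within_open[OF _ op] 1 by simp
      next
        case 2
        have op: "open (- half_space)" using half_space_closed by auto
        have x: "x \<in> - half_space" using 2 by (simp add: half_space_def)
        have "W' x = (\<lambda>_. 0)" using x CH by (auto simp: W'_def)
        moreover have "(W has_derivative (\<lambda>_. 0)) (at x)"
          by (rule has_derivative_extension[where F="\<lambda>_. 0", OF op x UNIV_I]) (use CH in \<open>auto simp: W_def\<close>)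
        ultimately show ?thesis by simp
      qed
      have l: "linear (W' x)" using d has_derivative_linear by blast
      have "((\<lambda>r. W (r *\<^sub>R e + x)) has_derivative (\<lambda>u. W' x (u *\<^sub>R e))) (at 0)"
        by (rule has_derivative_compose[where g=W and f="\<lambda>r. r *\<^sub>R e + x"]) (use d in \<open>auto intro!: derivative_eq_intros\<close>)
      then have "((\<lambda>r. W (r *\<^sub>R e + x)) has_real_derivative W' x e) (at 0)"
        unfolding has_field_derivative_def
        by (rule has_derivative_eq_rhs) (rule ext, simp add: linear_cmul[OF l] mult.commute)
      then have "((\<lambda>r. (W (r *\<^sub>R e + x) - W x) / r) \<longlongrightarrow> W' x e) (at 0)"
        by (simp add: DERIV_def)
      moreover have "filterlim h (at 0) sequentially"
        unfolding filterlim_at using h h0 by (auto intro!: always_eventually simp: less_imp_neq[symmetric])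
      ultimately show "(\<lambda>n. q n x) \<longlonglongrightarrow> W' x e" unfolding q_def by (rule filterlim_compose)
    qed
  qed
  then have "(LINT x|lborel. W' x e) = 0" unfolding q0 by (simp add: LIMSEQ_const_iff)
  then have "(LINT x|lborel. indicator K x * D C w x e) = 0" by (simp add: W'eq)
  then show "integral C (\<lambda>x. D C w x (axis i 1)) = 0"
    using compact_support_integral[OF K(1,2) contK D0] by (simp add: e_def)
qed

section \<open>Integration over a compact manifold\<close>

definition partial :: "R3 set \<Rightarrow> 3 \<Rightarrow> (R3 \<Rightarrow> 'b::real_normed_vector) \<Rightarrow> R3 \<Rightarrow> 'b" where
  "partial C i f x = D C f x (axis i 1)"

definition divg :: "R3 set \<Rightarrow> (R3 \<Rightarrow> R3) \<Rightarrow> R3 \<Rightarrow> real" where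
  "divg C w x = (\<Sum>i\<in>UNIV. partial C i (\<lambda>y. w y $ i) x)"

definition scalar_field :: "'a chart set \<Rightarrow> ('a, real) field \<Rightarrow> bool" where
  "scalar_field A f \<longleftrightarrow> (\<forall>c\<in>A. \<forall>d\<in>A. \<forall>x\<in>overlap c d. f d (trans_map c d x) = f c x)"

definition density_field :: "'a chart set \<Rightarrow> ('a, real) field \<Rightarrow> bool" where
  "density_field A r \<longleftrightarrow> (\<forall>c\<in>A. \<forall>d\<in>A. \<forall>x\<in>overlap c d.
     r c x = det (matrix (jac c d x)) * r d (trans_map c d x))"

definition vector_field :: "'a chart set \<Rightarrow> ('a, R3) field \<Rightarrow> bool" where
  "vector_field A v \<longleftrightarrow> (\<forall>c\<in>A. \<forall>d\<in>A. \<forall>x\<in>overlap c d. v d (trans_map c d x) = jac c d x (v c x))"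

text \<open>Covectors and two-forms are encoded by their component vectors; a two-form becomes the vector
  density whose contraction with the coordinate volume form it is.\<close>

definition covector_field :: "'a chart set \<Rightarrow> ('a, R3) field \<Rightarrow> bool" where
  "covector_field A a \<longleftrightarrow> (\<forall>c\<in>A. \<forall>d\<in>A. \<forall>x\<in>overlap c d. \<forall>u.
     a c x \<bullet> u = a d (trans_map c d x) \<bullet> jac c d x u)"

definition vector_density :: "'a chart set \<Rightarrow> ('a, R3) field \<Rightarrow> bool" where
  "vector_density A w \<longleftrightarrow> (\<forall>c\<in>A. \<forall>d\<in>A. \<forall>x\<in>overlap c d.
     jac c d x (w c x) = det (matrix (jac c d x)) *\<^sub>R w d (trans_map c d x))"

definition smooth_field :: "'a chart set \<Rightarrow> ('a, 'b::real_normed_vector) field \<Rightarrow> bool" where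
  "smooth_field A f \<longleftrightarrow> (\<forall>c\<in>A. smooth_on (cimg c) (f c))"

definition tangent_field :: "'a chart set \<Rightarrow> ('a, R3) field \<Rightarrow> bool" where
  "tangent_field A w \<longleftrightarrow> (\<forall>c\<in>A. \<forall>x\<in>cimg c. x $ 1 = 0 \<longrightarrow> w c x $ 1 = 0)"

definition pou_integral :: "'a chart set \<Rightarrow> ('a chart \<Rightarrow> 'a \<Rightarrow> real) \<Rightarrow> ('a, real) field \<Rightarrow> real" where
  "pou_integral F \<phi> r = (\<Sum>c\<in>F. integral (cimg c) (\<lambda>x. \<phi> c (cinv c x) * r c x))"

locale compact_3manifold =
  fixes X :: "'a topology" and A :: "'a chart set"
  assumes compact_X: "compact_space X" and manifold: "oriented_3manifold X A"
begin

lemma Hausdorff: "Hausdorff_space X"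
  and cover: "(\<Union>c\<in>A. cdom c) = topspace X"
  and openin_cdom: "c \<in> A \<Longrightarrow> openin X (cdom c)"
  and openin_cimg: "c \<in> A \<Longrightarrow> openin (top_of_set half_space) (cimg c)"
  and homeo: "c \<in> A \<Longrightarrow> homeomorphic_map (subtopology X (cdom c)) (top_of_set (cimg c)) (crd c)"
  and smooth_trans: "c \<in> A \<Longrightarrow> d \<in> A \<Longrightarrow> smooth_on (overlap c d) (trans_map c d)"
  and det_jac_pos: "c \<in> A \<Longrightarrow> d \<in> A \<Longrightarrow> x \<in> overlap c d \<Longrightarrow> det (matrix (jac c d x)) > 0"
  using manifold by (auto simp: oriented_3manifold_def)

lemma cdom_subset: "c \<in> A \<Longrightarrow> cdom c \<subseteq> topspace X"
  using cover by auto

lemma fat_cimg: "c \<in> A \<Longrightarrow> fat (cimg c)"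
  using openin_cimg fat_half_space by blast

lemma inj_crd: "c \<in> A \<Longrightarrow> inj_on (crd c) (cdom c)"
  using homeomorphic_imp_injective_map[OF homeo] cdom_subset by (metis inf.absorb_iff2 topspace_subtopology)

lemma cinv_crd: "c \<in> A \<Longrightarrow> q \<in> cdom c \<Longrightarrow> cinv c (crd c q) = q"
  by (simp add: cinv_def inj_crd)

lemma crd_cinv: "x \<in> cimg c \<Longrightarrow> crd c (cinv c x) = x"
  by (simp add: cinv_def cimg_def f_inv_into_f)

lemma cinv_in: "x \<in> cimg c \<Longrightarrow> cinv c x \<in> cdom c"
  by (simp add: cinv_def cimg_def inv_into_into)

lemma crd_in: "q \<in> cdom c \<Longrightarrow> crd c q \<in> cimg c"
  by (simp add: cimg_def)

lemma overlap_iff: "c \<in> A \<Longrightarrow> x \<in> overlap c d \<longleftrightarrow> x \<in> cimg c \<and> cinv c x \<in> cdom d"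
  unfolding overlap_def using cinv_crd crd_cinv cinv_in by (auto simp: cimg_def image_iff)

lemma overlap_subset: "overlap c d \<subseteq> cimg c"
  by (auto simp: overlap_def cimg_def)

lemma openin_overlap:
  assumes "c \<in> A" "d \<in> A"
  shows "openin (top_of_set half_space) (overlap c d)"
proof -
  have "openin (subtopology X (cdom c)) (cdom c \<inter> cdom d)"
    using assms openin_cdom by (auto simp: openin_subtopology intro!: exI[of _ "cdom d"])
  then have "openin (top_of_set (cimg c)) (overlap c d)"
    unfolding overlap_def using homeo[OF assms(1)]
    by (metis homeomorphic_map_openness_eq openin_subset)
  then show ?thesis using openin_cimg[OF assms(1)] openin_trans by blast
qed

lemma fat_overlap: "c \<in> A \<Longrightarrow> d \<in> A \<Longrightarrow> fat (overlap c d)"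
  using openin_overlap fat_half_space by blast

lemma trans_map_eq: "trans_map c d x = crd d (cinv c x)"
  by (simp add: trans_map_def)

lemma cinv_trans: "c \<in> A \<Longrightarrow> d \<in> A \<Longrightarrow> x \<in> overlap c d \<Longrightarrow> cinv d (trans_map c d x) = cinv c x"
  by (simp add: trans_map_eq cinv_crd overlap_iff)

lemma trans_in: "c \<in> A \<Longrightarrow> d \<in> A \<Longrightarrow> x \<in> overlap c d \<Longrightarrow> trans_map c d x \<in> overlap d c"
  by (simp add: overlap_iff cinv_trans trans_map_eq cinv_crd crd_in cinv_in)

lemma trans_in_cimg: "c \<in> A \<Longrightarrow> d \<in> A \<Longrightarrow> x \<in> overlap c d \<Longrightarrow> trans_map c d x \<in> cimg d"
  using trans_in overlap_subset by blast

lemma trans_trans: "c \<in> A \<Longrightarrow> d \<in> A \<Longrightarrow> x \<in> overlap c d \<Longrightarrow> trans_map d c (trans_map c d x) = x"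
  by (simp add: trans_map_eq[of d c] cinv_trans) (simp add: crd_cinv overlap_iff)

lemma trans_image: "c \<in> A \<Longrightarrow> d \<in> A \<Longrightarrow> trans_map c d ` overlap c d = overlap d c"
  using trans_in trans_trans by (auto simp: image_iff) metis

lemma inj_on_trans: "c \<in> A \<Longrightarrow> d \<in> A \<Longrightarrow> inj_on (trans_map c d) (overlap c d)"
  by (rule inj_on_inverseI[of _ "trans_map d c"]) (rule trans_trans)

lemma has_derivative_trans:
  "c \<in> A \<Longrightarrow> d \<in> A \<Longrightarrow> x \<in> overlap c d \<Longrightarrow> (trans_map c d has_derivative jac c d x) (at x within overlap c d)"
  unfolding jac_def by (rule smooth_on_has_derivative[OF smooth_trans])

lemma linear_jac: "c \<in> A \<Longrightarrow> d \<in> A \<Longrightarrow> x \<in> overlap c d \<Longrightarrow> linear (jac c d x)"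
  using has_derivative_trans has_derivative_linear by blast

lemma jac_matrix: "c \<in> A \<Longrightarrow> d \<in> A \<Longrightarrow> x \<in> overlap c d \<Longrightarrow> matrix (jac c d x) *v u = jac c d x u"
  using linear_jac matrix_works by (metis linear_matrix_vector_mul_eq)

lemma D_overlap:
  assumes "c \<in> A" "d \<in> A" "x \<in> overlap c d" "smooth_on (cimg c) f"
  shows "D (overlap c d) f x = D (cimg c) f x"
  using at_within_relatively_open[OF openin_overlap[OF assms(1,2)] assms(3)]
    at_within_relatively_open[OF openin_cimg[OF assms(1)], of x] overlap_subset assms(3) by (metis subsetD)

lemma D_pullback:
  assumes cd: "c \<in> A" "d \<in> A" "x \<in> overlap c d" and f: "smooth_on (cimg d) f"
  shows "D (overlap c d) (\<lambda>y. f (trans_map c d y)) x u = D (cimg d) f (trans_map c d x) (jac c d x u)"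
proof -
  have "((\<lambda>y. f (trans_map c d y)) has_derivative (\<lambda>u. D (cimg d) f (trans_map c d x) (jac c d x u))) (at x within overlap c d)"
    by (rule has_derivative_in_compose2[where g=f and t="cimg d" and g'="D (cimg d) f"])
      (use cd smooth_on_has_derivative[OF f] has_derivative_trans trans_in_cimg in auto)
  from frechet_fat[OF fat_overlap[OF cd(1,2)] cd(3) this] show ?thesis by simp
qed

lemma openin_sets_lebesgue: "openin (top_of_set half_space) S \<Longrightarrow> S \<in> sets lebesgue"
proof -
  assume "openin (top_of_set half_space) S"
  then obtain U where "open U" "S = half_space \<inter> U" by (auto simp: openin_open)
  then have "S \<in> sets borel" using half_space_closed by auto
  then show ?thesis by simp
qed

lemma compact_image_support:
  assumes "c \<in> A" "closedin X K" "K \<subseteq> cdom c"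
  shows "compact (crd c ` K)" "crd c ` K \<subseteq> cimg c"
proof -
  have "compactin X K" using assms(2) compact_X closedin_compact_space by blast
  then have "compactin (subtopology X (cdom c)) K" using assms(3) by (simp add: compactin_subtopology)
  then have "compactin (top_of_set (cimg c)) (crd c ` K)"
    using homeo[OF assms(1)] by (meson homeomorphic_imp_continuous_map image_compactin)
  then show "compact (crd c ` K)" "crd c ` K \<subseteq> cimg c"
    by (auto simp: compactin_subtopology compactin_euclidean_iff)
qed

text \<open>The density law absorbs the Jacobian of the change of variables, and the orientation
  makes its determinant positive, so the absolute value disappears. The common support
  \<open>K\<close> lies in both chart domains, which allows both integrals to be restricted to the
  overlap first.\<close>

lemma change_of_chart:
  assumes cd: "c \<in> A" "d \<in> A" and K: "closedin X K" "K \<subseteq> cdom c" "K \<subseteq> cdom d"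
    and r: "density_field A r" "continuous_on (cimg c) (r c)" "continuous_on (cimg d) (r d)"
    and z: "\<And>x. x \<in> cimg c \<Longrightarrow> cinv c x \<notin> K \<Longrightarrow> r c x = 0" "\<And>x. x \<in> cimg d \<Longrightarrow> cinv d x \<notin> K \<Longrightarrow> r d x = 0"
  shows "integral (cimg c) (r c) = integral (cimg d) (r d)"
proof -
  have red: "integral (cimg c) (r c) = integral (overlap c d) (r c) \<and> r c absolutely_integrable_on (overlap c d)"
    if "c \<in> A" "d \<in> A" "K \<subseteq> cdom c" "K \<subseteq> cdom d" "continuous_on (cimg c) (r c)"
      "\<And>x. x \<in> cimg c \<Longrightarrow> cinv c x \<notin> K \<Longrightarrow> r c x = 0" for c d
  proof -
    note cpt = compact_image_support[OF that(1) K(1) that(3)]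
    have zero: "r c x = 0" if "x \<in> cimg c" "x \<notin> crd c ` K" for x
      using that \<open>\<And>x. x \<in> cimg c \<Longrightarrow> cinv c x \<notin> K \<Longrightarrow> r c x = 0\<close> crd_cinv by (metis image_eqI)
    have zero': "r c x = 0" if "x \<in> overlap c d" "x \<notin> crd c ` K" for x
      using zero that overlap_subset by blast
    have sub: "crd c ` K \<subseteq> overlap c d" using that by (auto simp: overlap_def)
    have cont: "continuous_on (crd c ` K) (r c)" using that(5) cpt(2) continuous_on_subset by blast
    show ?thesis
      using compact_support_integral[OF cpt cont zero] compact_support_integral[OF cpt(1) sub cont zero']
        compact_support_abs_integrable[OF cpt(1) sub cont zero'] by auto
  qed
  have c: "integral (cimg c) (r c) = integral (overlap c d) (r c)" "r c absolutely_integrable_on (overlap c d)"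
    using red[OF cd K(2,3) r(2) z(1)] by auto
  have d: "integral (cimg d) (r d) = integral (overlap d c) (r d)" "r d absolutely_integrable_on (overlap d c)"
    using red[OF cd(2,1) K(3,2) r(3) z(2)] by auto
  let ?lift = "vec :: real \<Rightarrow> real^1"
  have ai: "(\<lambda>x. ?lift (r d x)) absolutely_integrable_on (trans_map c d ` overlap c d)"
    using d(2) by (simp add: trans_image[OF cd] absolutely_integrable_on_1_iff)
  have "integral (trans_map c d ` overlap c d) (\<lambda>x. ?lift (r d x))
     = integral (overlap c d) (\<lambda>x. \<bar>det (matrix (jac c d x))\<bar> *\<^sub>R ?lift (r d (trans_map c d x)))"
    by (rule integral_change_of_variables[OF openin_sets_lebesgue[OF openin_overlap[OF cd]] has_derivative_trans[OF cd]
          inj_on_trans[OF cd]]) (use ai in auto)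
  also have "\<dots> = integral (overlap c d) (\<lambda>x. ?lift (r c x))"
  proof (rule integral_cong)
    fix x assume x: "x \<in> overlap c d"
    have "r c x = det (matrix (jac c d x)) * r d (trans_map c d x)"
      using r(1) cd x by (simp add: density_field_def)
    then show "\<bar>det (matrix (jac c d x))\<bar> *\<^sub>R ?lift (r d (trans_map c d x)) = ?lift (r c x)"
      using det_jac_pos[OF cd x] by (simp add: vec_eq_iff)
  qed
  finally have "integral (overlap d c) (\<lambda>x. ?lift (r d x)) $ 1 = integral (overlap c d) (\<lambda>x. ?lift (r c x)) $ 1"
    by (simp add: trans_image[OF cd])
  moreover have "integral S (\<lambda>x. ?lift (f x)) $ 1 = integral S f" if "f absolutely_integrable_on S" for f and S :: "R3 set"
    using integral_on_1_eq[of S "\<lambda>x. ?lift (f x)"] by simp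
  ultimately show ?thesis using c d by simp
qed

end

section \<open>Independence of the integral from the partition of unity, and the theorem of
  Stokes\<close>

context compact_3manifold
begin

definition supp :: "('a \<Rightarrow> real) \<Rightarrow> 'a set" where
  "supp f = X closure_of {q \<in> topspace X. f q \<noteq> 0}"

lemma closedin_supp: "closedin X (supp f)"
  by (simp add: supp_def)

lemma not_in_supp: "q \<in> topspace X \<Longrightarrow> q \<notin> supp f \<Longrightarrow> f q = 0"
  unfolding supp_def using closure_of_subset[of "{q \<in> topspace X. f q \<noteq> 0}" X] by auto

lemma cinv_topspace: "c \<in> A \<Longrightarrow> x \<in> cimg c \<Longrightarrow> cinv c x \<in> topspace X"
  using cinv_in cdom_subset by blast

lemma
  assumes "partition_of_unity X A F \<phi>"
  shows pou_finite: "finite F" and pou_subset: "F \<subseteq> A"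
    and pou_smooth: "c \<in> F \<Longrightarrow> d \<in> A \<Longrightarrow> smooth_on (cimg d) (\<lambda>x. \<phi> c (cinv d x))"
    and pou_supp: "c \<in> F \<Longrightarrow> supp (\<phi> c) \<subseteq> cdom c"
    and pou_sum: "q \<in> topspace X \<Longrightarrow> (\<Sum>c\<in>F. \<phi> c q) = 1"
    and pou_nonneg: "c \<in> F \<Longrightarrow> q \<in> topspace X \<Longrightarrow> 0 \<le> \<phi> c q"
  using assms by (auto simp: partition_of_unity_def supp_def)

lemma supported_abs_integrable:
  fixes f :: "R3 \<Rightarrow> real"
  assumes "c \<in> A" "closedin X K" "K \<subseteq> cdom c" "continuous_on (cimg c) f"
    "\<And>x. x \<in> cimg c \<Longrightarrow> cinv c x \<notin> K \<Longrightarrow> f x = 0"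
  shows "f absolutely_integrable_on cimg c"
proof -
  note cpt = compact_image_support[OF assms(1-3)]
  have cont: "continuous_on (crd c ` K) f" using assms(4) cpt(2) continuous_on_subset by blast
  show ?thesis
    by (rule compact_support_abs_integrable[OF cpt cont]) (metis assms(5) crd_cinv image_eqI)
qed

lemma pou_continuous:
  assumes "partition_of_unity X A F \<phi>" "c \<in> F" "d \<in> A"
  shows "continuous_on (cimg d) (\<lambda>x. \<phi> c (cinv d x))"
  using pou_smooth[OF assms] smooth_on_imp_continuous_on by blast

lemma pou_abs_integrable:
  assumes "partition_of_unity X A F \<phi>" "c \<in> F" "continuous_on (cimg c) f"
  shows "(\<lambda>x. \<phi> c (cinv c x) * f x) absolutely_integrable_on cimg c"
proof (rule supported_abs_integrable[OF _ closedin_supp pou_supp[OF assms(1,2)]])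
  show c: "c \<in> A" using assms pou_subset by blast
  show "continuous_on (cimg c) (\<lambda>x. \<phi> c (cinv c x) * f x)"
    by (intro continuous_on_mult pou_continuous[OF assms(1,2) c] assms(3))
  show "\<phi> c (cinv c x) * f x = 0" if "x \<in> cimg c" "cinv c x \<notin> supp (\<phi> c)" for x
    using not_in_supp[OF cinv_topspace[OF c that(1)] that(2)] by simp
qed

lemma pou_integrable:
  assumes "partition_of_unity X A F \<phi>" "c \<in> F" "continuous_on (cimg c) f"
  shows "(\<lambda>x. \<phi> c (cinv c x) * f x) integrable_on cimg c"
  using pou_abs_integrable[OF assms] set_lebesgue_integral_eq_integral(1) by blast

lemma pou_integral_cong:
  assumes "\<And>c x. c \<in> F \<Longrightarrow> x \<in> cimg c \<Longrightarrow> r c x = r' c x"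
  shows "pou_integral F \<phi> r = pou_integral F \<phi> r'"
  unfolding pou_integral_def by (intro sum.cong refl integral_cong) (simp add: assms)

lemma pou_integral_add:
  assumes "partition_of_unity X A F \<phi>" "\<And>c. c \<in> A \<Longrightarrow> continuous_on (cimg c) (r c)" "\<And>c. c \<in> A \<Longrightarrow> continuous_on (cimg c) (r' c)"
  shows "pou_integral F \<phi> (\<lambda>c x. r c x + r' c x) = pou_integral F \<phi> r + pou_integral F \<phi> r'"
  unfolding pou_integral_def sum.distrib[symmetric] distrib_left
  by (intro sum.cong refl integral_add pou_integrable[OF assms(1)] assms) (use pou_subset[OF assms(1)] in auto)

lemma pou_integral_cmult: "pou_integral F \<phi> (\<lambda>c x. k * r c x) = k * pou_integral F \<phi> r"
  unfolding pou_integral_def sum_distrib_left by (simp add: mult.left_commute[of _ k])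

lemma pou_integral_0: "pou_integral F \<phi> (\<lambda>c x. 0) = 0"
  by (simp add: pou_integral_def)

text \<open>Insert the sum of all \<psi> d, which is 1, and move each summand from chart
  \<open>c\<close> to chart \<open>d\<close>; it is supported in the intersection of
  \<open>K\<close> with the support of \<psi> d, hence in both domains.\<close>

lemma pou_integral_local:
  assumes pou: "partition_of_unity X A G \<psi>" and r: "density_field A r" "\<And>c. c \<in> A \<Longrightarrow> continuous_on (cimg c) (r c)"
    and c: "c \<in> A" and K: "closedin X K" "K \<subseteq> cdom c"
    and z: "\<And>d x. d \<in> A \<Longrightarrow> x \<in> cimg d \<Longrightarrow> cinv d x \<notin> K \<Longrightarrow> r d x = 0"
  shows "integral (cimg c) (r c) = pou_integral G \<psi> r"
proof -
  have int: "(\<lambda>x. \<psi> d (cinv c x) * r c x) absolutely_integrable_on cimg c" if "d \<in> G" for d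
    by (rule supported_abs_integrable[OF c K])
      (use z c r pou_continuous[OF pou that c] in \<open>auto intro!: continuous_on_mult\<close>)
  have "integral (cimg c) (r c) = integral (cimg c) (\<lambda>x. \<Sum>d\<in>G. \<psi> d (cinv c x) * r c x)"
    by (intro integral_cong) (simp add: sum_distrib_right[symmetric] pou_sum[OF pou] cinv_topspace c)
  also have "\<dots> = (\<Sum>d\<in>G. integral (cimg c) (\<lambda>x. \<psi> d (cinv c x) * r c x))"
    using int by (intro integral_sum pou_finite[OF pou] set_lebesgue_integral_eq_integral(1))
  also have "\<dots> = (\<Sum>d\<in>G. integral (cimg d) (\<lambda>x. \<psi> d (cinv d x) * r d x))"
  proof (rule sum.cong[OF refl])
    fix d assume d: "d \<in> G"
    then have dA: "d \<in> A" using pou_subset[OF pou] by blast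
    show "integral (cimg c) (\<lambda>x. \<psi> d (cinv c x) * r c x) = integral (cimg d) (\<lambda>x. \<psi> d (cinv d x) * r d x)"
    proof (rule change_of_chart[where r="\<lambda>e x. \<psi> d (cinv e x) * r e x" and K="K \<inter> supp (\<psi> d)"])
      show "density_field A (\<lambda>e x. \<psi> d (cinv e x) * r e x)"
        using r(1) cinv_trans unfolding density_field_def by simp
      have "\<psi> d (cinv e x) * r e x = 0" if "e \<in> A" "x \<in> cimg e" "cinv e x \<notin> K \<inter> supp (\<psi> d)" for e x
        using z[OF that(1,2)] not_in_supp[OF cinv_topspace[OF that(1,2)], of "\<psi> d"] that(3) by auto
      then show "x \<in> cimg c \<Longrightarrow> cinv c x \<notin> K \<inter> supp (\<psi> d) \<Longrightarrow> \<psi> d (cinv c x) * r c x = 0"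
        "x \<in> cimg d \<Longrightarrow> cinv d x \<notin> K \<inter> supp (\<psi> d) \<Longrightarrow> \<psi> d (cinv d x) * r d x = 0" for x
        using c dA by blast+
    qed (use c dA K closedin_supp pou_supp[OF pou d] r pou_continuous[OF pou d] in \<open>auto intro!: continuous_on_mult\<close>)
  qed
  finally show ?thesis by (simp add: pou_integral_def)
qed

text \<open>Each \<phi> c r is supported in one chart, so its integral there can be computed with
  the second partition. Exchanging the finite sums and using that the \<phi> c add up to 1 gives the
  claim.\<close>

lemma pou_integral_unique:
  assumes pou: "partition_of_unity X A F \<phi>" "partition_of_unity X A G \<psi>"
    and r: "density_field A r" "\<And>c. c \<in> A \<Longrightarrow> continuous_on (cimg c) (r c)"
  shows "pou_integral F \<phi> r = pou_integral G \<psi> r"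
proof -
  have "pou_integral F \<phi> r = (\<Sum>c\<in>F. pou_integral G \<psi> (\<lambda>d x. \<phi> c (cinv d x) * r d x))"
    unfolding pou_integral_def[of F]
  proof (rule sum.cong[OF refl])
    fix c assume c: "c \<in> F"
    then have cA: "c \<in> A" using pou_subset[OF pou(1)] by blast
    show "integral (cimg c) (\<lambda>x. \<phi> c (cinv c x) * r c x) = pou_integral G \<psi> (\<lambda>d x. \<phi> c (cinv d x) * r d x)"
    proof (rule pou_integral_local[OF pou(2), where r="\<lambda>d x. \<phi> c (cinv d x) * r d x" and K="supp (\<phi> c)"])
      show "density_field A (\<lambda>e x. \<phi> c (cinv e x) * r e x)"
        using r(1) cinv_trans unfolding density_field_def by simp
      show "\<phi> c (cinv e x) * r e x = 0" if "e \<in> A" "x \<in> cimg e" "cinv e x \<notin> supp (\<phi> c)" for e x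
        using not_in_supp[OF cinv_topspace[OF that(1,2)] that(3)] by simp
    qed (use cA closedin_supp pou_supp[OF pou(1) c] r pou_continuous[OF pou(1) c] in \<open>auto intro!: continuous_on_mult\<close>)
  qed
  also have "\<dots> = (\<Sum>d\<in>G. \<Sum>c\<in>F. integral (cimg d) (\<lambda>x. \<psi> d (cinv d x) * (\<phi> c (cinv d x) * r d x)))"
    unfolding pou_integral_def by (rule sum.swap)
  also have "\<dots> = (\<Sum>d\<in>G. integral (cimg d) (\<lambda>x. \<Sum>c\<in>F. \<psi> d (cinv d x) * (\<phi> c (cinv d x) * r d x)))"
    by (intro sum.cong refl integral_sum[symmetric] pou_finite[OF pou(1)] pou_integrable[OF pou(2)] continuous_on_mult)
      (use pou_continuous[OF pou(1)] pou_subset[OF pou(2)] r(2) in auto)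
  also have "\<dots> = pou_integral G \<psi> r"
    unfolding pou_integral_def
  proof (intro sum.cong refl integral_cong)
    fix d x assume "d \<in> G" and x: "x \<in> cimg d"
    then have "d \<in> A" using pou_subset[OF pou(2)] by blast
    have "(\<Sum>c\<in>F. \<psi> d (cinv d x) * (\<phi> c (cinv d x) * r d x)) = \<psi> d (cinv d x) * ((\<Sum>c\<in>F. \<phi> c (cinv d x)) * r d x)"
      by (simp add: sum_distrib_left sum_distrib_right)
    then show "(\<Sum>c\<in>F. \<psi> d (cinv d x) * (\<phi> c (cinv d x) * r d x)) = \<psi> d (cinv d x) * r d x"
      using pou_sum[OF pou(1) cinv_topspace[OF \<open>d \<in> A\<close> x]] by simp
  qed
  finally show ?thesis .
qed

text \<open>In place of a transformation law and continuity of the integrand it suffices that every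
  partition of unity produces the same number. This form serves for the material derivative, where
  each partition is shown to give 0.\<close>

lemma mfd_integral_eqI:
  assumes "partition_of_unity X A F \<phi>"
    and r: "\<And>G \<psi>. partition_of_unity X A G \<psi> \<Longrightarrow> pou_integral G \<psi> r = I"
    and \<rho>: "\<And>c x. c \<in> A \<Longrightarrow> x \<in> cimg c \<Longrightarrow> \<rho> c x (axis 1 1) (axis 2 1) (axis 3 1) = r c x"
  shows "mfd_integral X A \<rho> = I"
proof -
  have eq: "(\<Sum>c\<in>G. integral (cimg c) (\<lambda>x. \<psi> c (cinv c x) * \<rho> c x (axis 1 1) (axis 2 1) (axis 3 1)))
      = pou_integral G \<psi> r" if "partition_of_unity X A G \<psi>" for G \<psi>
    unfolding pou_integral_def using pou_subset[OF that] \<rho> by (intro sum.cong refl integral_cong) auto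
  show ?thesis
    unfolding mfd_integral_def
  proof (rule the_equality)
    show "\<exists>F \<phi>. partition_of_unity X A F \<phi> \<and> I = (\<Sum>c\<in>F. integral (cimg c)
        (\<lambda>x. \<phi> c (cinv c x) * \<rho> c x (axis 1 1) (axis 2 1) (axis 3 1)))"
      using assms(1) eq[OF assms(1)] r[OF assms(1)] by (intro exI[of _ F] exI[of _ \<phi>]) simp
  next
    fix J assume "\<exists>F \<phi>. partition_of_unity X A F \<phi> \<and> J = (\<Sum>c\<in>F. integral (cimg c)
        (\<lambda>x. \<phi> c (cinv c x) * \<rho> c x (axis 1 1) (axis 2 1) (axis 3 1)))"
    then show "J = I" using eq r by auto
  qed
qed

lemma mfd_integral_eq:
  assumes pou: "partition_of_unity X A F \<phi>"
    and r: "density_field A r" "\<And>c. c \<in> A \<Longrightarrow> continuous_on (cimg c) (r c)"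
    and \<rho>: "\<And>c x. c \<in> A \<Longrightarrow> x \<in> cimg c \<Longrightarrow> \<rho> c x (axis 1 1) (axis 2 1) (axis 3 1) = r c x"
  shows "mfd_integral X A \<rho> = pou_integral F \<phi> r"
  by (rule mfd_integral_eqI[where r=r, OF pou]) (use pou_integral_unique[OF _ pou r] \<rho> in auto)

lemma vec_eq_sum_axis: "(u :: R3) = (\<Sum>i\<in>UNIV. u $ i *\<^sub>R axis i 1)"
  by (simp add: basis_expansion scalar_mult_eq_scaleR[symmetric])

lemma D_eq_sum:
  assumes "linear (D C f x)"
  shows "D C f x u = (\<Sum>i\<in>UNIV. u $ i *\<^sub>R partial C i f x)"
  by (subst vec_eq_sum_axis[of u]) (simp add: linear_sum[OF assms] linear_cmul[OF assms] partial_def)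

lemma linear_D: "smooth_on C f \<Longrightarrow> x \<in> C \<Longrightarrow> linear (D C f x)"
  using smooth_on_has_derivative has_derivative_linear by blast

text \<open>In each chart \<phi> div w = div(\<phi> w) - d\<phi>(w). The first term integrates to
  zero by the divergence theorem on the half-space, tangency of \<open>w\<close> providing the
  boundary condition in the first direction. The second terms add up to zero because the functions
  of the partition have constant sum.\<close>

theorem Stokes:
  assumes pou: "partition_of_unity X A F \<phi>"
    and w: "smooth_field A w" "vector_density A w" "tangent_field A w"
  shows "pou_integral F \<phi> (\<lambda>c. divg (cimg c) (w c)) = 0"
proof -
  \<comment> \<open>d\<phi>(w) in chart \<open>d\<close>, for the partition function belonging to
    \<open>c\<close>. It is a density supported where that function is, so its integral over chart
    \<open>c\<close> alone can be rewritten with the whole partition of unity.\<close>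
  define G where "G c d x = D (cimg d) (\<lambda>y. \<phi> c (cinv d y)) x (w d x)" for c d x
  have FA: "c \<in> A" if "c \<in> F" for c using pou_subset[OF pou] that by blast
  have ws: "smooth_on (cimg d) (\<lambda>x. w d x $ i)" if "d \<in> A" for d i
    using w(1) that by (intro smooth_on_component) (auto simp: smooth_field_def)
  have Gsum: "G c d x = (\<Sum>i\<in>UNIV. w d x $ i * partial (cimg d) i (\<lambda>y. \<phi> c (cinv d y)) x)"
    if "c \<in> F" "d \<in> A" "x \<in> cimg d" for c d x
    unfolding G_def by (subst D_eq_sum) (use linear_D[OF pou_smooth[OF pou that(1,2)] that(3)] in auto)
  have smooth_partial: "smooth_on (cimg d) (partial (cimg d) i (\<lambda>y. \<phi> c (cinv d y)))" if "c \<in> F" "d \<in> A" for c d i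
    unfolding partial_def by (rule smooth_on_frechet[OF fat_cimg[OF that(2)] pou_smooth[OF pou that]])
  have Gcont: "continuous_on (cimg d) (G c d)" if "c \<in> F" "d \<in> A" for c d
  proof -
    have "smooth_on (cimg d) (\<lambda>x. \<Sum>i\<in>UNIV. w d x $ i * partial (cimg d) i (\<lambda>y. \<phi> c (cinv d y)) x)"
      by (intro smooth_on_sum smooth_on_mult ws smooth_partial that)
    then show ?thesis using Gsum[OF that] smooth_on_imp_continuous_on continuous_on_cong by force
  qed
  have Gsupp: "G c d x = 0" if "c \<in> F" "d \<in> A" "x \<in> cimg d" "cinv d x \<notin> supp (\<phi> c)" for c d x
  proof -
    let ?S = "cdom d - supp (\<phi> c)"
    have "openin (subtopology X (cdom d)) ?S"
      using openin_diff[OF openin_cdom[OF that(2)] closedin_supp] by (metis Diff_subset inf.absorb_iff2 Int_commute openin_subtopology)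
    then have "openin (top_of_set (cimg d)) (crd d ` ?S)"
      using homeo[OF that(2)] by (metis homeomorphic_map_openness_eq)
    then have op: "openin (top_of_set (cimg d)) (crd d ` ?S)" .
    have x: "x \<in> crd d ` ?S" using that crd_cinv cinv_in by (metis DiffI image_eqI)
    obtain U where U: "open U" "crd d ` ?S = cimg d \<inter> U" using op by (auto simp: openin_open)
    have "0 = \<phi> c (cinv d y)" if "y \<in> cimg d" "y \<in> U" for y
    proof -
      have "y \<in> crd d ` ?S" using that U by blast
      then have "cinv d y \<notin> supp (\<phi> c)" using cinv_crd \<open>d \<in> A\<close> by force
      then show ?thesis using not_in_supp cinv_topspace \<open>d \<in> A\<close> that(1) by metis
    qed
    note zero = this
    have xU: "x \<in> U" using x U by auto
    have "((\<lambda>y. \<phi> c (cinv d y)) has_derivative (\<lambda>_. 0)) (at x within cimg d)"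
      by (rule has_derivative_extension[where F="\<lambda>_. 0", OF U(1) xU that(3) zero]) auto
    from frechet_fat[OF fat_cimg[OF that(2)] that(3) this] show ?thesis by (simp add: G_def)
  qed
  have Gdens: "density_field A (G c)" if c: "c \<in> F" for c
    unfolding density_field_def
  proof (intro ballI)
    fix d e x assume de: "d \<in> A" "e \<in> A" "x \<in> overlap d e"
    have "G c d x = D (overlap d e) (\<lambda>y. \<phi> c (cinv d y)) x (w d x)"
      unfolding G_def by (simp add: D_overlap[OF de pou_smooth[OF pou c de(1)]])
    also have "\<dots> = D (overlap d e) (\<lambda>y. \<phi> c (cinv e (trans_map d e y))) x (w d x)"
      by (rule fun_cong[OF frechet_derivative_within_cong]) (use cinv_trans de in auto)
    also have "\<dots> = D (cimg e) (\<lambda>y. \<phi> c (cinv e y)) (trans_map d e x) (jac d e x (w d x))"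
      by (rule D_pullback[OF de pou_smooth[OF pou c de(2)]])
    also have "\<dots> = det (matrix (jac d e x)) * G c e (trans_map d e x)"
      using w(2) de linear_cmul[OF linear_D[OF pou_smooth[OF pou c de(2)] trans_in_cimg[OF de]]]
      by (simp add: vector_density_def G_def)
    finally show "G c d x = det (matrix (jac d e x)) * G c e (trans_map d e x)" .
  qed
  have loc: "integral (cimg c) (\<lambda>x. \<phi> c (cinv c x) * divg (cimg c) (w c) x) = - pou_integral F \<phi> (G c)" if c: "c \<in> F" for c
  proof -
    note cA = FA[OF c]
    let ?f = "\<lambda>x. \<phi> c (cinv c x)"
    note cpt = compact_image_support[OF cA closedin_supp pou_supp[OF pou c]]
    have p: "(\<lambda>x. partial (cimg c) i (\<lambda>y. ?f y * w c y $ i) x) absolutely_integrable_on cimg c"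
      "integral (cimg c) (partial (cimg c) i (\<lambda>y. ?f y * w c y $ i)) = 0" for i
    proof -
      have sm: "smooth_on (cimg c) (\<lambda>y. ?f y * w c y $ i)"
        by (intro smooth_on_mult pou_smooth[OF pou c cA] ws cA)
      have z: "?f x * w c x $ i = 0" if "x \<in> cimg c" "x \<notin> crd c ` supp (\<phi> c)" for x
      proof -
        have "cinv c x \<notin> supp (\<phi> c)" using that crd_cinv by (metis image_eqI)
        then show ?thesis using not_in_supp[OF cinv_topspace[OF cA that(1)]] by simp
      qed
      have bd: "i = 1 \<Longrightarrow> \<forall>x\<in>cimg c. x $ 1 = 0 \<longrightarrow> ?f x * w c x $ i = 0"
        using w(3) cA by (auto simp: tangent_field_def)
      show "(\<lambda>x. partial (cimg c) i (\<lambda>y. ?f y * w c y $ i) x) absolutely_integrable_on cimg c"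
        "integral (cimg c) (partial (cimg c) i (\<lambda>y. ?f y * w c y $ i)) = 0"
        using integral_partial_derivative_zero[where i=i, OF openin_cimg[OF cA] sm cpt z bd] by (simp_all add: partial_def[abs_def])
    qed
    have prod: "partial (cimg c) i (\<lambda>y. ?f y * w c y $ i) x
        = ?f x * partial (cimg c) i (\<lambda>y. w c y $ i) x + w c x $ i * partial (cimg c) i ?f x" if "x \<in> cimg c" for x i
    proof -
      have "((\<lambda>y. ?f y * w c y $ i) has_derivative (\<lambda>h. ?f x * D (cimg c) (\<lambda>y. w c y $ i) x h + D (cimg c) ?f x h * w c x $ i)) (at x within cimg c)"
        by (intro has_derivative_mult smooth_on_has_derivative pou_smooth[OF pou c cA] ws cA that)
      from frechet_fat[OF fat_cimg[OF cA] that this] show ?thesis by (simp add: partial_def)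
    qed
    have "integral (cimg c) (\<lambda>x. ?f x * divg (cimg c) (w c) x + G c c x)
       = integral (cimg c) (\<lambda>x. \<Sum>i\<in>UNIV. partial (cimg c) i (\<lambda>y. ?f y * w c y $ i) x)"
      by (intro integral_cong) (simp add: prod Gsum[OF c cA] divg_def sum.distrib sum_distrib_left)
    also have "\<dots> = (\<Sum>i\<in>UNIV. integral (cimg c) (partial (cimg c) i (\<lambda>y. ?f y * w c y $ i)))"
      using p(1) by (intro integral_sum) (auto simp: absolutely_integrable_on_def)
    finally have "integral (cimg c) (\<lambda>x. ?f x * divg (cimg c) (w c) x + G c c x) = 0" using p(2) by simp
    moreover have "continuous_on (cimg c) (divg (cimg c) (w c))"
      unfolding divg_def partial_def
      by (intro continuous_on_sum smooth_on_imp_continuous_on smooth_on_frechet fat_cimg ws cA)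
    then have "(\<lambda>x. ?f x * divg (cimg c) (w c) x) integrable_on cimg c" by (rule pou_integrable[OF pou c])
    moreover have "G c c integrable_on cimg c"
      using supported_abs_integrable[OF cA closedin_supp pou_supp[OF pou c] Gcont[OF c cA] Gsupp[OF c cA]]
      by (auto simp: absolutely_integrable_on_def)
    ultimately have "integral (cimg c) (\<lambda>x. ?f x * divg (cimg c) (w c) x) = - integral (cimg c) (G c c)"
      by (simp add: integral_add)
    also have "integral (cimg c) (G c c) = pou_integral F \<phi> (G c)"
      using pou_integral_local[OF pou Gdens[OF c] Gcont[OF c] cA closedin_supp pou_supp[OF pou c] Gsupp[OF c]] .
    finally show ?thesis .
  qed
  have "pou_integral F \<phi> (\<lambda>c. divg (cimg c) (w c)) = - (\<Sum>c\<in>F. pou_integral F \<phi> (G c))"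
    unfolding pou_integral_def[of F \<phi> "\<lambda>c. divg (cimg c) (w c)"] sum_negf[symmetric] by (rule sum.cong[OF refl loc])
  \<comment> \<open>Exchanging the two sums brings together the derivatives of all partition
    functions in one chart; their sum is the derivative of the constant 1.\<close>
  also have "(\<Sum>c\<in>F. pou_integral F \<phi> (G c)) = (\<Sum>d\<in>F. \<Sum>c\<in>F. integral (cimg d) (\<lambda>x. \<phi> d (cinv d x) * G c d x))"
    unfolding pou_integral_def by (rule sum.swap)
  also have "\<dots> = (\<Sum>d\<in>F. integral (cimg d) (\<lambda>x. \<Sum>c\<in>F. \<phi> d (cinv d x) * G c d x))"
    by (intro sum.cong refl integral_sum[symmetric] pou_finite[OF pou] pou_integrable[OF pou] Gcont FA)
  also have "\<dots> = 0"
  proof (intro sum.neutral ballI)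
    fix d assume d: "d \<in> F"
    have z: "(\<Sum>c\<in>F. G c d x) = 0" if x: "x \<in> cimg d" for x
    proof -
      have "((\<lambda>y. \<Sum>c\<in>F. \<phi> c (cinv d y)) has_derivative (\<lambda>u. \<Sum>c\<in>F. D (cimg d) (\<lambda>y. \<phi> c (cinv d y)) x u)) (at x within cimg d)"
        by (intro has_derivative_sum smooth_on_has_derivative pou_smooth[OF pou] FA d x)
      then have "D (cimg d) (\<lambda>y. \<Sum>c\<in>F. \<phi> c (cinv d y)) x = (\<lambda>u. \<Sum>c\<in>F. D (cimg d) (\<lambda>y. \<phi> c (cinv d y)) x u)"
        by (rule frechet_fat[OF fat_cimg[OF FA[OF d]] x])
      moreover have "D (cimg d) (\<lambda>y. \<Sum>c\<in>F. \<phi> c (cinv d y)) x = D (cimg d) (\<lambda>y. 1) x"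
        by (rule frechet_derivative_within_cong[OF _ x]) (simp add: pou_sum[OF pou] cinv_topspace FA d)
      moreover have "D (cimg d) (\<lambda>y. 1::real) x = (\<lambda>_. 0)"
        by (rule frechet_fat[OF fat_cimg[OF FA[OF d]] x]) simp
      ultimately show ?thesis unfolding G_def by metis
    qed
    then show "integral (cimg d) (\<lambda>x. \<Sum>c\<in>F. \<phi> d (cinv d x) * G c d x) = 0"
      by (subst integral_cong[where g="\<lambda>_. 0"]) (simp_all add: sum_distrib_left[symmetric])
  qed
  finally show ?thesis by simp
qed

end

section \<open>Existence of partitions of unity\<close>

text \<open>All powers are treated at once because the derivative of the n-th function is a
  combination of those with indices n + 1 and n + 2. The family is closed under differentiation, and
  smoothness follows by induction.\<close>

definition flat_exp :: "nat \<Rightarrow> real \<Rightarrow> real" where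
  "flat_exp n x = (if x > 0 then inverse x ^ n * exp (- inverse x) else 0)"

lemma flat_exp_tendsto: "(flat_exp n \<longlongrightarrow> 0) (at 0)"
proof -
  have "((\<lambda>x::real. inverse x ^ n / exp (inverse x)) \<longlongrightarrow> 0) (at_right 0)"
    by (rule filterlim_compose[OF tendsto_power_div_exp_0 filterlim_inverse_at_top_right])
  then have "(flat_exp n \<longlongrightarrow> 0) (at_right 0)"
    by (rule Lim_transform_eventually) (auto simp: flat_exp_def eventually_at_right_less exp_minus divide_inverse
        intro!: eventually_mono[OF eventually_at_right_less])
  moreover have "(flat_exp n \<longlongrightarrow> 0) (at_left 0)"
    by (rule Lim_transform_eventually[OF tendsto_const])
      (auto simp: flat_exp_def intro!: eventually_mono[OF eventually_at_left_real[of "-1"]])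
  ultimately show ?thesis by (simp add: filterlim_split_at)
qed

lemma flat_exp_deriv:
  "(flat_exp n has_real_derivative flat_exp (n + 2) x - of_nat n * flat_exp (n + 1) x) (at x)"
proof -
  consider "x > 0" | "x < 0" | "x = 0" by linarith
  then show ?thesis
  proof cases
    case 1
    have "((\<lambda>x. inverse x ^ n * exp (- inverse x)) has_real_derivative flat_exp (n + 2) x - of_nat n * flat_exp (n + 1) x) (at x)"
      using 1 power_eq_if[of x "n - 1"]
      by (cases n) (auto intro!: derivative_eq_intros simp: flat_exp_def field_simps power2_eq_square)
    then show ?thesis
      by (rule has_field_derivative_transform_within_open[of _ _ _ "{0<..}"]) (use 1 in \<open>auto simp: flat_exp_def\<close>)
  next
    case 2
    then have "((\<lambda>x. 0) has_real_derivative flat_exp (n + 2) x - of_nat n * flat_exp (n + 1) x) (at x)"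
      by (simp add: flat_exp_def)
    then show ?thesis
      by (rule has_field_derivative_transform_within_open[of _ _ _ "{..<0}"]) (use 2 in \<open>auto simp: flat_exp_def\<close>)
  next
    case 3
    \<comment> \<open>Dividing by h raises the index by one, so the difference quotient at 0 is the
      next member of the family, which tends to 0.\<close>
    have "((\<lambda>h. (flat_exp n (0 + h) - flat_exp n 0) / h) \<longlongrightarrow> 0) (at 0)"
      by (rule Lim_transform_eventually[OF flat_exp_tendsto[of "n + 1"]])
        (auto simp: flat_exp_def divide_inverse eventually_at_filter)
    then show ?thesis using 3 by (simp add: DERIV_def flat_exp_def)
  qed
qed

lemma Ck_on_flat_exp: "Ck_on k UNIV (flat_exp n)"
proof (induction k arbitrary: n)
  case 0
  have "isCont (flat_exp n) x" for x using flat_exp_deriv DERIV_isCont by blast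
  then show ?case by (simp add: continuous_at_imp_continuous_on)
next
  case (Suc k)
  show ?case
  proof (rule Ck_on_SucI[where f'="\<lambda>x u. u *\<^sub>R (flat_exp (n + 2) x + - (of_nat n *\<^sub>R flat_exp (n + 1) x))"])
    show "(flat_exp n has_derivative (\<lambda>u. u *\<^sub>R (flat_exp (n + 2) x + - (of_nat n *\<^sub>R flat_exp (n + 1) x)))) (at x)" for x
      by (rule has_derivative_eq_rhs[OF flat_exp_deriv[of n x, unfolded has_field_derivative_def]]) (rule ext, simp add: algebra_simps)
    show "Ck_on k UNIV (\<lambda>x. u *\<^sub>R (flat_exp (n + 2) x + - (of_nat n *\<^sub>R flat_exp (n + 1) x)))" for u :: real
      by (intro Ck_on_bounded_linear[OF bounded_linear_scaleR_right] Ck_on_add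
          Ck_on_bounded_linear[OF bounded_linear_minus[OF bounded_linear_ident]] Suc) auto
  qed auto
qed

text \<open>The squared distance keeps the argument polynomial; the norm itself would not be smooth
  at the centre.\<close>

definition bump :: "R3 \<Rightarrow> real \<Rightarrow> R3 \<Rightarrow> real" where
  "bump y r x = flat_exp 0 (r\<^sup>2 - (x - y) \<bullet> (x - y))"

lemma smooth_bump: "smooth_on S (bump y r)"
  unfolding bump_def
  by (rule smooth_on_compose[OF smooth_on_open[OF open_UNIV Ck_on_flat_exp]])
    (auto intro!: smooth_intros smooth_on_bilinear[OF bounded_bilinear_inner])

lemma bump_nonneg: "0 \<le> bump y r x"
  by (simp add: bump_def flat_exp_def)

lemma bump_pos_iff: "r > 0 \<Longrightarrow> bump y r x \<noteq> 0 \<longleftrightarrow> x \<in> ball y r"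
  by (auto simp: bump_def flat_exp_def dist_norm norm_minus_commute power2_norm_eq_inner[symmetric]
      power_mono_iff power2_less_imp_less intro: power_strict_mono)

lemma smooth_on_local:
  assumes "\<And>x. x \<in> S \<Longrightarrow> \<exists>V. openin (top_of_set S) V \<and> x \<in> V \<and> smooth_on V f"
  shows "smooth_on S f"
proof (rule smooth_onI)
  fix x assume "x \<in> S"
  then obtain V where V: "openin (top_of_set S) V" "x \<in> V" "smooth_on V f" using assms by blast
  obtain W where W: "open W" "V = S \<inter> W" using V(1) by (auto simp: openin_open)
  obtain U F where U: "open U" "x \<in> U" "\<And>k. Ck_on k U F" "\<And>y. y \<in> V \<Longrightarrow> y \<in> U \<Longrightarrow> F y = f y"
    using smooth_onE[OF V(3,2)] by metis
  have "Ck_on k (U \<inter> W) F" for k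
    by (rule Ck_on_subset[OF U(1) _ _ U(3)]) (use U W in auto)
  then show "\<exists>U F. open U \<and> x \<in> U \<and> (\<forall>k. Ck_on k U F) \<and> (\<forall>y\<in>S \<inter> U. F y = f y)"
    using U V W by (intro exI[of _ "U \<inter> W"] exI[of _ F]) auto
qed

context compact_3manifold
begin

text \<open>A bump in coordinates is pulled back and extended by zero outside the chart domain. It
  vanishes off the preimage of a closed half-ball contained in the chart image; this preimage is
  compact, and the Hausdorff property makes it closed in the whole manifold, so the extension by
  zero is smooth.\<close>

lemma local_bump:
  assumes "q \<in> topspace X"
  obtains c and b :: "'a \<Rightarrow> real" and K where "c \<in> A" "closedin X K" "K \<subseteq> cdom c" "\<And>p. p \<in> topspace X \<Longrightarrow> 0 \<le> b p" "b q > 0"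
    "\<And>p. p \<in> topspace X \<Longrightarrow> b p \<noteq> 0 \<Longrightarrow> p \<in> K" "openin X {p \<in> topspace X. b p \<noteq> 0}"
    "\<And>d. d \<in> A \<Longrightarrow> smooth_on (cimg d) (\<lambda>x. b (cinv d x))"
proof -
  obtain c where c: "c \<in> A" "q \<in> cdom c" using assms cover by blast
  obtain U where U: "open U" "cimg c = half_space \<inter> U" using openin_cimg[OF c(1)] by (auto simp: openin_open)
  define y where "y = crd c q"
  have "y \<in> U" using crd_in[OF c(2)] U by (auto simp: y_def)
  then obtain r where r: "r > 0" "cball y r \<subseteq> U" using U(1) open_contains_cball by metis
  define b where "b p = (if p \<in> cdom c then bump y r (crd c p) else 0)" for p
  define L where "L = half_space \<inter> cball y r"
  define K where "K = cinv c ` L"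
  have L: "compact L" "L \<subseteq> cimg c"
    using half_space_closed r U by (auto simp: L_def Int_commute intro: compact_Int_closed)
  have Kc: "K \<subseteq> cdom c" using L(2) cinv_in by (auto simp: K_def)
  have cm: "continuous_map (top_of_set (cimg c)) (subtopology X (cdom c)) (cinv c)"
  proof -
    obtain k where k: "homeomorphic_maps (subtopology X (cdom c)) (top_of_set (cimg c)) (crd c) k"
      using homeo[OF c(1)] homeomorphic_map_maps by blast
    have "k x = cinv c x" if "x \<in> cimg c" for x
    proof -
      have "cinv c x \<in> topspace (subtopology X (cdom c))"
        using cinv_in[OF that] cdom_subset[OF c(1)] by auto
      then have "k (crd c (cinv c x)) = cinv c x" using k by (simp add: homeomorphic_maps_def)
      then show ?thesis by (simp add: crd_cinv[OF that])
    qed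
    then show ?thesis using k by (auto simp: homeomorphic_maps_def intro: continuous_map_eq)
  qed
  have "compactin (top_of_set (cimg c)) L" using L by (simp add: compactin_subtopology compactin_euclidean_iff)
  then have "compactin (subtopology X (cdom c)) K" unfolding K_def using cm image_compactin by blast
  then have "compactin X K" by (simp add: compactin_subtopology)
  then have Kcl: "closedin X K" using Hausdorff compactin_imp_closedin by blast
  have bK: "p \<in> K" if "b p \<noteq> 0" for p
  proof -
    have p: "p \<in> cdom c" "crd c p \<in> ball y r" using that bump_pos_iff[OF r(1)] by (auto simp: b_def split: if_splits)
    then have "crd c p \<in> L" using crd_in[OF p(1)] U by (auto simp: L_def)
    then show ?thesis using cinv_crd[OF c(1) p(1)] by (force simp: K_def)
  qed
  have op: "openin X {p \<in> topspace X. b p \<noteq> 0}"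
  proof -
    have "{p \<in> topspace X. b p \<noteq> 0} = {p \<in> topspace (subtopology X (cdom c)). crd c p \<in> cimg c \<inter> ball y r}"
      using bump_pos_iff[OF r(1)] cdom_subset[OF c(1)] crd_in by (auto simp: b_def split: if_splits)
    moreover have "openin (subtopology X (cdom c)) {p \<in> topspace (subtopology X (cdom c)). crd c p \<in> cimg c \<inter> ball y r}"
      by (rule openin_continuous_map_preimage[OF homeomorphic_imp_continuous_map[OF homeo[OF c(1)]]]) auto
    ultimately show ?thesis using openin_cdom[OF c(1)] openin_trans_full by metis
  qed
  have sm: "smooth_on (cimg d) (\<lambda>x. b (cinv d x))" if d: "d \<in> A" for d
  proof (rule smooth_on_local)
    fix x assume x: "x \<in> cimg d"
    show "\<exists>V. openin (top_of_set (cimg d)) V \<and> x \<in> V \<and> smooth_on V (\<lambda>x. b (cinv d x))"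
    \<comment> \<open>The overlap with chart \<open>c\<close> and the complement of the closed set
      \<open>K\<close> are open, and they cover the chart \<open>d\<close> because \<open>K\<close>
      lies in the domain of \<open>c\<close>. On the second set the bump is identically
      zero.\<close>
    proof (cases "cinv d x \<in> cdom c")
      case True
      have "smooth_on (overlap d c) (\<lambda>x. bump y r (trans_map d c x))"
        by (rule smooth_on_compose[OF smooth_bump[of UNIV] smooth_trans[OF d c(1)]]) auto
      then have "smooth_on (overlap d c) (\<lambda>x. b (cinv d x))"
        by (rule smooth_on_cong[THEN iffD1, rotated]) (simp add: b_def trans_map_eq overlap_iff d)
      moreover have "openin (top_of_set (cimg d)) (overlap d c)"
        using openin_overlap[OF d c(1)] openin_cimg[OF d] overlap_subset[of d c]
        by (metis openin_subset_trans openin_imp_subset)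
      ultimately show ?thesis using True x d overlap_iff by blast
    next
      case False
      let ?S = "cdom d - K"
      have "openin (subtopology X (cdom d)) ?S"
        using openin_diff[OF openin_cdom[OF d] Kcl] by (metis Diff_subset inf.absorb_iff2 Int_commute openin_subtopology)
      then have "openin (top_of_set (cimg d)) (crd d ` ?S)"
        using homeo[OF d] by (metis homeomorphic_map_openness_eq)
      moreover have "x \<in> crd d ` ?S" using x False Kc crd_cinv cinv_in by (metis DiffI image_eqI subsetD)
      moreover have "smooth_on (crd d ` ?S) (\<lambda>x. b (cinv d x))"
        by (rule smooth_on_cong[THEN iffD1, OF _ smooth_on_const[of _ 0]]) (use bK cinv_crd[OF d] in force)
      ultimately show ?thesis by blast
    qed
  qed
  have "b q \<noteq> 0" using c bump_pos_iff[OF r(1), of y y] r(1) by (simp add: b_def y_def)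
  moreover have "0 \<le> b p" for p by (simp add: b_def bump_nonneg)
  ultimately show ?thesis using that[of c K b] c Kcl Kc bK op sm by (metis order_le_less)
qed

text \<open>By compactness finitely many of the open sets on which a local bump is nonzero cover the
  manifold, so the sum of these bumps is positive everywhere and can be divided out.\<close>

lemma partition_of_unity_exists: "\<exists>F \<phi>. partition_of_unity X A F \<phi>"
proof -
  define P where "P q c b K \<longleftrightarrow> (q \<in> topspace X \<longrightarrow> c \<in> A \<and> closedin X K \<and> K \<subseteq> cdom c \<and> (\<forall>p\<in>topspace X. 0 \<le> b p) \<and> b q > (0::real)
    \<and> (\<forall>p\<in>topspace X. b p \<noteq> 0 \<longrightarrow> p \<in> K) \<and> openin X {p \<in> topspace X. b p \<noteq> 0}
    \<and> (\<forall>d\<in>A. smooth_on (cimg d) (\<lambda>x. b (cinv d x))))" for q c b K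
  have "\<forall>q. \<exists>c b K. P q c b K"
  proof
    fix q
    show "\<exists>c b K. P q c b K"
    proof (cases "q \<in> topspace X")
      case True
      show ?thesis unfolding P_def by (rule local_bump[OF True]) blast
    qed (simp add: P_def)
  qed
  from choice[OF this] obtain c where "\<forall>q. \<exists>b K. P q (c q) b K" by blast
  from choice[OF this] obtain b where "\<forall>q. \<exists>K. P q (c q) (b q) K" by blast
  from choice[OF this] obtain K where P: "\<forall>q. P q (c q) (b q) (K q)" by blast
  have b: "c q \<in> A" "closedin X (K q)" "K q \<subseteq> cdom (c q)" "\<And>p. p \<in> topspace X \<Longrightarrow> 0 \<le> b q p" "b q q > 0"
    "\<And>p. p \<in> topspace X \<Longrightarrow> b q p \<noteq> 0 \<Longrightarrow> p \<in> K q" "openin X {p \<in> topspace X. b q p \<noteq> 0}"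
    "\<And>d. d \<in> A \<Longrightarrow> smooth_on (cimg d) (\<lambda>x. b q (cinv d x))" if "q \<in> topspace X" for q
    using P that unfolding P_def by blast+
  let ?V = "\<lambda>q. {p \<in> topspace X. b q p \<noteq> 0}"
  have "compactin X (topspace X)" using compact_X by (simp add: compact_space_def)
  moreover have "Ball (?V ` topspace X) (openin X)" using b(7) by auto
  moreover have "topspace X \<subseteq> \<Union>(?V ` topspace X)" using b(5) by fastforce
  ultimately obtain Q where Q: "finite Q" "Q \<subseteq> topspace X" "topspace X \<subseteq> \<Union>(?V ` Q)"
    unfolding compactin_def by (metis (no_types, lifting) finite_subset_image)
  define S where "S p = (\<Sum>q\<in>Q. b q p)" for p
  have S: "S p > 0" if p: "p \<in> topspace X" for p
  proof -
    obtain q where "q \<in> Q" "b q p \<noteq> 0" using p Q(3) by auto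
    then show ?thesis unfolding S_def using b(4)[OF _ p] Q
      by (intro sum_pos2[of Q q]) (auto simp: less_le)
  qed
  \<comment> \<open>A partition of unity is indexed by charts, and several points of
    \<open>Q\<close> may have been assigned the same chart; their bumps are therefore added.\<close>
  define \<phi> where "\<phi> d p = (\<Sum>q\<in>{q\<in>Q. c q = d}. b q p) / S p" for d p
  have sm: "smooth_on (cimg e) (\<lambda>x. \<phi> d (cinv e x))" if "e \<in> A" for d e
    unfolding \<phi>_def S_def
  proof (intro smooth_on_divide smooth_on_sum)
    show "(\<Sum>q\<in>Q. b q (cinv e x)) \<noteq> 0" if "x \<in> cimg e" for x
      using S[OF cinv_topspace[OF \<open>e \<in> A\<close> that]] by (simp add: S_def)
  qed (use b(8) Q \<open>e \<in> A\<close> in auto)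
  have supp: "X closure_of {q \<in> topspace X. \<phi> d q \<noteq> 0} \<subseteq> cdom d" for d
  proof -
    let ?K = "\<Union>q\<in>{q\<in>Q. c q = d}. K q"
    have "{q \<in> topspace X. \<phi> d q \<noteq> 0} \<subseteq> ?K"
    proof
      fix p assume p: "p \<in> {q \<in> topspace X. \<phi> d q \<noteq> 0}"
      then obtain q where "q \<in> Q" "c q = d" "b q p \<noteq> 0"
        by (auto simp: \<phi>_def elim!: sum.not_neutral_contains_not_neutral)
      then show "p \<in> ?K" using b(6) p Q by blast
    qed
    moreover have "closedin X ?K" using b(2) Q by (intro closedin_Union) auto
    ultimately have "X closure_of {q \<in> topspace X. \<phi> d q \<noteq> 0} \<subseteq> ?K" by (rule closure_of_minimal)
    then show ?thesis using b(3) Q by blast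
  qed
  have "(\<Sum>d\<in>c ` Q. \<phi> d p) = 1" if p: "p \<in> topspace X" for p
  proof -
    have "(\<Sum>d\<in>c ` Q. \<phi> d p) = (\<Sum>d\<in>c ` Q. \<Sum>q\<in>{q\<in>Q. c q = d}. b q p) / S p"
      by (simp add: \<phi>_def sum_divide_distrib)
    also have "(\<Sum>d\<in>c ` Q. \<Sum>q\<in>{q\<in>Q. c q = d}. b q p) = S p"
      unfolding S_def by (rule sum.image_gen[OF Q(1), symmetric])
    finally show ?thesis using S[OF p] by simp
  qed
  moreover have "0 \<le> \<phi> d p" if p: "p \<in> topspace X" for d p
    unfolding \<phi>_def using S[OF p] b(4)[OF _ p] Q by (intro divide_nonneg_pos sum_nonneg) auto
  ultimately have "partition_of_unity X A (c ` Q) \<phi>"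
    unfolding partition_of_unity_def using Q b(1) sm supp by blast
  then show ?thesis by blast
qed

end

section \<open>Vector calculus in a chart\<close>

unbundle cross3_syntax

definition grad :: "R3 set \<Rightarrow> (R3 \<Rightarrow> real) \<Rightarrow> R3 \<Rightarrow> R3" where
  "grad C f x = (\<chi> i. partial C i f x)"

text \<open>No metric enters: for a one-form with components \<open>a\<close> these are the
  components of its exterior derivative in the order 23, 31, 12. In the same spirit \<times> is the
  wedge product of one-forms, and the inner product of a covector with a vector density is the
  density of a three-form.\<close>

definition rot :: "R3 set \<Rightarrow> (R3 \<Rightarrow> R3) \<Rightarrow> R3 \<Rightarrow> R3" where
  "rot C a x = vector [partial C 2 (\<lambda>y. a y $ 3) x - partial C 3 (\<lambda>y. a y $ 2) x,
     partial C 3 (\<lambda>y. a y $ 1) x - partial C 1 (\<lambda>y. a y $ 3) x,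
     partial C 1 (\<lambda>y. a y $ 2) x - partial C 2 (\<lambda>y. a y $ 1) x]"

lemma grad_nth [simp]: "grad C f x $ i = partial C i f x"
  by (simp add: grad_def)

lemma rot_nth [simp]:
  "rot C a x $ 1 = partial C 2 (\<lambda>y. a y $ 3) x - partial C 3 (\<lambda>y. a y $ 2) x"
  "rot C a x $ 2 = partial C 3 (\<lambda>y. a y $ 1) x - partial C 1 (\<lambda>y. a y $ 3) x"
  "rot C a x $ 3 = partial C 1 (\<lambda>y. a y $ 2) x - partial C 2 (\<lambda>y. a y $ 1) x"
  by (simp_all add: rot_def vector_3)

lemma partial_cong: "(\<And>y. y \<in> C \<Longrightarrow> f y = g y) \<Longrightarrow> x \<in> C \<Longrightarrow> partial C i f x = partial C i g x"
  unfolding partial_def using frechet_derivative_within_cong[of C f g x] by simp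

lemma grad_cong: "(\<And>y. y \<in> C \<Longrightarrow> f y = g y) \<Longrightarrow> x \<in> C \<Longrightarrow> grad C f x = grad C g x"
  unfolding vec_eq_iff grad_nth using partial_cong[of C f g x] by blast

lemma rot_cong:
  assumes "\<And>y. y \<in> C \<Longrightarrow> f y = g y" "x \<in> C"
  shows "rot C f x = rot C g x"
proof -
  have "partial C i (\<lambda>y. f y $ j) x = partial C i (\<lambda>y. g y $ j) x" for i j
    by (rule partial_cong) (simp_all add: assms)
  then show ?thesis by (simp add: rot_def)
qed

lemma divg_cong:
  assumes "\<And>y. y \<in> C \<Longrightarrow> f y = g y" "x \<in> C"
  shows "divg C f x = divg C g x"
  unfolding divg_def by (intro sum.cong refl partial_cong) (simp_all add: assms)

lemma grad_inner: "smooth_on C f \<Longrightarrow> x \<in> C \<Longrightarrow> grad C f x \<bullet> u = D C f x u"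
proof -
  assume a: "smooth_on C f" "x \<in> C"
  have l: "linear (D C f x)" using smooth_on_has_derivative[OF a] has_derivative_linear by blast
  have "u = (\<Sum>i\<in>UNIV. u $ i *\<^sub>R axis i 1)"
    by (simp add: basis_expansion scalar_mult_eq_scaleR[symmetric])
  then have "D C f x u = D C f x (\<Sum>i\<in>UNIV. u $ i *\<^sub>R axis i 1)" by simp
  also have "\<dots> = (\<Sum>i\<in>UNIV. u $ i * partial C i f x)"
    by (simp add: linear_sum[OF l] linear_cmul[OF l] partial_def)
  finally show ?thesis by (simp add: inner_vec_def mult.commute)
qed

context
  fixes C :: "R3 set"
  assumes fat: "fat C"
begin

lemma smooth_partial: "smooth_on C f \<Longrightarrow> smooth_on C (partial C i f)"
  unfolding partial_def by (rule smooth_on_frechet[OF fat])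

lemma partial_eqI:
  "(f has_derivative f') (at x within C) \<Longrightarrow> x \<in> C \<Longrightarrow> partial C i f x = f' (axis i 1)"
  unfolding partial_def by (rule fun_cong[OF frechet_fat[OF fat]])

lemma partial_const: "x \<in> C \<Longrightarrow> partial C i (\<lambda>_. k) x = 0"
  by (subst partial_eqI[OF has_derivative_const]) auto

lemma partial_add: "smooth_on C f \<Longrightarrow> smooth_on C g \<Longrightarrow> x \<in> C \<Longrightarrow>
    partial C i (\<lambda>y. f y + g y) x = partial C i f x + partial C i g x"
  by (subst partial_eqI[OF has_derivative_add[OF smooth_on_has_derivative smooth_on_has_derivative]]) (auto simp: partial_def)

lemma partial_diff: "smooth_on C f \<Longrightarrow> smooth_on C g \<Longrightarrow> x \<in> C \<Longrightarrow>
    partial C i (\<lambda>y. f y - g y) x = partial C i f x - partial C i g x"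
  by (subst partial_eqI[OF has_derivative_diff[OF smooth_on_has_derivative smooth_on_has_derivative]]) (auto simp: partial_def)

lemma partial_minus: "smooth_on C f \<Longrightarrow> x \<in> C \<Longrightarrow> partial C i (\<lambda>y. - f y) x = - partial C i f x"
  by (subst partial_eqI[OF has_derivative_minus[OF smooth_on_has_derivative]]) (auto simp: partial_def)

lemma partial_mult: "smooth_on C f \<Longrightarrow> smooth_on C g \<Longrightarrow> x \<in> C \<Longrightarrow>
    partial C i (\<lambda>y. f y * g y :: real) x = partial C i f x * g x + f x * partial C i g x"
  by (subst partial_eqI[OF has_derivative_mult[OF smooth_on_has_derivative smooth_on_has_derivative]]) (auto simp: partial_def)

lemma partial_sum: "(\<And>j. j \<in> I \<Longrightarrow> smooth_on C (f j)) \<Longrightarrow> x \<in> C \<Longrightarrow>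
    partial C i (\<lambda>y. \<Sum>j\<in>I. f j y) x = (\<Sum>j\<in>I. partial C i (f j) x)"
  by (subst partial_eqI[OF has_derivative_sum[OF smooth_on_has_derivative]]) (auto simp: partial_def)

lemma partial_real_fun:
  assumes "smooth_on C f" "x \<in> C" "(\<phi> has_real_derivative d) (at (f x))"
  shows "partial C i (\<lambda>y. \<phi> (f y)) x = d * partial C i f x"
proof -
  have "((\<lambda>y. \<phi> (f y)) has_derivative (\<lambda>u. d * D C f x u)) (at x within C)"
    using has_derivative_compose[OF smooth_on_has_derivative[OF assms(1,2)] assms(3)[unfolded has_field_derivative_def]] .
  from partial_eqI[OF this assms(2)] show ?thesis by (simp add: partial_def)
qed

lemma partial_commute: "smooth_on C f \<Longrightarrow> x \<in> C \<Longrightarrow> partial C i (partial C j f) x = partial C j (partial C i (f :: R3 \<Rightarrow> real)) x"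
  unfolding partial_def[abs_def] by (rule frechet_symmetric[OF fat])

lemma smooth_grad: "smooth_on C f \<Longrightarrow> smooth_on C (grad C f)"
  by (rule smooth_on_vec) (simp add: smooth_partial)

lemma smooth_rot: "smooth_on C a \<Longrightarrow> smooth_on C (rot C a)"
proof (rule smooth_on_vec)
  fix i :: 3 assume a: "smooth_on C a"
  have "smooth_on C (\<lambda>x. partial C i (\<lambda>y. a y $ j) x - partial C k (\<lambda>y. a y $ l) x)" for i j k l
    by (intro smooth_on_diff smooth_partial smooth_on_component a)
  then show "smooth_on C (\<lambda>x. rot C a x $ i)" using exhaust_3[of i] by auto
qed

lemma smooth_divg: "smooth_on C a \<Longrightarrow> smooth_on C (divg C a)"
  unfolding divg_def by (intro smooth_on_sum smooth_partial smooth_on_component)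

lemma smooth_cross: "smooth_on C a \<Longrightarrow> smooth_on C b \<Longrightarrow> smooth_on C (\<lambda>x. a x \<times> b x)"
proof (rule smooth_on_vec)
  fix i :: 3 assume "smooth_on C a" "smooth_on C b"
  then have "smooth_on C (\<lambda>x. a x $ i * b x $ j - b x $ k * a x $ l)" "smooth_on C (\<lambda>x. a x $ i * b x $ j - a x $ k * b x $ l)" for i j k l
    by (auto intro!: smooth_intros)
  then show "smooth_on C (\<lambda>x. (a x \<times> b x) $ i)"
    using exhaust_3[of i] by (auto simp: cross_components)
qed

lemma smooth_inner: "smooth_on C a \<Longrightarrow> smooth_on C b \<Longrightarrow> smooth_on C (\<lambda>x. a x \<bullet> b x)"
  by (rule smooth_on_bilinear[OF bounded_bilinear_inner])

lemmas partial_simps = partial_const partial_add partial_diff partial_minus partial_mult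
  smooth_partial smooth_on_component smooth_on_add smooth_on_diff smooth_on_minus smooth_on_mult smooth_on_scaleR

lemma grad_add: "smooth_on C f \<Longrightarrow> smooth_on C g \<Longrightarrow> x \<in> C \<Longrightarrow> grad C (\<lambda>y. f y + g y) x = grad C f x + grad C g x"
  by (simp add: vec_eq_iff partial_simps)

lemma grad_mult: "smooth_on C f \<Longrightarrow> smooth_on C g \<Longrightarrow> x \<in> C \<Longrightarrow>
    grad C (\<lambda>y. f y * g y) x = g x *\<^sub>R grad C f x + f x *\<^sub>R grad C g x"
  by (simp add: vec_eq_iff partial_simps)

lemma rot_add: "smooth_on C a \<Longrightarrow> smooth_on C b \<Longrightarrow> x \<in> C \<Longrightarrow> rot C (\<lambda>y. a y + b y) x = rot C a x + rot C b x"
  by (simp add: vec_eq_iff forall_3 partial_simps)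

lemma rot_diff: "smooth_on C a \<Longrightarrow> smooth_on C b \<Longrightarrow> x \<in> C \<Longrightarrow> rot C (\<lambda>y. a y - b y) x = rot C a x - rot C b x"
  by (simp add: vec_eq_iff forall_3 partial_simps)

lemma rot_scaleR: "smooth_on C f \<Longrightarrow> smooth_on C a \<Longrightarrow> x \<in> C \<Longrightarrow>
    rot C (\<lambda>y. f y *\<^sub>R a y) x = grad C f x \<times> a x + f x *\<^sub>R rot C a x"
  by (simp add: vec_eq_iff forall_3 partial_simps cross_components algebra_simps)

lemma divg_scaleR: "smooth_on C f \<Longrightarrow> smooth_on C a \<Longrightarrow> x \<in> C \<Longrightarrow>
    divg C (\<lambda>y. f y *\<^sub>R a y) x = grad C f x \<bullet> a x + f x * divg C a x"
  by (simp add: divg_def sum_3 partial_simps inner_vec_def algebra_simps)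

lemma divg_cross: "smooth_on C a \<Longrightarrow> smooth_on C b \<Longrightarrow> x \<in> C \<Longrightarrow>
    divg C (\<lambda>y. a y \<times> b y) x = rot C a x \<bullet> b x - a x \<bullet> rot C b x"
  by (simp add: divg_def sum_3 partial_simps inner_vec_def cross_components algebra_simps)

lemma rot_grad: "smooth_on C f \<Longrightarrow> x \<in> C \<Longrightarrow> rot C (grad C f) x = 0"
  by (simp add: vec_eq_iff forall_3 partial_commute[of f x])

lemma divg_rot: "smooth_on C a \<Longrightarrow> x \<in> C \<Longrightarrow> divg C (rot C a) x = 0"
proof -
  assume a: "smooth_on C a" and x: "x \<in> C"
  have "partial C i (partial C j (\<lambda>y. a y $ k)) x = partial C j (partial C i (\<lambda>y. a y $ k)) x" for i j k
    by (rule partial_commute[OF smooth_on_component[OF a] x])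
  then show ?thesis using a x
    by (simp add: divg_def sum_3 partial_simps)
qed

end

lemma triple_rotate: "(a \<times> b) \<bullet> c = a \<bullet> (b \<times> c)" for a b c :: R3
  by (simp add: cross3_simps)

lemma cross_cross_left: "(a \<times> (b \<times> c)) = (a \<bullet> c) *\<^sub>R b - (a \<bullet> b) *\<^sub>R c" for a b c :: R3
  by (simp add: vec_eq_iff forall_3 cross_components inner_vec_def sum_3 algebra_simps)

section \<open>Transformation laws\<close>

lemma transpose_inner: "(transpose M *v a) \<bullet> u = a \<bullet> (M *v u)" for M :: "real^'n^'m"
  by (simp add: dot_lmul_matrix[symmetric])

lemma linear_R3:
  fixes f :: "R3 \<Rightarrow> 'b::real_vector"
  assumes "linear f"
  shows "f u = u $ 1 *\<^sub>R f (axis 1 1) + u $ 2 *\<^sub>R f (axis 2 1) + u $ 3 *\<^sub>R f (axis 3 1)"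
proof -
  have "u = (\<Sum>i\<in>UNIV. u $ i *\<^sub>R axis i 1)"
    by (simp add: basis_expansion scalar_mult_eq_scaleR[symmetric])
  then have "f u = f (\<Sum>i\<in>UNIV. u $ i *\<^sub>R axis i 1)" by simp
  then show ?thesis by (simp add: linear_add[OF assms] linear_cmul[OF assms] sum_3)
qed

lemma bilinear_R3:
  fixes b :: "R3 \<Rightarrow> R3 \<Rightarrow> real"
  assumes "bilinear b"
  shows "b u y = (\<Sum>i\<in>UNIV. \<Sum>j\<in>UNIV. b (axis i 1) (axis j 1) * (u $ i * y $ j))"
proof -
  have l1: "linear (\<lambda>u. b u y)" and l2: "linear (b u)" for u y
    using assms by (auto simp: bilinear_def)
  have "b u y = u $ 1 * b (axis 1 1) y + u $ 2 * b (axis 2 1) y + u $ 3 * b (axis 3 1) y"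
    using linear_R3[OF l1[of y], of u] by simp
  moreover have "b (axis i 1) y = y $ 1 * b (axis i 1) (axis 1 1) + y $ 2 * b (axis i 1) (axis 2 1)
      + y $ 3 * b (axis i 1) (axis 3 1)" for i
    using linear_R3[OF l2[of "axis i 1"], of y] by simp
  ultimately show ?thesis by (simp add: sum_3 algebra_simps)
qed

lemma partial_component:
  assumes "fat C" "smooth_on C a" "x \<in> C"
  shows "partial C i (\<lambda>y. a y $ j) x = D C a x (axis i 1) $ j"
  unfolding partial_def by (simp add: frechet_bounded_linear[OF bounded_linear_vec_nth assms])

text \<open>The right side is the invariant expression for the exterior derivative on constant
  vectors. Both sides are alternating bilinear in \<open>u\<close> and \<open>w\<close>, so
  expanding them in the basis is enough.\<close>

lemma rot_inner_cross:
  assumes "fat C" "smooth_on C a" "x \<in> C"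
  shows "rot C a x \<bullet> (u \<times> w) = D C a x u \<bullet> w - D C a x w \<bullet> u"
proof -
  have l: "linear (D C a x)" using smooth_on_has_derivative[OF assms(2,3)] has_derivative_linear by blast
  show ?thesis
    by (subst linear_R3[OF l, of u], subst linear_R3[OF l, of w])
      (simp add: inner_vec_def sum_3 partial_component[OF assms] cross_components algebra_simps)
qed

lemma eq_if_inner_cross:
  fixes Y Z :: R3
  assumes "\<And>u w. Y \<bullet> (u \<times> w) = Z \<bullet> (u \<times> w)"
  shows "Y = Z"
  using assms[of "axis 2 1" "axis 3 1"] assms[of "axis 3 1" "axis 1 1"] assms[of "axis 1 1" "axis 2 1"]
  by (simp add: cross_basis inner_axis vec_eq_iff forall_3)

context compact_3manifold
begin

context
  fixes c d x assumes c: "c \<in> A" and d: "d \<in> A" and x: "x \<in> overlap c d"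
begin

lemma jac_invertible: "invertible (matrix (jac c d x))"
  using det_jac_pos[OF c d x] by (simp add: invertible_det_nz)

lemma jac_surj: "\<exists>u. jac c d x u = z"
  using jac_invertible jac_matrix[OF c d x]
  by (metis invertible_def matrix_vector_mul_assoc matrix_vector_mul_lid)

text \<open>The triple product is a determinant, hence multiplicative. This is the reason why a
  two-form and a vector density obey the same transformation law.\<close>

lemma jac_cross: "z \<bullet> (u \<times> w) * det (matrix (jac c d x)) = jac c d x z \<bullet> (jac c d x u \<times> jac c d x w)"
proof -
  let ?M = "matrix (jac c d x)"
  have "z \<bullet> (det ?M *\<^sub>R (u \<times> w)) = z \<bullet> (transpose ?M *v ((?M *v u) \<times> (?M *v w)))"
    by (simp only: cross_matrix_mult)
  also have "\<dots> = (?M *v z) \<bullet> ((?M *v u) \<times> (?M *v w))"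
    by (subst inner_commute, subst transpose_inner, rule inner_commute)
  finally show ?thesis by (simp add: jac_matrix[OF c d x] mult.commute)
qed

lemma eq_if_inner_jac_cross:
  assumes "\<And>u w. Y \<bullet> (jac c d x u \<times> jac c d x w) = Z \<bullet> (jac c d x u \<times> jac c d x w)"
  shows "Y = Z"
  by (rule eq_if_inner_cross) (metis assms jac_surj)

end

lemma scalar_fieldD: "scalar_field A f \<Longrightarrow> c \<in> A \<Longrightarrow> d \<in> A \<Longrightarrow> x \<in> overlap c d \<Longrightarrow> f d (trans_map c d x) = f c x"
  by (simp add: scalar_field_def)

lemma density_fieldD: "density_field A r \<Longrightarrow> c \<in> A \<Longrightarrow> d \<in> A \<Longrightarrow> x \<in> overlap c d \<Longrightarrow>
    r c x = det (matrix (jac c d x)) * r d (trans_map c d x)"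
  by (simp add: density_field_def)

lemma vector_fieldD: "vector_field A v \<Longrightarrow> c \<in> A \<Longrightarrow> d \<in> A \<Longrightarrow> x \<in> overlap c d \<Longrightarrow>
    v d (trans_map c d x) = jac c d x (v c x)"
  by (simp add: vector_field_def)

lemma covector_fieldD: "covector_field A a \<Longrightarrow> c \<in> A \<Longrightarrow> d \<in> A \<Longrightarrow> x \<in> overlap c d \<Longrightarrow>
    a c x \<bullet> u = a d (trans_map c d x) \<bullet> jac c d x u"
  by (simp add: covector_field_def)

lemma vector_densityD: "vector_density A w \<Longrightarrow> c \<in> A \<Longrightarrow> d \<in> A \<Longrightarrow> x \<in> overlap c d \<Longrightarrow>
    jac c d x (w c x) = det (matrix (jac c d x)) *\<^sub>R w d (trans_map c d x)"
  by (simp add: vector_density_def)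

text \<open>The hypothesis is the pullback law of the two-form encoded by \<open>W\<close>. By the
  multiplicativity of triple products it becomes the density law tested against cross products of
  Jacobian images, and since the Jacobian is onto these detect every vector.\<close>

lemma vector_densityI:
  assumes "\<And>c d x u w. c \<in> A \<Longrightarrow> d \<in> A \<Longrightarrow> x \<in> overlap c d \<Longrightarrow>
    W c x \<bullet> (u \<times> w) = W d (trans_map c d x) \<bullet> (jac c d x u \<times> jac c d x w)"
  shows "vector_density A W"
  unfolding vector_density_def
proof (intro ballI)
  fix c d x assume *: "c \<in> A" "d \<in> A" "x \<in> overlap c d"
  show "jac c d x (W c x) = det (matrix (jac c d x)) *\<^sub>R W d (trans_map c d x)"
    by (rule eq_if_inner_jac_cross[OF *]) (simp add: jac_cross[OF *, symmetric] assms[OF *])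
qed

lemma vector_density_inner_cross:
  assumes "vector_density A W" "c \<in> A" "d \<in> A" "x \<in> overlap c d"
  shows "W c x \<bullet> (u \<times> w) = W d (trans_map c d x) \<bullet> (jac c d x u \<times> jac c d x w)"
  using jac_cross[OF assms(2-4), of "W c x" u w] vector_densityD[OF assms] det_jac_pos[OF assms(2-4)] by simp

lemma covector_grad:
  assumes "scalar_field A f" "smooth_field A f"
  shows "covector_field A (\<lambda>c. grad (cimg c) (f c))"
  unfolding covector_field_def
proof (intro ballI allI)
  fix c d x u assume *: "c \<in> A" "d \<in> A" "x \<in> overlap c d"
  have s: "smooth_on (cimg c) (f c)" "smooth_on (cimg d) (f d)" using assms(2) * by (auto simp: smooth_field_def)
  have "grad (cimg c) (f c) x \<bullet> u = D (overlap c d) (f c) x u"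
    using grad_inner[OF s(1)] D_overlap[OF * s(1)] * overlap_subset by (metis subsetD)
  also have "\<dots> = D (overlap c d) (\<lambda>y. f d (trans_map c d y)) x u"
    by (rule fun_cong[OF frechet_derivative_within_cong]) (use scalar_fieldD[OF assms(1)] * in auto)
  also have "\<dots> = grad (cimg d) (f d) (trans_map c d x) \<bullet> jac c d x u"
    by (simp add: D_pullback[OF * s(2)] grad_inner[OF s(2) trans_in_cimg[OF *]])
  finally show "grad (cimg c) (f c) x \<bullet> u = grad (cimg d) (f d) (trans_map c d x) \<bullet> jac c d x u" .
qed

lemma vector_density_cross:
  assumes "covector_field A a" "covector_field A b"
  shows "vector_density A (\<lambda>c x. a c x \<times> b c x)"
proof (rule vector_densityI)
  fix c d x u w assume *: "c \<in> A" "d \<in> A" "x \<in> overlap c d"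
  have eq: "(a \<times> b) \<bullet> (u \<times> w) = (a \<bullet> u) * (b \<bullet> w) - (a \<bullet> w) * (b \<bullet> u)" for a b u w :: R3
    by (simp add: cross3_simps)
  show "(a c x \<times> b c x) \<bullet> (u \<times> w) = (a d (trans_map c d x) \<times> b d (trans_map c d x)) \<bullet> (jac c d x u \<times> jac c d x w)"
    by (simp only: eq covector_fieldD[OF assms(1) *] covector_fieldD[OF assms(2) *])
qed

lemma covector_density_cross_vector:
  assumes "vector_density A w" "vector_field A v"
  shows "covector_field A (\<lambda>c x. w c x \<times> v c x)"
  unfolding covector_field_def
proof (intro ballI allI)
  fix c d x u assume *: "c \<in> A" "d \<in> A" "x \<in> overlap c d"
  show "(w c x \<times> v c x) \<bullet> u = (w d (trans_map c d x) \<times> v d (trans_map c d x)) \<bullet> jac c d x u"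
    by (simp only: triple_rotate vector_density_inner_cross[OF assms(1) *] vector_fieldD[OF assms(2) *])
qed

text \<open>Naturality of the exterior derivative: the second derivatives of the transition map cancel
  by symmetry.\<close>

lemma vector_density_rot:
  assumes "covector_field A a" "smooth_field A a"
  shows "vector_density A (\<lambda>c. rot (cimg c) (a c))"
proof (rule vector_densityI)
  fix c d x u w assume *: "c \<in> A" "d \<in> A" "x \<in> overlap c d"
  let ?O = "overlap c d" and ?T = "trans_map c d"
  have s: "smooth_on (cimg c) (a c)" "smooth_on (cimg d) (a d)" using assms(2) * by (auto simp: smooth_field_def)
  note fO = fat_overlap[OF *(1,2)] and sT = smooth_trans[OF *(1,2)]
  have xc: "x \<in> cimg c" using * overlap_subset by blast
  have key: "D (cimg c) (a c) x u \<bullet> w = D (cimg d) (a d) (?T x) (jac c d x u) \<bullet> jac c d x w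
      + a d (?T x) \<bullet> D ?O (\<lambda>y. jac c d y w) x u" for u w
  proof -
    have sJ: "smooth_on ?O (\<lambda>y. jac c d y w)" unfolding jac_def by (rule smooth_on_frechet[OF fO sT])
    have "D (cimg c) (a c) x u \<bullet> w = D ?O (a c) x u \<bullet> w" using D_overlap[OF * s(1)] by simp
    also have "\<dots> = D ?O (\<lambda>y. a c y \<bullet> w) x u"
      by (simp add: frechet_bounded_linear[OF bounded_linear_inner_left fO smooth_on_subset[OF s(1) overlap_subset] *(3)])
    also have "\<dots> = D ?O (\<lambda>y. a d (?T y) \<bullet> jac c d y w) x u"
      by (rule fun_cong[OF frechet_derivative_within_cong]) (use covector_fieldD[OF assms(1)] * in auto)
    also have "\<dots> = a d (?T x) \<bullet> D ?O (\<lambda>y. jac c d y w) x u + D ?O (\<lambda>y. a d (?T y)) x u \<bullet> jac c d x w"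
    proof -
      have "smooth_on ?O (\<lambda>y. a d (?T y))"
        by (rule smooth_on_compose[OF s(2) sT]) (use * trans_in_cimg in auto)
      then have "((\<lambda>y. a d (?T y) \<bullet> jac c d y w) has_derivative
          (\<lambda>u. a d (?T x) \<bullet> D ?O (\<lambda>y. jac c d y w) x u + D ?O (\<lambda>y. a d (?T y)) x u \<bullet> jac c d x w)) (at x within ?O)"
        using *(3) by (intro has_derivative_inner smooth_on_has_derivative sJ)
      from frechet_fat[OF fO *(3) this] show ?thesis by simp
    qed
    finally show ?thesis by (simp add: D_pullback[OF * s(2)])
  qed
  have sym: "D ?O (\<lambda>y. jac c d y w) x u = D ?O (\<lambda>y. jac c d y u) x w"
    unfolding jac_def by (rule frechet_symmetric[OF fO sT *(3)])
  show "rot (cimg c) (a c) x \<bullet> (u \<times> w) = rot (cimg d) (a d) (?T x) \<bullet> (jac c d x u \<times> jac c d x w)"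
    unfolding rot_inner_cross[OF fat_cimg[OF *(1)] s(1) xc] rot_inner_cross[OF fat_cimg[OF *(2)] s(2) trans_in_cimg[OF *]]
    by (simp add: key sym)
qed

lemma scalar_inner: "covector_field A a \<Longrightarrow> vector_field A v \<Longrightarrow> scalar_field A (\<lambda>c x. a c x \<bullet> v c x)"
  unfolding scalar_field_def by (auto simp: covector_fieldD vector_fieldD)

lemma density_inner: "covector_field A a \<Longrightarrow> vector_density A w \<Longrightarrow> density_field A (\<lambda>c x. a c x \<bullet> w c x)"
  unfolding density_field_def by (auto simp: covector_fieldD vector_densityD)

lemma scalar_add: "scalar_field A f \<Longrightarrow> scalar_field A g \<Longrightarrow> scalar_field A (\<lambda>c x. f c x + g c x)"
  and scalar_diff: "scalar_field A f \<Longrightarrow> scalar_field A g \<Longrightarrow> scalar_field A (\<lambda>c x. f c x - g c x)"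
  and scalar_mult: "scalar_field A f \<Longrightarrow> scalar_field A g \<Longrightarrow> scalar_field A (\<lambda>c x. f c x * g c x)"
  and scalar_divide: "scalar_field A f \<Longrightarrow> scalar_field A g \<Longrightarrow> scalar_field A (\<lambda>c x. f c x / g c x)"
  and scalar_fun: "scalar_field A f \<Longrightarrow> scalar_field A (\<lambda>c x. h (f c x))"
  and scalar_const: "scalar_field A (\<lambda>c x. k)"
  by (auto simp: scalar_field_def)

lemma scalar_density_quotient:
  "density_field A r \<Longrightarrow> density_field A f \<Longrightarrow> scalar_field A (\<lambda>c x. r c x / f c x)"
  unfolding scalar_field_def using det_jac_pos by (force simp: density_fieldD)

lemma density_add: "density_field A f \<Longrightarrow> density_field A g \<Longrightarrow> density_field A (\<lambda>c x. f c x + g c x)"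
  by (auto simp: density_field_def algebra_simps)

lemma covector_scaleR: "scalar_field A f \<Longrightarrow> covector_field A a \<Longrightarrow> covector_field A (\<lambda>c x. f c x *\<^sub>R a c x)"
  by (auto simp: covector_field_def scalar_field_def)

lemma vector_density_scaleR:
  "scalar_field A f \<Longrightarrow> vector_density A w \<Longrightarrow> vector_density A (\<lambda>c x. f c x *\<^sub>R w c x)"
  unfolding vector_density_def scalar_field_def using linear_jac by (auto simp: linear_cmul)

lemma vector_density_of_vector:
  "density_field A f \<Longrightarrow> vector_field A v \<Longrightarrow> vector_density A (\<lambda>c x. f c x *\<^sub>R v c x)"
  unfolding vector_density_def density_field_def vector_field_def using linear_jac by (auto simp: linear_cmul)

end

section \<open>Pointwise identities at a fixed time\<close>

text \<open>Here \<open>\<theta>\<close> is the one-form \<open>v\<^sup>\<flat>\<close> and \<open>s = g(v, v)\<close>. Both \<open>\<alpha>\<close> and \<open>\<beta>\<close> are normalised to vanish on \<open>v\<close>;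
  they satisfy \<open>d\<theta> = \<theta> \<and> \<alpha>\<close> and \<open>d\<alpha> = \<theta> \<and> \<beta>\<close>, and \<open>\<kappa>\<close> is \<open>\<alpha> \<and> d\<alpha>\<close>.\<close>

locale chart_forms =
  fixes C :: "R3 set" and s \<kappa> :: "R3 \<Rightarrow> real" and \<theta> v w \<alpha> \<beta> :: "R3 \<Rightarrow> R3"
  assumes fat: "fat C"
    and smooth_s: "smooth_on C s" and smooth_\<theta>: "smooth_on C \<theta>" and smooth_v: "smooth_on C v"
    and s_pos: "\<And>x. x \<in> C \<Longrightarrow> s x > 0"
    and \<theta>v: "\<And>x. x \<in> C \<Longrightarrow> \<theta> x \<bullet> v x = s x"
    and w_eq: "\<And>x. x \<in> C \<Longrightarrow> w x = rot C \<theta> x"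
    and \<theta>w: "\<And>x. x \<in> C \<Longrightarrow> \<theta> x \<bullet> w x = 0"
    and \<alpha>_eq: "\<And>x. x \<in> C \<Longrightarrow> \<alpha> x = (1 / s x) *\<^sub>R (w x \<times> v x)"
    and \<beta>_eq: "\<And>x. x \<in> C \<Longrightarrow> \<beta> x = (1 / s x) *\<^sub>R (rot C \<alpha> x \<times> v x)"
    and \<kappa>_eq: "\<And>x. x \<in> C \<Longrightarrow> \<kappa> x = \<alpha> x \<bullet> rot C \<alpha> x"
begin

lemma smooth_w: "smooth_on C w"
  by (rule smooth_on_cong[THEN iffD1, OF _ smooth_rot[OF fat smooth_\<theta>]]) (simp add: w_eq)

lemma smooth_over_s: "smooth_on C f \<Longrightarrow> smooth_on C (\<lambda>x. f x / s x)"
  using s_pos by (intro smooth_on_divide smooth_s) force+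

lemma smooth_\<alpha>: "smooth_on C \<alpha>"
  by (rule smooth_on_cong[THEN iffD1, OF _ smooth_on_scaleR[OF smooth_over_s[OF smooth_on_const[where c=1]] smooth_cross[OF fat smooth_w smooth_v]]])
    (simp add: \<alpha>_eq)

lemma smooth_\<beta>: "smooth_on C \<beta>"
  by (rule smooth_on_cong[THEN iffD1, OF _ smooth_on_scaleR[OF smooth_over_s[OF smooth_on_const[where c=1]] smooth_cross[OF fat smooth_rot[OF fat smooth_\<alpha>] smooth_v]]])
    (simp add: \<beta>_eq)

lemma smooth_\<kappa>: "smooth_on C \<kappa>"
  by (rule smooth_on_cong[THEN iffD1, OF _ smooth_inner[OF fat smooth_\<alpha> smooth_rot[OF fat smooth_\<alpha>]]])
    (simp add: \<kappa>_eq)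

text \<open>A two-form whose wedge product with \<theta> vanishes is divisible by \<theta>, and
  contracting it with \<open>v\<close> yields a quotient that vanishes on \<open>v\<close>. Both
  \<alpha> and \<beta> arise from d\<theta> and d\<alpha> in this way.\<close>

lemma \<theta>_cross:
  assumes "x \<in> C" "\<theta> x \<bullet> y = 0"
  shows "\<theta> x \<times> ((1 / s x) *\<^sub>R (y \<times> v x)) = y"
  using s_pos[OF assms(1)] assms(2) by (simp add: cross_mult_right cross_cross_left \<theta>v[OF assms(1)])

lemma \<theta>\<alpha>: "x \<in> C \<Longrightarrow> \<theta> x \<times> \<alpha> x = w x"
  using \<theta>_cross[OF _ \<theta>w] by (simp add: \<alpha>_eq)

lemma w\<alpha>: "x \<in> C \<Longrightarrow> w x \<bullet> \<alpha> x = 0"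
  by (simp add: \<alpha>_eq dot_cross_self)

lemma \<alpha>_zero: "x \<in> C \<Longrightarrow> \<alpha> x = 0 \<longleftrightarrow> w x = 0"
  using \<theta>\<alpha>[of x] \<alpha>_eq[of x] by auto

lemma divg_w: "x \<in> C \<Longrightarrow> divg C w x = 0"
  using divg_rot[OF fat smooth_\<theta>] divg_cong[of C w "rot C \<theta>" x] w_eq by auto

text \<open>Differentiating d\<theta> = \<theta> \<and> \<alpha> gives 0 = d\<theta> \<and> \<alpha>
  - \<theta> \<and> d\<alpha>, and the first term vanishes since \<alpha> occurs twice in
  it.\<close>

lemma \<theta>_rot_\<alpha>:
  assumes x: "x \<in> C"
  shows "\<theta> x \<bullet> rot C \<alpha> x = 0"
proof -
  have "0 = divg C (\<lambda>y. \<theta> y \<times> \<alpha> y) x"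
    using divg_w[OF x] divg_cong[of C w "\<lambda>y. \<theta> y \<times> \<alpha> y" x] \<theta>\<alpha> x by auto
  then show ?thesis using divg_cross[OF fat smooth_\<theta> smooth_\<alpha> x] w\<alpha>[OF x] w_eq[OF x] by simp
qed

lemma \<theta>\<beta>: "x \<in> C \<Longrightarrow> \<theta> x \<times> \<beta> x = rot C \<alpha> x"
  using \<theta>_cross[OF _ \<theta>_rot_\<alpha>] by (simp add: \<beta>_eq)

text \<open>The sign comes from exchanging two factors: \<alpha> \<and> d\<alpha> = \<alpha> \<and>
  \<theta> \<and> \<beta> = -\<theta> \<and> \<alpha> \<and> \<beta>.\<close>

lemma w\<beta>:
  assumes x: "x \<in> C"
  shows "w x \<bullet> \<beta> x = - \<kappa> x"
proof -
  have "w x \<bullet> \<beta> x = - (\<alpha> x \<bullet> (\<theta> x \<times> \<beta> x))"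
    by (simp add: \<theta>\<alpha>[OF x, symmetric] cross3_simps)
  then show ?thesis by (simp add: \<theta>\<beta>[OF x] \<kappa>_eq[OF x])
qed

end

text \<open>Where \<open>w \<noteq> 0\<close> one has \<open>dP = a \<theta> + b \<alpha>\<close> with a coefficient \<open>b\<close> that need not extend to the
  zeros of \<open>w\<close>. The smooth functions \<open>M\<close> and \<open>N\<close> are chosen such that \<open>b = M / N\<close>; \<open>h\<close> is any
  positive definite form, used only to produce them.\<close>

locale chart_flow = chart_forms C s \<kappa> \<theta> v w \<alpha> \<beta> for C s \<kappa> \<theta> v w \<alpha> \<beta> +
  fixes P a m M N :: "R3 \<Rightarrow> real" and h :: "R3 \<Rightarrow> R3 \<Rightarrow> R3 \<Rightarrow> real"
  assumes smooth_P: "smooth_on C P"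
    and smooth_h: "\<And>u y. smooth_on C (\<lambda>x. h x u y)"
    and Pw: "\<And>x. x \<in> C \<Longrightarrow> grad C P x \<bullet> w x = 0"
    and a_eq: "\<And>x. x \<in> C \<Longrightarrow> a x = grad C P x \<bullet> v x / s x"
    and m_eq: "\<And>x. x \<in> C \<Longrightarrow> m x = grad C a x \<bullet> v x / s x"
    and bil: "\<And>x. x \<in> C \<Longrightarrow> bilinear (h x)"
    and h_pos: "\<And>x u. x \<in> C \<Longrightarrow> u \<noteq> 0 \<Longrightarrow> h x u u > 0"
    and N_eq: "\<And>x. x \<in> C \<Longrightarrow> N x = h x (w x) (w x)"
    and M_eq: "\<And>x. x \<in> C \<Longrightarrow> M x = h x (\<theta> x \<times> grad C P x) (w x)"
begin

lemma smooth_a: "smooth_on C a"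
  by (rule smooth_on_cong[THEN iffD1, OF _ smooth_over_s[OF smooth_inner[OF fat smooth_grad[OF fat smooth_P] smooth_v]]])
    (simp add: a_eq)

lemma smooth_m: "smooth_on C m"
  by (rule smooth_on_cong[THEN iffD1, OF _ smooth_over_s[OF smooth_inner[OF fat smooth_grad[OF fat smooth_a] smooth_v]]])
    (simp add: m_eq)

lemmas h_expand = bilinear_R3[OF bil]

lemma smooth_h_fields: "smooth_on C u \<Longrightarrow> smooth_on C y \<Longrightarrow> smooth_on C (\<lambda>x. h x (u x) (y x))"
  by (rule smooth_on_cong[THEN iffD1, OF h_expand[symmetric]]) (auto intro!: smooth_intros smooth_h)

lemma smooth_N: "smooth_on C N"
  by (rule smooth_on_cong[THEN iffD1, OF _ smooth_h_fields[OF smooth_w smooth_w]]) (simp add: N_eq)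

lemma smooth_M: "smooth_on C M"
  by (rule smooth_on_cong[THEN iffD1, OF _ smooth_h_fields[OF smooth_cross[OF fat smooth_\<theta> smooth_grad[OF fat smooth_P]] smooth_w]])
    (simp add: M_eq)

lemmas smooths = smooth_s smooth_P smooth_\<theta> smooth_v smooth_w smooth_\<alpha> smooth_\<beta> smooth_a smooth_m smooth_\<kappa> smooth_N smooth_M
  smooth_grad[OF fat] smooth_rot[OF fat] smooth_cross[OF fat] smooth_inner[OF fat]

text \<open>The part b \<alpha> of dP. In this form it is smooth everywhere, also at the zeros of
  \<open>w\<close>, where \<open>b\<close> itself is not defined.\<close>

definition c where "c x = grad C P x - a x *\<^sub>R \<theta> x"

lemma smooth_c: "smooth_on C c"
  unfolding c_def by (intro smooth_intros smooths)

text \<open>The covector vanishes on \<open>v\<close> by the choice of \<open>a\<close>, and on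
  \<open>w\<close> since both dP and \<theta> do. As \<alpha> is a multiple of w \<times> v, the
  expansion of the double cross product leaves nothing.\<close>

lemma c\<alpha>:
  assumes x: "x \<in> C"
  shows "c x \<times> \<alpha> x = 0"
proof -
  have "c x \<bullet> v x = 0" using s_pos[OF x] by (simp add: c_def inner_diff_left \<theta>v[OF x] a_eq[OF x])
  moreover have "c x \<bullet> w x = 0" by (simp add: c_def inner_diff_left \<theta>w[OF x] Pw[OF x])
  ultimately show ?thesis by (simp add: \<alpha>_eq[OF x] cross_mult_right cross_cross_left)
qed

lemma \<theta>c: "x \<in> C \<Longrightarrow> \<theta> x \<times> c x = \<theta> x \<times> grad C P x"
  by (simp add: c_def Cross3.right_diff_distrib cross_mult_right)

lemma N_zero: "x \<in> C \<Longrightarrow> N x = 0 \<longleftrightarrow> w x = 0"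
  using h_pos[of x "w x"] bil[of x] by (cases "w x = 0") (auto simp: N_eq bilinear_lzero)

lemma N_nonneg: "x \<in> C \<Longrightarrow> N x \<ge> 0"
  using N_zero[of x] h_pos[of x "w x"] by (cases "w x = 0") (auto simp: N_eq)

text \<open>The relation c = (M/N) \<alpha> without denominators. Where \<alpha> \<noteq> 0
  parallelism provides the factor, and pairing with \<open>w\<close> under \<open>h\<close>
  identifies it; where \<alpha> = 0 also N = 0.\<close>

lemma N_c:
  assumes x: "x \<in> C"
  shows "N x *\<^sub>R c x = M x *\<^sub>R \<alpha> x"
proof (cases "\<alpha> x = 0")
  case True
  then show ?thesis using N_zero[OF x] \<alpha>_zero[OF x] by simp
next
  case False
  have "collinear {0, \<alpha> x, c x}" using c\<alpha>[OF x] cross_eq_0 cross_skew by (metis neg_0_equal_iff_equal)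
  then obtain b where b: "c x = b *\<^sub>R \<alpha> x" using False by (auto simp: collinear_lemma)
  have "M x = b * N x"
    using bil[OF x] by (simp add: M_eq[OF x] N_eq[OF x] \<theta>c[OF x, symmetric] b cross_mult_right \<theta>\<alpha>[OF x] bilinear_lmul)
  then show ?thesis by (simp add: b)
qed

lemma N_\<theta>P:
  assumes x: "x \<in> C"
  shows "N x *\<^sub>R (\<theta> x \<times> grad C P x) = M x *\<^sub>R w x"
  by (metis N_c[OF x] \<theta>c[OF x] \<theta>\<alpha>[OF x] cross_mult_right)

text \<open>Of dP = a \<theta> + c only a \<theta> contributes, because \<open>c\<close> is parallel
  to \<alpha>; the rest is a \<theta> \<and> \<alpha> \<and> \<beta>.\<close>

lemma triple_P:
  assumes x: "x \<in> C"
  shows "grad C P x \<bullet> (\<alpha> x \<times> \<beta> x) = - (a x * \<kappa> x)"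
proof -
  have P: "grad C P x = a x *\<^sub>R \<theta> x + c x" by (simp add: c_def)
  have "c x \<bullet> (\<alpha> x \<times> \<beta> x) = 0"
    using c\<alpha>[OF x] by (simp add: triple_rotate[symmetric])
  moreover have "\<theta> x \<bullet> (\<alpha> x \<times> \<beta> x) = w x \<bullet> \<beta> x"
    by (simp add: triple_rotate[symmetric] \<theta>\<alpha>[OF x])
  ultimately show ?thesis by (simp add: P inner_add_left w\<beta>[OF x])
qed

lemma rot_c:
  assumes x: "x \<in> C"
  shows "rot C c x = - (grad C a x \<times> \<theta> x) - a x *\<^sub>R w x"
  unfolding c_def
  by (simp add: rot_diff[OF fat] rot_scaleR[OF fat] rot_grad[OF fat] smooths smooth_on_scaleR x w_eq[OF x])

text \<open>The exterior derivative of c \<and> \<alpha> = 0 gives dc \<and> \<alpha> = c \<and>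
  d\<alpha>. Here dc = -da \<and> \<theta> - a d\<theta>, and its second term dies against \<alpha>.
  This is \<xi>(a) = -b \<kappa>, multiplied by \<open>N\<close>.\<close>

lemma grad_a_w:
  assumes x: "x \<in> C"
  shows "N x * (grad C a x \<bullet> w x) = - (M x * \<kappa> x)"
proof -
  have "0 = divg C (\<lambda>y. c y \<times> \<alpha> y) x"
    using divg_cong[of C "\<lambda>y. c y \<times> \<alpha> y" "\<lambda>_. 0" x] c\<alpha> x by (auto simp: divg_def partial_const[OF fat])
  then have "rot C c x \<bullet> \<alpha> x = c x \<bullet> rot C \<alpha> x"
    by (simp add: divg_cross[OF fat smooth_c smooth_\<alpha> x])
  moreover have "(grad C a x \<times> \<theta> x) \<bullet> \<alpha> x = grad C a x \<bullet> w x"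
    by (simp add: triple_rotate \<theta>\<alpha>[OF x])
  ultimately have "grad C a x \<bullet> w x = - (c x \<bullet> rot C \<alpha> x)"
    by (simp add: rot_c[OF x] inner_diff_left w\<alpha>[OF x])
  moreover have "N x * (c x \<bullet> rot C \<alpha> x) = M x * \<kappa> x"
    using N_c[OF x] by (metis \<kappa>_eq[OF x] inner_scaleR_left)
  ultimately show ?thesis by simp
qed

text \<open>Both \<theta> \<and> dP and d\<theta> are closed, the former because dP vanishes on
  \<open>w\<close>. Hence the divergence of N (\<theta> \<times> dP) = M w involves dN and dM only;
  multiplying by \<open>N\<close> and using the same equation once more gives \<xi>(M/N) = 0 without
  denominators.\<close>

lemma w_grad_M:
  assumes x: "x \<in> C"
  shows "N x * (grad C M x \<bullet> w x) = M x * (grad C N x \<bullet> w x)"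
proof -
  have "divg C (\<lambda>y. N y *\<^sub>R (\<theta> y \<times> grad C P y)) x = divg C (\<lambda>y. M y *\<^sub>R w y) x"
    by (rule divg_cong[OF N_\<theta>P x])
  then have "grad C N x \<bullet> (\<theta> x \<times> grad C P x) = grad C M x \<bullet> w x"
    by (simp add: divg_scaleR[OF fat] divg_cross[OF fat] rot_grad[OF fat] smooths x divg_w Pw[OF x]
        w_eq[OF x, symmetric] inner_commute[of "w x"])
  then have "N x * (grad C M x \<bullet> w x) = grad C N x \<bullet> (N x *\<^sub>R (\<theta> x \<times> grad C P x))" by simp
  then show ?thesis by (simp add: N_\<theta>P[OF x])
qed

text \<open>Where N \<noteq> 0 this is N^2 db with b = M/N; correspondingly \<open>e\<close> is N^2
  v(b)/s.\<close>

definition k where "k x = N x *\<^sub>R grad C M x - M x *\<^sub>R grad C N x"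
definition e where "e x = k x \<bullet> v x / s x"

lemma smooth_k: "smooth_on C k" unfolding k_def by (intro smooth_intros smooths)
lemma smooth_e: "smooth_on C e" unfolding e_def by (intro smooth_over_s smooths smooth_k)

lemma k\<alpha>:
  assumes x: "x \<in> C"
  shows "k x \<times> \<alpha> x = e x *\<^sub>R w x"
proof -
  have "k x \<bullet> w x = 0" using w_grad_M[OF x] by (simp add: k_def inner_diff_left)
  then show ?thesis by (simp add: \<alpha>_eq[OF x] cross_mult_right cross_cross_left e_def)
qed

text \<open>Where N \<noteq> 0 this says da = (v(b)/s + a) \<alpha> + b \<beta> + m \<theta>. It is
  obtained by equating the exterior derivatives of N c and M \<alpha>, which determines \<theta>
  \<and> da; the coefficient of \<theta> is then read off by evaluating on \<open>v\<close>.\<close>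

lemma grad_a:
  assumes x: "x \<in> C"
  shows "(N x)\<^sup>2 *\<^sub>R grad C a x = (e x + (N x)\<^sup>2 * a x) *\<^sub>R \<alpha> x + (N x * M x) *\<^sub>R \<beta> x + ((N x)\<^sup>2 * m x) *\<^sub>R \<theta> x"
proof -
  have "rot C (\<lambda>y. N y *\<^sub>R c y) x = rot C (\<lambda>y. M y *\<^sub>R \<alpha> y) x"
    by (rule rot_cong[OF N_c x])
  then have "grad C N x \<times> c x + N x *\<^sub>R rot C c x = grad C M x \<times> \<alpha> x + M x *\<^sub>R rot C \<alpha> x"
    by (simp add: rot_scaleR[OF fat] smooths smooth_c x)
  then have e0: "N x *\<^sub>R (grad C N x \<times> c x + N x *\<^sub>R rot C c x) = N x *\<^sub>R (grad C M x \<times> \<alpha> x + M x *\<^sub>R rot C \<alpha> x)"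
    by simp
  have e1: "N x *\<^sub>R (grad C N x \<times> c x) = M x *\<^sub>R (grad C N x \<times> \<alpha> x)"
    by (metis N_c[OF x] cross_mult_right)
  have e2: "k x \<times> \<alpha> x = N x *\<^sub>R (grad C M x \<times> \<alpha> x) - M x *\<^sub>R (grad C N x \<times> \<alpha> x)"
    by (simp add: k_def Cross3.left_diff_distrib cross_mult_left)
  have "Y = K + Q" if "Z + Y = P + Q" "K = P - Z" for Z Y P Q K :: R3
    using that by (metis add.commute add_diff_cancel_left' add_diff_eq)
  from this[OF _ e2] have 1: "(N x)\<^sup>2 *\<^sub>R rot C c x = k x \<times> \<alpha> x + (N x * M x) *\<^sub>R rot C \<alpha> x"
    using e0 by (simp add: scaleR_add_right power2_eq_square e1)
  define Y where "Y = (N x)\<^sup>2 *\<^sub>R grad C a x - (e x + (N x)\<^sup>2 * a x) *\<^sub>R \<alpha> x - (N x * M x) *\<^sub>R \<beta> x"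
  have "\<theta> x \<times> Y = - ((N x)\<^sup>2 *\<^sub>R (grad C a x \<times> \<theta> x)) - (e x + (N x)\<^sup>2 * a x) *\<^sub>R w x - (N x * M x) *\<^sub>R rot C \<alpha> x"
    using cross_skew[of "\<theta> x" "grad C a x"]
    by (simp add: Y_def Cross3.right_diff_distrib cross_mult_right \<theta>\<alpha>[OF x] \<theta>\<beta>[OF x])
  also have "\<dots> = 0"
    using 1 by (simp add: rot_c[OF x] k\<alpha>[OF x] algebra_simps)
  \<comment> \<open>A covector whose wedge with \<theta> vanishes is a multiple of \<theta>, and
    evaluation on \<open>v\<close> gives the factor; \<alpha> and \<beta> contribute nothing to it,
    as they vanish on \<open>v\<close>.\<close>
  finally have "v x \<times> (\<theta> x \<times> Y) = 0" by simp
  then have "(v x \<bullet> Y) *\<^sub>R \<theta> x = s x *\<^sub>R Y"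
    by (simp add: cross_cross_left inner_commute[of "v x" "\<theta> x"] \<theta>v[OF x])
  moreover have "v x \<bullet> Y = (N x)\<^sup>2 * (s x * m x)"
    using s_pos[OF x]
    by (simp add: Y_def inner_diff_right m_eq[OF x] \<alpha>_eq[OF x] \<beta>_eq[OF x] dot_cross_self inner_commute)
  ultimately have "s x *\<^sub>R Y = s x *\<^sub>R (((N x)\<^sup>2 * m x) *\<^sub>R \<theta> x)" by (metis mult.left_commute scaleR_scaleR)
  then have "Y = ((N x)\<^sup>2 * m x) *\<^sub>R \<theta> x"
    using s_pos[OF x] unfolding real_vector.scale_cancel_left by auto
  then show ?thesis by (simp add: Y_def algebra_simps)
qed

text \<open>The identity obtained from \<open>d(da) = 0\<close> at the zeros of \<open>M\<close>.\<close>

lemma second_order_identity: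
  assumes x: "x \<in> C" and M0: "M x = 0"
  shows "N x * (a x * \<kappa> x + grad C m x \<bullet> w x) = - 2 * \<kappa> x * (grad C M x \<bullet> v x) / s x"
proof (cases "N x = 0")
  case True
  then have "w x = 0" "\<alpha> x = 0" using N_zero[OF x] \<alpha>_zero[OF x] by auto
  then show ?thesis using True by (simp add: \<kappa>_eq[OF x])
next
  case False
  let ?A = "\<lambda>x. e x + (N x)\<^sup>2 * a x" and ?B = "\<lambda>x. N x * M x" and ?Z = "\<lambda>x. (N x)\<^sup>2 * m x" and ?N2 = "\<lambda>x. (N x)\<^sup>2"
  have sA: "smooth_on C ?A" and sB: "smooth_on C ?B" and sZ: "smooth_on C ?Z" and sN: "smooth_on C ?N2"
    by (intro smooth_intros smooths smooth_e)+
  \<comment> \<open>The expansion of N^2 da is differentiated and then wedged with \<alpha>. The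
    form d\<beta>, about which nothing is known, enters with the coefficient N M and so drops out
    exactly at the zeros of \<open>M\<close>.\<close>
  have "rot C (\<lambda>y. ?N2 y *\<^sub>R grad C a y) x = rot C (\<lambda>y. (?A y *\<^sub>R \<alpha> y + ?B y *\<^sub>R \<beta> y) + ?Z y *\<^sub>R \<theta> y) x"
    by (rule rot_cong[OF grad_a x])
  also have "\<dots> = grad C ?A x \<times> \<alpha> x + ?A x *\<^sub>R rot C \<alpha> x + (grad C ?B x \<times> \<beta> x + ?B x *\<^sub>R rot C \<beta> x)
      + (grad C ?Z x \<times> \<theta> x + ?Z x *\<^sub>R rot C \<theta> x)"
    using sA sB sZ by (simp add: rot_add[OF fat] rot_scaleR[OF fat] smooths smooth_on_scaleR smooth_on_add x)
  finally have "grad C ?N2 x \<times> grad C a x = grad C ?A x \<times> \<alpha> x + ?A x *\<^sub>R rot C \<alpha> x + grad C ?B x \<times> \<beta> x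
      + (grad C ?Z x \<times> \<theta> x + ?Z x *\<^sub>R rot C \<theta> x)"
    using sN by (simp add: rot_scaleR[OF fat] rot_grad[OF fat] smooths x M0)
  then have "(grad C ?N2 x \<times> grad C a x) \<bullet> \<alpha> x = (grad C ?A x \<times> \<alpha> x + ?A x *\<^sub>R rot C \<alpha> x + grad C ?B x \<times> \<beta> x
      + (grad C ?Z x \<times> \<theta> x + ?Z x *\<^sub>R rot C \<theta> x)) \<bullet> \<alpha> x" by simp
  also have "\<dots> = ?A x * \<kappa> x + (grad C ?B x \<times> \<beta> x) \<bullet> \<alpha> x + grad C ?Z x \<bullet> w x"
    by (simp add: inner_add_left dot_cross_self \<kappa>_eq[OF x] inner_commute[of "rot C \<alpha> x"] triple_rotate[of _ "\<theta> x"] \<theta>\<alpha>[OF x]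
        w_eq[OF x, symmetric] w\<alpha>[OF x])
  finally have 1: "grad C ?N2 x \<bullet> (grad C a x \<times> \<alpha> x) = ?A x * \<kappa> x + (grad C ?B x \<times> \<beta> x) \<bullet> \<alpha> x + grad C ?Z x \<bullet> w x"
    by (simp add: triple_rotate)
  have B: "grad C ?B x = k x"
    using grad_mult[OF fat smooth_N smooth_M x] by (simp add: k_def M0)
  have "(k x \<times> \<beta> x) \<bullet> \<alpha> x = - ((k x \<times> \<alpha> x) \<bullet> \<beta> x)" by (simp add: cross3_simps)
  then have 2: "(grad C ?B x \<times> \<beta> x) \<bullet> \<alpha> x = e x * \<kappa> x" by (simp add: B k\<alpha>[OF x] w\<beta>[OF x])
  have 3: "grad C ?Z x \<bullet> w x = m x * (grad C ?N2 x \<bullet> w x) + (N x)\<^sup>2 * (grad C m x \<bullet> w x)"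
    using grad_mult[OF fat sN smooth_m x] by (simp add: inner_add_left)
  have "(N x)\<^sup>2 *\<^sub>R (grad C a x \<times> \<alpha> x) = ((N x)\<^sup>2 *\<^sub>R grad C a x) \<times> \<alpha> x" by (simp add: cross_mult_left)
  also have "\<dots> = (N x)\<^sup>2 *\<^sub>R (m x *\<^sub>R w x)"
    by (simp add: grad_a[OF x] M0 cross_add_left cross_mult_left \<theta>\<alpha>[OF x])
  finally have "grad C a x \<times> \<alpha> x = m x *\<^sub>R w x"
    using False unfolding real_vector.scale_cancel_left by auto
  then have 4: "grad C ?N2 x \<bullet> (grad C a x \<times> \<alpha> x) = m x * (grad C ?N2 x \<bullet> w x)" by simp
  have e: "e x = N x * (grad C M x \<bullet> v x) / s x" by (simp add: e_def k_def M0)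
  \<comment> \<open>The terms m \<xi>(N^2) from both sides cancel. The value \<open>e\<close>
    appears twice, in the coefficient of \<alpha> and through d(N M); this is the origin of the
    factor 2 in the result.\<close>
  have "0 = ?A x * \<kappa> x + e x * \<kappa> x + (N x)\<^sup>2 * (grad C m x \<bullet> w x)"
    using 1 2 3 4 by simp
  then have "N x * (N x * (a x * \<kappa> x + grad C m x \<bullet> w x)) = N x * (- 2 * \<kappa> x * (grad C M x \<bullet> v x) / s x)"
    by (simp add: e algebra_simps power2_eq_square add_divide_distrib)
  then show ?thesis using False unfolding mult_cancel_left by blast
qed

text \<open>\<open>N\<close> is quadratic in \<open>w\<close>, so its derivative along
  \<open>w\<close> is of order |w|^2, while N itself is at least a constant times |w|^2 on a compact
  set. Thus \<open>N\<close> has a bounded logarithmic derivative along \<open>w\<close> even near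
  its zeros, which later dominates the cut-offs.\<close>

lemma w_grad_N_bound:
  assumes K: "compact K" "K \<subseteq> C"
  shows "\<exists>B. \<forall>x\<in>K. \<bar>grad C N x \<bullet> w x\<bar> \<le> B * N x"
proof -
  let ?H = "\<lambda>i j x. h x (axis i 1) (axis j 1)"
  define R where "R x = (\<Sum>i\<in>UNIV. \<Sum>j\<in>UNIV. \<bar>grad C (?H i j) x \<bullet> w x\<bar> + \<bar>?H i j x\<bar> * (\<Sum>l\<in>UNIV. \<bar>partial C l (\<lambda>y. w y $ i) x\<bar> + \<bar>partial C l (\<lambda>y. w y $ j) x\<bar>))" for x
  have bound: "\<bar>grad C N x \<bullet> w x\<bar> \<le> R x * (norm (w x))\<^sup>2" if x: "x \<in> C" for x
  proof -
    have sH: "smooth_on C (?H i j)" for i j by (rule smooth_h)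
    have sw: "smooth_on C (\<lambda>y. w y $ i)" for i by (intro smooth_on_component smooths)
    have lw: "\<bar>grad C (\<lambda>y. w y $ i) x \<bullet> w x\<bar> \<le> norm (w x) * (\<Sum>l\<in>UNIV. \<bar>partial C l (\<lambda>y. w y $ i) x\<bar>)" for i
    proof -
      have "\<bar>grad C (\<lambda>y. w y $ i) x \<bullet> w x\<bar> \<le> (\<Sum>l\<in>UNIV. \<bar>partial C l (\<lambda>y. w y $ i) x * w x $ l\<bar>)"
        unfolding inner_vec_def by (simp add: sum_abs)
      also have "\<dots> \<le> (\<Sum>l\<in>UNIV. norm (w x) * \<bar>partial C l (\<lambda>y. w y $ i) x\<bar>)"
        using component_le_norm_cart[of "w x"] by (intro sum_mono) (simp add: abs_mult mult.commute mult_right_mono)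
      finally show ?thesis by (simp add: sum_distrib_left)
    qed
    have wb: "\<bar>w x $ i\<bar> \<le> norm (w x)" for i by (rule component_le_norm_cart)
    have "grad C N x = grad C (\<lambda>x. \<Sum>i\<in>UNIV. \<Sum>j\<in>UNIV. ?H i j x * (w x $ i * w x $ j)) x"
      by (rule grad_cong[OF _ x]) (simp add: N_eq h_expand)
    also have "\<dots> = (\<Sum>i\<in>UNIV. \<Sum>j\<in>UNIV. grad C (\<lambda>x. ?H i j x * (w x $ i * w x $ j)) x)"
      unfolding vec_eq_iff sum_component grad_nth
      by (intro allI, subst partial_sum[OF fat _ x], (intro smooth_intros sH smooth_w)+,
          intro sum.cong refl, subst partial_sum[OF fat _ x]) (intro smooth_intros sH smooth_w | simp)+
    finally have "grad C N x \<bullet> w x = (\<Sum>i\<in>UNIV. \<Sum>j\<in>UNIV. grad C (\<lambda>x. ?H i j x * (w x $ i * w x $ j)) x \<bullet> w x)"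
      by (simp add: inner_sum_left)
    then have "\<bar>grad C N x \<bullet> w x\<bar> \<le> (\<Sum>i\<in>UNIV. \<Sum>j\<in>UNIV. \<bar>grad C (\<lambda>x. ?H i j x * (w x $ i * w x $ j)) x \<bullet> w x\<bar>)"
      using order_trans[OF sum_abs sum_mono[OF sum_abs]] by simp
    also have "\<dots> \<le> R x * (norm (w x))\<^sup>2"
      unfolding R_def sum_distrib_right
    proof (intro sum_mono)
      fix i j :: 3
      have regroup: "G * (n * n) + H * (n * (n * S) + n * (n * T)) = (G + H * (S + T)) * n\<^sup>2" for G H n S T :: real
        by (simp add: algebra_simps power2_eq_square)
      let ?n = "norm (w x)"
      let ?S = "\<lambda>i. \<Sum>l\<in>UNIV. \<bar>partial C l (\<lambda>y. w y $ i) x\<bar>"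
      have eq: "grad C (\<lambda>x. ?H i j x * (w x $ i * w x $ j)) x \<bullet> w x
        = (grad C (?H i j) x \<bullet> w x) * (w x $ i * w x $ j)
         + ?H i j x * (w x $ j * (grad C (\<lambda>y. w y $ i) x \<bullet> w x) + w x $ i * (grad C (\<lambda>y. w y $ j) x \<bullet> w x))"
        by (subst grad_mult[OF fat sH smooth_on_mult[OF sw sw] x], subst grad_mult[OF fat sw sw x])
          (simp add: inner_add_left distrib_left distrib_right mult_ac)
      have est: "\<bar>p * (u * y) + q * (y * r + u * t)\<bar> \<le> \<bar>p\<bar> * (n * n) + \<bar>q\<bar> * (n * (n * S) + n * (n * T))"
        if "\<bar>u\<bar> \<le> n" "\<bar>y\<bar> \<le> n" "\<bar>r\<bar> \<le> n * S" "\<bar>t\<bar> \<le> n * T" "0 \<le> n" "0 \<le> S" "0 \<le> T"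
        for p q u y r t n S T :: real
      proof -
        have "\<bar>y * r + u * t\<bar> \<le> n * (n * S) + n * (n * T)"
          using that by (intro order_trans[OF abs_triangle_ineq] add_mono) (auto simp: abs_mult intro!: mult_mono)
        then show ?thesis
          using that by (intro order_trans[OF abs_triangle_ineq] add_mono) (auto simp: abs_mult intro!: mult_mono)
      qed
      show "\<bar>grad C (\<lambda>x. ?H i j x * (w x $ i * w x $ j)) x \<bullet> w x\<bar> \<le>
         (\<bar>grad C (?H i j) x \<bullet> w x\<bar> + \<bar>?H i j x\<bar> * (\<Sum>l\<in>UNIV. \<bar>partial C l (\<lambda>y. w y $ i) x\<bar> + \<bar>partial C l (\<lambda>y. w y $ j) x\<bar>)) * ?n\<^sup>2"
        unfolding eq sum.distrib regroup[symmetric] by (intro est wb lw sum_nonneg) auto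
    qed
    finally show ?thesis .
  qed
  have "continuous_on K R"
    unfolding R_def
    by (intro continuous_intros continuous_on_subset[OF smooth_on_imp_continuous_on K(2)] smooths smooth_h
        smooth_partial[OF fat] smooth_on_component)
  then have "compact (R ` K)" using K(1) by (rule compact_continuous_image)
  then obtain B1 where B1: "\<And>x. x \<in> K \<Longrightarrow> norm (R x) \<le> B1"
    using compact_imp_bounded[of "R ` K"] unfolding bounded_iff by blast
  \<comment> \<open>The minimum of the positive definite form over \<open>K\<close> and the unit
    sphere: a lower bound uniform in the base point.\<close>
  have "\<exists>l>0. \<forall>x\<in>K. \<forall>u\<in>sphere 0 1. l \<le> h x u u"
  proof (cases "K = {}")
    case False
    have "continuous_on (Sigma K (\<lambda>_. sphere (0::R3) 1)) (\<lambda>z. \<Sum>i\<in>UNIV. \<Sum>j\<in>UNIV. ?H i j (fst z) * (snd z $ i * snd z $ j))"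
    proof (intro continuous_intros)
      fix i j :: 3
      have "continuous_on K (?H i j)" by (intro continuous_on_subset[OF smooth_on_imp_continuous_on K(2)] smooth_h)
      then show "continuous_on (Sigma K (\<lambda>_. sphere (0::R3) 1)) (\<lambda>z. ?H i j (fst z))"
        by (rule continuous_on_compose2[OF _ continuous_on_fst[OF continuous_on_id]]) auto
    qed
    moreover have "compact (Sigma K (\<lambda>_. sphere (0::R3) 1))" using K by (intro compact_Times compact_sphere)
    moreover have "axis 1 1 \<in> sphere (0::R3) 1" by simp
    then have "Sigma K (\<lambda>_. sphere (0::R3) 1) \<noteq> {}" using False by blast
    ultimately obtain z where z: "z \<in> Sigma K (\<lambda>_. sphere (0::R3) 1)" "\<And>y. y \<in> Sigma K (\<lambda>_. sphere (0::R3) 1) \<Longrightarrow>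
      (\<Sum>i\<in>UNIV. \<Sum>j\<in>UNIV. ?H i j (fst z) * (snd z $ i * snd z $ j)) \<le> (\<Sum>i\<in>UNIV. \<Sum>j\<in>UNIV. ?H i j (fst y) * (snd y $ i * snd y $ j))"
      using continuous_attains_inf[of "Sigma K (\<lambda>_. sphere (0::R3) 1)"] by blast
    have "h (fst z) (snd z) (snd z) > 0" using z(1) K(2) by (intro h_pos) auto
    moreover have "h (fst z) (snd z) (snd z) \<le> h x u u" if "x \<in> K" "u \<in> sphere 0 1" for x u
    proof -
      have "fst z \<in> C" "x \<in> C" using z(1) that K(2) by auto
      then show ?thesis using z(2)[of "(x, u)"] that by (simp add: h_expand[of x u u] h_expand[of "fst z" "snd z" "snd z"])
    qed
    ultimately show ?thesis by blast
  qed (auto intro: exI[of _ 1])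
  then obtain l where l: "l > 0" "\<And>x u. x \<in> K \<Longrightarrow> u \<in> sphere 0 1 \<Longrightarrow> l \<le> h x u u" by blast
  have lower: "l * (norm (w x))\<^sup>2 \<le> N x" if x: "x \<in> K" for x
  proof (cases "w x = 0")
    case True
    then show ?thesis using N_nonneg K(2) x by auto
  next
    case False
    have xC: "x \<in> C" using x K by auto
    have "N x = (norm (w x))\<^sup>2 * h x (w x /\<^sub>R norm (w x)) (w x /\<^sub>R norm (w x))"
      using False by (simp add: N_eq[OF xC] bilinear_lmul[OF bil[OF xC]] bilinear_rmul[OF bil[OF xC]] field_simps power2_eq_square)
    moreover have "l \<le> h x (w x /\<^sub>R norm (w x)) (w x /\<^sub>R norm (w x))" using False by (intro l x) simp
    ultimately show ?thesis by (metis mult.commute mult_right_mono zero_le_power2)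
  qed
  show ?thesis
  proof (intro exI[of _ "B1 / l"] ballI)
    fix x assume x: "x \<in> K"
    have B0: "B1 \<ge> 0" using B1[OF x] norm_ge_zero order_trans by blast
    have "\<bar>grad C N x \<bullet> w x\<bar> \<le> R x * (norm (w x))\<^sup>2" using bound x K by auto
    also have "\<dots> \<le> B1 * (norm (w x))\<^sup>2" using B1[OF x] by (intro mult_right_mono) auto
    also have "\<dots> = B1 / l * (l * (norm (w x))\<^sup>2)" using l by simp
    also have "\<dots> \<le> B1 / l * N x" using l B0 lower[OF x] by (intro mult_left_mono) auto
    finally show "\<bar>grad C N x \<bullet> w x\<bar> \<le> B1 / l * N x" .
  qed
qed

end

section \<open>The integral argument at a fixed time\<close>

locale partitioned_3manifold = compact_3manifold X A for X :: "'a topology" and A :: "'a chart set" +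
  fixes F :: "'a chart set" and \<phi> :: "'a chart \<Rightarrow> 'a \<Rightarrow> real"
  assumes pou: "partition_of_unity X A F \<phi>"
begin

abbreviation I :: "('a, real) field \<Rightarrow> real" where "I \<equiv> pou_integral F \<phi>"

text \<open>Integrands cut off at the zero set of \<open>M\<close> are discontinuous, so their
  integrability does not come from continuity and has to be tracked through the limits.\<close>

definition locally_integrable :: "('a, real) field \<Rightarrow> bool" where
  "locally_integrable r \<longleftrightarrow> (\<forall>c\<in>F. (\<lambda>x. \<phi> c (cinv c x) * r c x) integrable_on cimg c)"

lemma FA: "c \<in> F \<Longrightarrow> c \<in> A"
  using pou_subset[OF pou] by blast

lemma smooth_fieldD: "smooth_field A f \<Longrightarrow> c \<in> A \<Longrightarrow> smooth_on (cimg c) (f c)"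
  by (simp add: smooth_field_def)

lemma smooth_locally_integrable: "smooth_field A r \<Longrightarrow> locally_integrable r"
  unfolding locally_integrable_def
  by (intro ballI pou_integrable[OF pou] smooth_on_imp_continuous_on smooth_fieldD) (auto intro: FA)

lemma I_add: "locally_integrable r \<Longrightarrow> locally_integrable r' \<Longrightarrow> I (\<lambda>c x. r c x + r' c x) = I r + I r'"
  unfolding pou_integral_def locally_integrable_def sum.distrib[symmetric] distrib_left
  by (intro sum.cong refl integral_add) auto

lemma I_diff: "locally_integrable r \<Longrightarrow> locally_integrable r' \<Longrightarrow> I (\<lambda>c x. r c x - r' c x) = I r - I r'"
  unfolding pou_integral_def locally_integrable_def sum_subtractf[symmetric] right_diff_distrib
  by (intro sum.cong refl integral_diff) auto

lemma locally_integrable_add: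
  "locally_integrable r \<Longrightarrow> locally_integrable r' \<Longrightarrow> locally_integrable (\<lambda>c x. r c x + r' c x)"
  unfolding locally_integrable_def distrib_left by (intro ballI integrable_add) auto

lemma I_cong: "(\<And>c x. c \<in> A \<Longrightarrow> x \<in> cimg c \<Longrightarrow> r c x = r' c x) \<Longrightarrow> I r = I r'"
  by (rule pou_integral_cong) (use FA in auto)

lemma locally_integrable_cong:
  "(\<And>c x. c \<in> A \<Longrightarrow> x \<in> cimg c \<Longrightarrow> r c x = r' c x) \<Longrightarrow> locally_integrable r = locally_integrable r'"
  unfolding locally_integrable_def using FA by (intro ball_cong refl integrable_cong) auto

text \<open>Bound and limit are required on the supports of the partition functions only: constants
  obtained by compactness are valid there, not on a whole chart.\<close>

lemma I_dominated_convergence: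
  assumes int: "\<And>n. locally_integrable (r n)"
    and B: "\<And>c. c \<in> F \<Longrightarrow> continuous_on (cimg c) (B c)"
    and le: "\<And>n c x. c \<in> F \<Longrightarrow> x \<in> cimg c \<Longrightarrow> cinv c x \<in> supp (\<phi> c) \<Longrightarrow> \<bar>r n c x\<bar> \<le> B c x"
    and lim: "\<And>c x. c \<in> F \<Longrightarrow> x \<in> cimg c \<Longrightarrow> cinv c x \<in> supp (\<phi> c) \<Longrightarrow> (\<lambda>n. r n c x) \<longlonglongrightarrow> r' c x"
  shows "locally_integrable r'" "(\<lambda>n. I (r n)) \<longlonglongrightarrow> I r'"
proof -
  have *: "(\<lambda>x. \<phi> c (cinv c x) * r' c x) integrable_on cimg c \<and>
      (\<lambda>n. integral (cimg c) (\<lambda>x. \<phi> c (cinv c x) * r n c x)) \<longlonglongrightarrow> integral (cimg c) (\<lambda>x. \<phi> c (cinv c x) * r' c x)"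
    if c: "c \<in> F" for c
  proof -
    have 1: "(\<lambda>x. \<phi> c (cinv c x) * r n c x) integrable_on cimg c" for n
      using int c by (simp add: locally_integrable_def)
    have 2: "(\<lambda>x. \<phi> c (cinv c x) * B c x) integrable_on cimg c"
      by (rule pou_integrable[OF pou c B[OF c]])
    have 3: "norm (\<phi> c (cinv c x) * r n c x) \<le> \<phi> c (cinv c x) * B c x" if x: "x \<in> cimg c" for n x
    proof (cases "cinv c x \<in> supp (\<phi> c)")
      case True
      then show ?thesis using le[OF c x True, of n] pou_nonneg[OF pou c cinv_topspace[OF FA[OF c] x]]
        by (simp add: abs_mult mult_left_mono)
    qed (simp add: not_in_supp[OF cinv_topspace[OF FA[OF c] x]])
    have 4: "(\<lambda>n. \<phi> c (cinv c x) * r n c x) \<longlonglongrightarrow> \<phi> c (cinv c x) * r' c x" if x: "x \<in> cimg c" for x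
    proof (cases "cinv c x \<in> supp (\<phi> c)")
      case True
      then show ?thesis by (intro tendsto_mult tendsto_const lim c x)
    qed (simp add: not_in_supp[OF cinv_topspace[OF FA[OF c] x]])
    show ?thesis using dominated_convergence[OF 1 2 3 4] by blast
  qed
  then show "locally_integrable r'" "(\<lambda>n. I (r n)) \<longlonglongrightarrow> I r'"
    unfolding locally_integrable_def pou_integral_def by (auto intro!: tendsto_sum)
qed

text \<open>Stokes applied to f g W: the divergence of \<open>W\<close> is zero, so both remaining
  terms are derivatives of \<open>f\<close> and \<open>g\<close> along \<open>W\<close>, and
  tangency survives multiplication by functions.\<close>

lemma I_by_parts:
  assumes W: "smooth_field A W" "vector_density A W" "tangent_field A W"
    and div: "\<And>c x. c \<in> A \<Longrightarrow> x \<in> cimg c \<Longrightarrow> divg (cimg c) (W c) x = 0"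
    and f: "scalar_field A f" "smooth_field A f" and g: "scalar_field A g" "smooth_field A g"
  shows "I (\<lambda>c x. g c x * (grad (cimg c) (f c) x \<bullet> W c x)) = - I (\<lambda>c x. f c x * (grad (cimg c) (g c) x \<bullet> W c x))"
proof -
  have sm: "smooth_on (cimg c) (f c)" "smooth_on (cimg c) (g c)" "smooth_on (cimg c) (W c)" if "c \<in> A" for c
    using W(1) f(2) g(2) that by (auto simp: smooth_field_def)
  have li: "locally_integrable (\<lambda>c x. g c x * (grad (cimg c) (f c) x \<bullet> W c x))"
    "locally_integrable (\<lambda>c x. f c x * (grad (cimg c) (g c) x \<bullet> W c x))"
    by (auto intro!: smooth_locally_integrable smooth_intros smooth_inner smooth_grad fat_cimg sm simp: smooth_field_def)
  have "0 = I (\<lambda>c. divg (cimg c) (\<lambda>x. (f c x * g c x) *\<^sub>R W c x))"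
  proof (rule Stokes[OF pou, symmetric])
    show "smooth_field A (\<lambda>c x. (f c x * g c x) *\<^sub>R W c x)"
      by (auto intro!: smooth_intros sm simp: smooth_field_def)
    show "vector_density A (\<lambda>c x. (f c x * g c x) *\<^sub>R W c x)"
      by (intro vector_density_scaleR scalar_mult f g W)
    show "tangent_field A (\<lambda>c x. (f c x * g c x) *\<^sub>R W c x)"
      using W(3) by (simp add: tangent_field_def)
  qed
  also have "\<dots> = I (\<lambda>c x. g c x * (grad (cimg c) (f c) x \<bullet> W c x) + f c x * (grad (cimg c) (g c) x \<bullet> W c x))"
    by (rule I_cong) (simp add: divg_scaleR[OF fat_cimg] grad_mult[OF fat_cimg] smooth_on_mult sm div inner_add_left)
  also have "\<dots> = I (\<lambda>c x. g c x * (grad (cimg c) (f c) x \<bullet> W c x)) + I (\<lambda>c x. f c x * (grad (cimg c) (g c) x \<bullet> W c x))"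
    by (rule I_add[OF li])
  finally show ?thesis by linarith
qed

end

text \<open>All integrations by parts are along one of two divergence-free vector densities tangent
  to the boundary: \<open>w\<close>, which is closed as an exterior derivative, and f v, where
  \<open>f\<close> is the density of the invariant volume.\<close>

locale manifold_flow = partitioned_3manifold X A F \<phi>
  for X :: "'a topology" and A F \<phi> +
  fixes s P a m \<kappa> M N f :: "('a, real) field" and \<theta> v w \<alpha> \<beta> :: "('a, R3) field"
    and h :: "('a, R3 \<Rightarrow> R3 \<Rightarrow> real) field"
  assumes chart: "\<And>c. c \<in> A \<Longrightarrow> chart_flow (cimg c) (s c) (\<kappa> c) (\<theta> c) (v c) (w c) (\<alpha> c) (\<beta> c) (P c) (a c) (m c) (M c) (N c) (h c)"
    and scalars: "scalar_field A s" "scalar_field A a" "scalar_field A m" "scalar_field A M" "scalar_field A N"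
    and density_\<kappa>: "density_field A \<kappa>" and density_f: "density_field A f"
    and smooth_f: "smooth_field A f" and f_nz: "\<And>c x. c \<in> A \<Longrightarrow> x \<in> cimg c \<Longrightarrow> f c x \<noteq> 0"
    and vector_v: "vector_field A v" and density_w: "vector_density A w"
    and tangent_v: "tangent_field A v" and tangent_w: "tangent_field A w"
    and divg_fv: "\<And>c x. c \<in> A \<Longrightarrow> x \<in> cimg c \<Longrightarrow> divg (cimg c) (\<lambda>x. f c x *\<^sub>R v c x) x = 0"
begin

lemmas forms = chart_flow.axioms(1)[OF chart]

lemma smooth_fields: "smooth_field A s" "smooth_field A a" "smooth_field A m" "smooth_field A \<kappa>" "smooth_field A M"
  "smooth_field A N" "smooth_field A v" "smooth_field A w"
  unfolding smooth_field_def using chart_flow.smooths[OF chart] by auto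

lemmas smooth_on_fields = smooth_fields[THEN smooth_fieldD] smooth_f[THEN smooth_fieldD]

abbreviation along_w :: "('a, real) field \<Rightarrow> ('a, real) field" where
  "along_w u c x \<equiv> grad (cimg c) (u c) x \<bullet> w c x"

lemma smooth_along_w: "smooth_field A u \<Longrightarrow> smooth_field A (along_w u)"
  unfolding smooth_field_def using smooth_on_fields by (auto intro!: smooth_inner smooth_grad fat_cimg)

lemma I_along_w:
  assumes "scalar_field A u" "smooth_field A u" "scalar_field A g" "smooth_field A g"
  shows "I (\<lambda>c x. g c x * along_w u c x) = - I (\<lambda>c x. u c x * along_w g c x)"
  using chart_forms.divg_w[OF forms]
  by (intro I_by_parts assms smooth_fields density_w tangent_w) auto

text \<open>Homogeneous functions of degree zero of \<open>M\<close> and \<open>N\<close> are, formally, constant along \<open>w\<close>. The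
  regularisation \<open>\<epsilon>\<close> makes them smooth, at the cost of an error that is bounded and tends to zero.\<close>

lemma I_homogeneous:
  assumes u: "scalar_field A u" "smooth_field A u" and \<eta>: "\<eta> > 0"
  shows "locally_integrable (\<lambda>c x. (p * M c x + q * N c x) * N c x / ((M c x)\<^sup>2 + \<eta> * (N c x)\<^sup>2) * along_w u c x)" (is "locally_integrable ?r")
    and "I (\<lambda>c x. (p * M c x + q * N c x) * N c x / ((M c x)\<^sup>2 + \<eta> * (N c x)\<^sup>2) * along_w u c x) = 0"
proof -
  define L where "L c x = p * M c x + q * N c x" for c x
  define Q where "Q c x = (M c x)\<^sup>2 + \<eta> * (N c x)\<^sup>2" for c x
  define \<epsilon> where "\<epsilon> n = inverse (real (Suc n))" for n
  define G where "G n c x = L c x * N c x / (Q c x + \<epsilon> n)" for n c x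
  \<comment> \<open>Both |M N| and N^2 are at most (1 + 1/\<eta>) Q. Hence |L N| \<le> k Q, and |G
    n| \<le> k for all n.\<close>
  define k where "k = (\<bar>p\<bar> + \<bar>q\<bar>) * (1 + 1 / \<eta>)"
  have \<epsilon>: "\<epsilon> n > 0" for n by (simp add: \<epsilon>_def)
  have \<epsilon>0: "\<epsilon> \<longlonglongrightarrow> 0" unfolding \<epsilon>_def by (rule LIMSEQ_inverse_real_of_nat)
  have Q: "Q c x \<ge> 0" for c x using \<eta> by (simp add: Q_def)
  have Q\<epsilon>: "Q c x + \<epsilon> n > 0" for n c x using Q[of c x] \<epsilon>[of n] by linarith
  have k0: "k \<ge> 0" using \<eta> by (simp add: k_def)
  have LN: "\<bar>L c x * N c x\<bar> \<le> k * Q c x" for c x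
  proof -
    let ?M = "\<bar>M c x\<bar>" and ?N = "\<bar>N c x\<bar>"
    have M2: "?M\<^sup>2 \<le> Q c x" using \<eta> by (simp add: Q_def)
    have N2: "?N\<^sup>2 \<le> Q c x / \<eta>" using \<eta> by (simp add: Q_def field_simps)
    have MN: "?M * ?N \<le> Q c x * (1 + 1 / \<eta>)"
    proof -
      have "2 * (?M * ?N) \<le> ?M\<^sup>2 + ?N\<^sup>2" using sum_squares_bound[of ?M ?N] by simp
      moreover have "0 \<le> ?M * ?N" by simp
      ultimately have "?M * ?N \<le> ?M\<^sup>2 + ?N\<^sup>2" by linarith
      then show ?thesis using M2 N2 by (simp add: distrib_left)
    qed
    have NN: "?N * ?N \<le> Q c x * (1 + 1 / \<eta>)"
      using N2 Q[of c x] by (simp add: distrib_left power2_eq_square)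
    have "\<bar>L c x * N c x\<bar> \<le> \<bar>p\<bar> * (?M * ?N) + \<bar>q\<bar> * (?N * ?N)"
      unfolding L_def abs_mult using mult_right_mono[OF abs_triangle_ineq[of "p * M c x" "q * N c x"], of ?N]
      by (simp add: abs_mult algebra_simps)
    also have "\<dots> \<le> \<bar>p\<bar> * (Q c x * (1 + 1 / \<eta>)) + \<bar>q\<bar> * (Q c x * (1 + 1 / \<eta>))"
      by (intro add_mono mult_left_mono MN NN) auto
    finally show ?thesis by (simp add: k_def algebra_simps)
  qed
  have smM: "smooth_on (cimg c) (M c)" and smN: "smooth_on (cimg c) (N c)" if "c \<in> A" for c
    using smooth_on_fields that by auto
  have smL: "smooth_on (cimg c) (L c)" and smQ: "smooth_on (cimg c) (Q c)" if "c \<in> A" for c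
    unfolding L_def Q_def by (intro smooth_intros smM smN that)+
  have smG: "smooth_on (cimg c) (G n c)" if "c \<in> A" for c n
    unfolding G_def using Q\<epsilon> by (intro smooth_on_divide smooth_intros smL smQ smN that) (simp add: less_imp_neq[symmetric])
  have scG: "scalar_field A (G n)" for n
    unfolding G_def L_def Q_def power2_eq_square by (intro scalar_divide scalar_mult scalar_add scalar_const scalars)
  have G_le: "\<bar>G n c x\<bar> \<le> k" for n c x
  proof -
    have "\<bar>G n c x\<bar> \<le> k * Q c x / (Q c x + \<epsilon> n)"
      using LN[of c x] Q\<epsilon>[of c x n] by (simp add: G_def divide_right_mono)
    also have "\<dots> \<le> k" using k0 \<epsilon>[of n] Q\<epsilon>[of c x n] by (simp add: field_simps mult_nonneg_nonneg)
    finally show ?thesis .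
  qed
  have G_lim: "(\<lambda>n. G n c x) \<longlonglongrightarrow> L c x * N c x / Q c x" for c x
  proof (cases "Q c x = 0")
    case True
    then have "L c x * N c x = 0" using LN[of c x] by simp
    then show ?thesis by (simp only: G_def) simp
  next
    case False
    have "(\<lambda>n. L c x * N c x / (Q c x + \<epsilon> n)) \<longlonglongrightarrow> L c x * N c x / (Q c x + 0)"
      using False by (intro tendsto_intros \<epsilon>0) auto
    then show ?thesis by (simp add: G_def)
  qed
  \<comment> \<open>Along \<open>w\<close> the functions \<open>M\<close>, \<open>N\<close> and
    \<open>L\<close> have one common logarithmic derivative \<rho>, and \<open>Q\<close> has 2
    \<rho>. Without the regularisation \<open>G\<close> would be constant; what remains is 2 \<rho>
    \<epsilon> L N / (Q + \<epsilon>)^2, with |\<rho>| \<le> B.\<close>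
  have key: "\<bar>along_w (G n) c x\<bar> \<le> B * 2 * k * (Q c x * \<epsilon> n / (Q c x + \<epsilon> n)\<^sup>2)"
    if c: "c \<in> A" and x: "x \<in> cimg c" and B: "\<bar>along_w N c x\<bar> \<le> B * N c x" "0 \<le> B" for n c x B
  proof (cases "N c x = 0")
    case True
    then have "w c x = 0" using chart_flow.N_zero[OF chart[OF c] x] by simp
    then show ?thesis using k0 Q[of c x] \<epsilon>[of n] B(2) by simp
  next
    case False
    then have Npos: "N c x > 0" using chart_flow.N_nonneg[OF chart[OF c] x] by simp
    define \<rho> where "\<rho> = along_w N c x / N c x"
    have dN: "along_w N c x = \<rho> * N c x" using False by (simp add: \<rho>_def)
    have dM: "along_w M c x = \<rho> * M c x"
      using chart_flow.w_grad_M[OF chart[OF c] x] False by (simp add: \<rho>_def field_simps)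
    have \<rho>: "\<bar>\<rho>\<bar> \<le> B" using B Npos by (simp add: \<rho>_def field_simps)
    note simps = grad_add[OF fat_cimg[OF c]] grad_mult[OF fat_cimg[OF c]] inner_add_left
    have const: "grad (cimg c) (\<lambda>_. z) x = 0" for z
      using x by (simp add: vec_eq_iff partial_const[OF fat_cimg[OF c]])
    have dL: "along_w L c x = \<rho> * L c x"
      unfolding L_def[abs_def] using smM[OF c] smN[OF c] x
      by (simp add: simps const smooth_on_const smooth_on_mult dN dM algebra_simps)
    have sq: "grad (cimg c) (\<lambda>y. z y * z y) x \<bullet> w c x = 2 * z x * (grad (cimg c) z x \<bullet> w c x)"
      if "smooth_on (cimg c) z" for z
      by (subst grad_mult[OF fat_cimg[OF c] that that x]) (simp only: inner_add_left inner_scaleR_left mult_2 distrib_right)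
    have dQ: "along_w Q c x = 2 * \<rho> * Q c x"
      unfolding Q_def[abs_def] power2_eq_square using smM[OF c] smN[OF c] x
      by (simp add: simps(1) grad_mult[OF fat_cimg[OF c], of "\<lambda>_. \<eta>"] inner_add_left const smooth_on_const smooth_on_mult sq dN dM algebra_simps)
    have "grad (cimg c) (\<lambda>y. G n c y * (Q c y + \<epsilon> n)) x = grad (cimg c) (\<lambda>y. L c y * N c y) x"
      using Q\<epsilon>[of c _ n] by (intro grad_cong[OF _ x]) (simp add: G_def less_imp_neq[symmetric])
    moreover have "grad (cimg c) (\<lambda>y. G n c y * (Q c y + \<epsilon> n)) x \<bullet> w c x
        = (Q c x + \<epsilon> n) * along_w (G n) c x + G n c x * (2 * \<rho> * Q c x)"
      by (subst grad_mult[OF fat_cimg[OF c] smG[OF c] smooth_on_add[OF smQ[OF c] smooth_on_const] x],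
          subst grad_add[OF fat_cimg[OF c] smQ[OF c] smooth_on_const x]) (simp add: inner_add_left const dQ)
    moreover have "grad (cimg c) (\<lambda>y. L c y * N c y) x \<bullet> w c x = 2 * \<rho> * (L c x * N c x)"
      by (subst grad_mult[OF fat_cimg[OF c] smL[OF c] smN[OF c] x]) (simp add: inner_add_left dL dN)
    ultimately have "(Q c x + \<epsilon> n) * along_w (G n) c x + G n c x * (2 * \<rho> * Q c x) = 2 * \<rho> * (L c x * N c x)"
      by simp
    moreover have "G n c x * (Q c x + \<epsilon> n) = L c x * N c x" using Q\<epsilon>[of c x n] by (simp add: G_def)
    ultimately have "(Q c x + \<epsilon> n) * along_w (G n) c x = 2 * \<rho> * \<epsilon> n * G n c x" by algebra
    moreover have "y = r * z / q\<^sup>2" if "q * y = r * (z / q)" "q > 0" for q y r z :: real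
      using that by (simp add: field_simps power2_eq_square)
    ultimately have "along_w (G n) c x = 2 * \<rho> * \<epsilon> n * (L c x * N c x) / (Q c x + \<epsilon> n)\<^sup>2"
      using Q\<epsilon>[of c x n] unfolding G_def by blast
    then have "\<bar>along_w (G n) c x\<bar> = (2 * \<bar>\<rho>\<bar> * \<epsilon> n) * \<bar>L c x * N c x\<bar> / (Q c x + \<epsilon> n)\<^sup>2"
      using \<epsilon>[of n] by (simp add: abs_mult)
    also have "\<dots> \<le> (2 * B * \<epsilon> n) * (k * Q c x) / (Q c x + \<epsilon> n)\<^sup>2"
      using \<rho> \<epsilon>[of n] B by (intro divide_right_mono mult_mono LN mult_left_mono) (auto intro!: mult_right_mono)
    finally show ?thesis by (simp add: ac_simps)
  qed
  have "\<exists>B. 0 \<le> B \<and> (\<forall>x\<in>cimg c. cinv c x \<in> supp (\<phi> c) \<longrightarrow> \<bar>along_w N c x\<bar> \<le> B * N c x)" if c: "c \<in> F" for c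
  proof -
    have cA: "c \<in> A" using FA[OF c] .
    note K = compact_image_support[OF cA closedin_supp pou_supp[OF pou c]]
    obtain B where B: "\<forall>x\<in>crd c ` supp (\<phi> c). \<bar>along_w N c x\<bar> \<le> B * N c x"
      using chart_flow.w_grad_N_bound[OF chart[OF cA] K] by blast
    have "\<bar>along_w N c x\<bar> \<le> max B 0 * N c x" if x: "x \<in> cimg c" "cinv c x \<in> supp (\<phi> c)" for x
    proof -
      have "x \<in> crd c ` supp (\<phi> c)" using x crd_cinv by (metis image_eqI)
      then have "\<bar>along_w N c x\<bar> \<le> B * N c x" using B by blast
      also have "\<dots> \<le> max B 0 * N c x" using chart_flow.N_nonneg[OF chart[OF cA] x(1)] by (intro mult_right_mono) auto
      finally show ?thesis .
    qed
    then show ?thesis by (intro exI[of _ "max B 0"]) auto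
  qed
  then obtain B where B: "\<And>c. c \<in> F \<Longrightarrow> 0 \<le> B c"
    "\<And>c x. c \<in> F \<Longrightarrow> x \<in> cimg c \<Longrightarrow> cinv c x \<in> supp (\<phi> c) \<Longrightarrow> \<bar>along_w N c x\<bar> \<le> B c * N c x"
    by metis
  have smu: "smooth_on (cimg c) (u c)" if "c \<in> A" for c using u(2) that by (simp add: smooth_field_def)
  have smGf: "smooth_field A (G n)" for n using smG by (simp add: smooth_field_def)
  have eq: "I (\<lambda>c x. G n c x * along_w u c x) = - I (\<lambda>c x. u c x * along_w (G n) c x)" for n
    by (rule I_along_w[OF u scG smGf])
  have li: "locally_integrable (\<lambda>c x. G n c x * along_w u c x)" "locally_integrable (\<lambda>c x. u c x * along_w (G n) c x)" for n
    using smooth_along_w[OF u(2)] smooth_along_w[OF smGf] smGf u(2)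
    by (auto intro!: smooth_locally_integrable smooth_on_mult simp: smooth_field_def)
  have cont: "continuous_on (cimg c) (u c)" "continuous_on (cimg c) (along_w u c)" if "c \<in> F" for c
    using smu smooth_along_w[OF u(2)] FA[OF that] by (auto intro!: smooth_on_imp_continuous_on simp: smooth_field_def)
  have b1: "continuous_on (cimg c) (\<lambda>x. k * \<bar>along_w u c x\<bar>)" if "c \<in> F" for c
    by (intro continuous_intros cont that)
  have b2: "\<bar>G n c x * along_w u c x\<bar> \<le> k * \<bar>along_w u c x\<bar>" for n c x
    using G_le[of n c x] by (simp add: abs_mult mult_right_mono)
  have b3: "(\<lambda>n. G n c x * along_w u c x) \<longlonglongrightarrow> L c x * N c x / Q c x * along_w u c x" for c x
    by (intro tendsto_mult tendsto_const G_lim)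
  have lim1: "locally_integrable (\<lambda>c x. L c x * N c x / Q c x * along_w u c x)"
    "(\<lambda>n. I (\<lambda>c x. G n c x * along_w u c x)) \<longlonglongrightarrow> I (\<lambda>c x. L c x * N c x / Q c x * along_w u c x)"
    using I_dominated_convergence[where r="\<lambda>n c x. G n c x * along_w u c x"
        and r'="\<lambda>c x. L c x * N c x / Q c x * along_w u c x" and B="\<lambda>c x. k * \<bar>along_w u c x\<bar>", OF li(1) b1 b2 b3]
    by auto
  \<comment> \<open>The factor tends to 0 at each point but not uniformly: it equals 1/4 wherever Q
    = \<epsilon>. Hence this bound is combined with dominated convergence.\<close>
  have q1: "Q c x * \<epsilon> n / (Q c x + \<epsilon> n)\<^sup>2 \<le> 1" for n c x
  proof -
    have "Q c x * \<epsilon> n \<le> (Q c x + \<epsilon> n)\<^sup>2" using Q[of c x] \<epsilon>[of n] by (simp add: power2_sum)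
    then show ?thesis using Q\<epsilon>[of c x n] by (simp add: divide_le_eq)
  qed
  have qlim: "(\<lambda>n. Q c x * \<epsilon> n / (Q c x + \<epsilon> n)\<^sup>2) \<longlonglongrightarrow> 0" for c x
  proof (cases "Q c x = 0")
    case False
    have "(\<lambda>n. Q c x * \<epsilon> n / (Q c x + \<epsilon> n)\<^sup>2) \<longlonglongrightarrow> Q c x * 0 / (Q c x + 0)\<^sup>2"
      using False by (intro tendsto_intros \<epsilon>0) auto
    then show ?thesis by simp
  qed simp
  have "(\<lambda>n. I (\<lambda>c x. u c x * along_w (G n) c x)) \<longlonglongrightarrow> I (\<lambda>c x. 0)"
  proof (rule I_dominated_convergence(2)[where B="\<lambda>c x. \<bar>u c x\<bar> * (B c * 2 * k)", OF li(2)])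
    show "continuous_on (cimg c) (\<lambda>x. \<bar>u c x\<bar> * (B c * 2 * k))" if "c \<in> F" for c
      by (intro continuous_intros cont that)
    have est: "\<bar>u c x * along_w (G n) c x\<bar> \<le> \<bar>u c x\<bar> * (B c * 2 * k) * (Q c x * \<epsilon> n / (Q c x + \<epsilon> n)\<^sup>2)"
      if "c \<in> F" "x \<in> cimg c" "cinv c x \<in> supp (\<phi> c)" for n c x
      using mult_left_mono[OF key[OF FA[OF that(1)] that(2) B(2)[OF that] B(1)[OF that(1)]], of "\<bar>u c x\<bar>" n]
      by (simp add: abs_mult mult.assoc)
    show "\<bar>u c x * along_w (G n) c x\<bar> \<le> \<bar>u c x\<bar> * (B c * 2 * k)"
      if "c \<in> F" "x \<in> cimg c" "cinv c x \<in> supp (\<phi> c)" for n c x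
      using est[OF that, of n] mult_left_mono[OF q1[of c x n], of "\<bar>u c x\<bar> * (B c * 2 * k)"] B(1)[OF that(1)] k0 by simp
    show "(\<lambda>n. u c x * along_w (G n) c x) \<longlonglongrightarrow> 0"
      if "c \<in> F" "x \<in> cimg c" "cinv c x \<in> supp (\<phi> c)" for c x
    proof (rule tendsto_0_le[where K="\<bar>u c x\<bar> * (B c * 2 * k)", OF qlim[of c x]], rule always_eventually, rule allI)
      fix n
      have "\<bar>\<epsilon> n * Q c x\<bar> = \<epsilon> n * Q c x"
        using Q[of c x] \<epsilon>[of n] by simp
      then show "norm (u c x * along_w (G n) c x) \<le> norm (Q c x * \<epsilon> n / (Q c x + \<epsilon> n)\<^sup>2) * (\<bar>u c x\<bar> * (B c * 2 * k))"
        using est[OF that, of n] by (simp only: real_norm_def) (simp add: mult.commute)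
    qed
  qed
  then have "(\<lambda>n. I (\<lambda>c x. G n c x * along_w u c x)) \<longlonglongrightarrow> 0"
    unfolding eq using tendsto_minus by (fastforce simp: pou_integral_0)
  then have "I (\<lambda>c x. L c x * N c x / Q c x * along_w u c x) = 0"
    using lim1(2) LIMSEQ_unique by blast
  then show "locally_integrable ?r" "I ?r = 0" using lim1(1) by (simp_all add: L_def Q_def)
qed

end

section \<open>The integral of a \<alpha> \<and> d\<alpha>, split along the zero set of
  \<open>M\<close>\<close>

context manifold_flow
begin

definition a\<kappa> :: "('a, real) field" where "a\<kappa> c x = a c x * \<kappa> c x"

lemma smooth_a\<kappa>: "smooth_field A a\<kappa>"
  using smooth_on_fields by (auto simp: smooth_field_def a\<kappa>_def[abs_def] intro!: smooth_on_mult)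

lemma continuous_of_smooth: "smooth_field A u \<Longrightarrow> c \<in> F \<Longrightarrow> continuous_on (cimg c) (u c)"
  using FA by (auto simp: smooth_field_def intro!: smooth_on_imp_continuous_on)

lemma locally_integrable_cmult:
  assumes "locally_integrable r"
  shows "locally_integrable (\<lambda>c x. k * r c x)"
  unfolding locally_integrable_def
proof
  fix c assume "c \<in> F"
  then have "(\<lambda>x. k * (\<phi> c (cinv c x) * r c x)) integrable_on cimg c"
    using assms integrable_cmul[of "\<lambda>x. \<phi> c (cinv c x) * r c x" "cimg c" k] by (simp add: locally_integrable_def)
  then show "(\<lambda>x. \<phi> c (cinv c x) * (k * r c x)) integrable_on cimg c" by (simp add: mult.left_commute)
qed

lemma inverse_Suc_tendsto: "(\<lambda>n. inverse (real (Suc n))) \<longlonglongrightarrow> 0"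
  by (rule LIMSEQ_inverse_real_of_nat)

text \<open>Provides bounded weights that approach the indicator of p \<noteq> 0; if both numbers
  vanish, the convention 0/0 = 0 gives the required value.\<close>

lemma quotient_tendsto_indicator:
  fixes p q :: real
  assumes "p \<ge> 0" "q \<ge> 0"
  shows "(\<lambda>n. p / (p + inverse (real (Suc n)) * q)) \<longlonglongrightarrow> (if p = 0 then 0 else 1)"
    and "\<bar>p / (p + inverse (real (Suc n)) * q)\<bar> \<le> 1"
proof -
  show "(\<lambda>n. p / (p + inverse (real (Suc n)) * q)) \<longlonglongrightarrow> (if p = 0 then 0 else 1)"
  proof (cases "p = 0")
    case False
    have "(\<lambda>n. p / (p + inverse (real (Suc n)) * q)) \<longlonglongrightarrow> p / (p + 0 * q)"
      using False by (intro tendsto_intros inverse_Suc_tendsto) auto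
    then show ?thesis using False by simp
  qed simp
  have "0 \<le> inverse (real (Suc n)) * q" using assms by simp
  then show "\<bar>p / (p + inverse (real (Suc n)) * q)\<bar> \<le> 1"
    using assms by (cases "p + inverse (real (Suc n)) * q = 0") (auto simp: divide_le_eq)
qed

text \<open>Use u = a^2 with the weight M N / (M^2 + \<eta> N^2), a regularisation of 1/b. As N
  \<xi>(a) = -M \<kappa>, the integrand becomes -2 a \<kappa> M^2 / (M^2 + \<eta> N^2), and for
  \<eta> \<rightarrow> 0 its last factor tends to the indicator of M \<noteq> 0.\<close>

lemma I_nonzero_M:
  "locally_integrable (\<lambda>c x. if M c x = 0 then 0 else a\<kappa> c x)" (is "locally_integrable ?r")
  "I (\<lambda>c x. if M c x = 0 then 0 else a\<kappa> c x) = 0"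
proof -
  define r where "r n c x = (M c x)\<^sup>2 / ((M c x)\<^sup>2 + inverse (real (Suc n)) * (N c x)\<^sup>2) * a\<kappa> c x" for n c x
  let ?u = "\<lambda>c x. a c x * a c x"
  have u: "scalar_field A ?u" "smooth_field A ?u"
    using smooth_on_fields by (auto intro!: scalar_mult scalars smooth_on_mult simp: smooth_field_def)
  have eq: "(1 * M c x + 0 * N c x) * N c x / ((M c x)\<^sup>2 + inverse (real (Suc n)) * (N c x)\<^sup>2) * along_w ?u c x
      = - 2 * r n c x" if "c \<in> A" "x \<in> cimg c" for n c x
  proof -
    have "grad (cimg c) (?u c) x \<bullet> w c x = 2 * a c x * along_w a c x"
      by (subst grad_mult[OF fat_cimg[OF that(1)] _ _ that(2)], (rule smooth_on_fields that)+)
        (simp only: inner_add_left inner_scaleR_left mult_2 distrib_right)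
    moreover have "N c x * along_w a c x = - (M c x * \<kappa> c x)"
      by (rule chart_flow.grad_a_w[OF chart[OF that(1)] that(2)])
    ultimately have "N c x * along_w ?u c x = - 2 * a c x * M c x * \<kappa> c x" by algebra
    then show ?thesis by (simp add: r_def a\<kappa>_def power2_eq_square algebra_simps)
  qed
  have r: "locally_integrable (\<lambda>c x. - 2 * r n c x)" "I (\<lambda>c x. - 2 * r n c x) = 0" for n
    using I_homogeneous[OF u, of "inverse (real (Suc n))" 1 0]
      locally_integrable_cong[OF eq[where n=n]] I_cong[OF eq[where n=n]] by auto
  have r0: "I (r n) = 0" for n
    using r(2)[of n] pou_integral_cmult[of F \<phi> "-2" "r n"] by simp
  have rl: "locally_integrable (r n)" for n
  proof -
    have "locally_integrable (\<lambda>c x. (- 1 / 2) * (- 2 * r n c x))"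
      by (rule locally_integrable_cmult[OF r(1)])
    then show ?thesis by (simp add: locally_integrable_def)
  qed
  have b1: "continuous_on (cimg c) (\<lambda>x. \<bar>a\<kappa> c x\<bar>)" if "c \<in> F" for c
    by (intro continuous_intros continuous_of_smooth[OF smooth_a\<kappa> that])
  have b2: "\<bar>r n c x\<bar> \<le> \<bar>a\<kappa> c x\<bar>" for n c x
    using mult_right_mono[OF quotient_tendsto_indicator(2)[of "(M c x)\<^sup>2" "(N c x)\<^sup>2" n], of "\<bar>a\<kappa> c x\<bar>"]
    by (simp only: r_def abs_mult) simp
  have b3: "(\<lambda>n. r n c x) \<longlonglongrightarrow> (if M c x = 0 then 0 else a\<kappa> c x)" for c x
    using tendsto_mult_right[OF quotient_tendsto_indicator(1)[of "(M c x)\<^sup>2" "(N c x)\<^sup>2"], of "a\<kappa> c x"]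
    by (auto simp: r_def)
  note lim = I_dominated_convergence[where r=r and r'="?r", OF rl b1 b2 b3]
  show "locally_integrable ?r" using lim(1) by simp
  have "(\<lambda>n. I (r n)) \<longlonglongrightarrow> I ?r" using lim(2) by simp
  then show "I ?r = 0" unfolding r0 by (simp add: LIMSEQ_const_iff)
qed

text \<open>The weight \<eta> N^2 / (M^2 + \<eta> N^2) is homogeneous of degree zero and tends to
  the indicator of M = 0 wherever N \<noteq> 0; where N = 0 the derivative along \<open>w\<close>
  vanishes by itself.\<close>

lemma I_zero_M_along_w:
  "locally_integrable (\<lambda>c x. if M c x = 0 then along_w m c x else 0)" (is "locally_integrable ?r")
  "I (\<lambda>c x. if M c x = 0 then along_w m c x else 0) = 0"
proof -
  define r where "r n c x = (0 * M c x + inverse (real (Suc n)) * N c x) * N c x / ((M c x)\<^sup>2 + inverse (real (Suc n)) * (N c x)\<^sup>2) * along_w m c x" for n c x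
  have rl: "locally_integrable (r n)" and r0: "I (r n) = 0" for n
    unfolding r_def by (rule I_homogeneous; use scalars smooth_fields in auto)+
  have b1: "continuous_on (cimg c) (\<lambda>x. \<bar>along_w m c x\<bar>)" if "c \<in> F" for c
    by (intro continuous_intros continuous_of_smooth[OF smooth_along_w[OF smooth_fields(3)] that])
  have b: "\<bar>r n c x\<bar> \<le> \<bar>along_w m c x\<bar>" "(\<lambda>n. r n c x) \<longlonglongrightarrow> ?r c x" if "c \<in> F" "x \<in> cimg c" for n c x
  proof -
    define p where "p n = (M c x)\<^sup>2 / ((M c x)\<^sup>2 + inverse (real (Suc n)) * (N c x)\<^sup>2)" for n
    have p: "p \<longlonglongrightarrow> (if M c x = 0 then 0 else 1)" "\<bar>p n\<bar> \<le> 1" "0 \<le> p n" for n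
      using quotient_tendsto_indicator[of "(M c x)\<^sup>2" "(N c x)\<^sup>2"] by (simp_all add: p_def[abs_def])
    have "r n c x = (1 - p n) * along_w m c x" for n
    proof (cases "N c x = 0")
      case True
      then have "w c x = 0" using chart_flow.N_zero[OF chart[OF FA[OF that(1)]] that(2)] by simp
      then show ?thesis by (simp add: r_def)
    next
      case False
      then have "(M c x)\<^sup>2 + inverse (real (Suc n)) * (N c x)\<^sup>2 > 0" by (intro add_nonneg_pos mult_pos_pos) auto
      then have "inverse (real (Suc n)) * (N c x)\<^sup>2 / ((M c x)\<^sup>2 + inverse (real (Suc n)) * (N c x)\<^sup>2) = 1 - p n"
        unfolding p_def by (metis add_diff_cancel_left' diff_divide_distrib divide_self less_numeral_extra(3))
      then show ?thesis by (simp add: r_def power2_eq_square mult.assoc)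
    qed
    note r = this
    show "\<bar>r n c x\<bar> \<le> \<bar>along_w m c x\<bar>"
      using p(2,3)[of n] by (simp add: r abs_mult mult_left_le_one_le)
    have "(\<lambda>n. (1 - p n) * along_w m c x) \<longlonglongrightarrow> (1 - (if M c x = 0 then 0 else 1)) * along_w m c x"
      by (intro tendsto_intros p)
    then show "(\<lambda>n. r n c x) \<longlonglongrightarrow> ?r c x" by (simp add: r split: if_splits)
  qed
  note lim = I_dominated_convergence[where r=r and r'="?r" and B="\<lambda>c x. \<bar>along_w m c x\<bar>", OF rl b1 b(1) b(2)]
  show "locally_integrable ?r" using lim(1) by simp
  have "(\<lambda>n. I (r n)) \<longlonglongrightarrow> I ?r" using lim(2) by simp
  then show "I ?r = 0" unfolding r0 by (simp add: LIMSEQ_const_iff)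
qed

text \<open>The functions \<epsilon> arctan(M/\<epsilon>) tend to 0 uniformly, while their
  derivatives with respect to M, 1/(1 + (M/\<epsilon>)^2), tend to the indicator of M = 0.
  Integrating by parts along the divergence-free f v moves the derivative to \<open>K\<close>, and
  the limit is zero.\<close>

lemma I_zero_M_along_v:
  assumes K: "scalar_field A K" "smooth_field A K"
  shows "locally_integrable (\<lambda>c x. if M c x = 0 then K c x * (grad (cimg c) (M c) x \<bullet> (f c x *\<^sub>R v c x)) else 0)" (is "locally_integrable ?r")
    "I (\<lambda>c x. if M c x = 0 then K c x * (grad (cimg c) (M c) x \<bullet> (f c x *\<^sub>R v c x)) else 0) = 0"
proof -
  let ?W = "\<lambda>c x. f c x *\<^sub>R v c x"
  let ?dM = "\<lambda>c x. grad (cimg c) (M c) x \<bullet> ?W c x"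
  define \<epsilon> where "\<epsilon> n = inverse (real (Suc n))" for n
  have \<epsilon>: "\<epsilon> n > 0" for n by (simp add: \<epsilon>_def)
  have \<epsilon>0: "\<epsilon> \<longlonglongrightarrow> 0" unfolding \<epsilon>_def by (rule LIMSEQ_inverse_real_of_nat)
  have Ck_arctan: "Ck_on k UNIV arctan" for k
  proof (cases k)
    case (Suc j)
    have sum_sq: "1 + x * x \<noteq> 0" for x :: real using zero_le_square[of x] by linarith
    have "Ck_on j UNIV (\<lambda>x::real. u * inverse (1 + x * x))" for u
      by (intro Ck_on_bounded_linear[OF bounded_linear_mult_right] Ck_on_compose[OF _ _ _ Ck_on_inverse]
          Ck_on_add Ck_on_const Ck_on_bilinear[OF bounded_bilinear_mult] Ck_on_id) (use sum_sq in auto)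
    then show ?thesis unfolding Suc
      by (intro Ck_on_SucI[where f'="\<lambda>x u. u * inverse (1 + x * x)"])
        (auto intro!: derivative_eq_intros simp: power2_eq_square)
  qed (auto intro!: continuous_intros)
  have smM: "smooth_on (cimg c) (M c)" if "c \<in> A" for c using smooth_on_fields that by auto
  define H where "H n c x = \<epsilon> n * arctan (M c x / \<epsilon> n)" for n c x
  have sW: "smooth_field A ?W"
    using smooth_on_fields by (auto simp: smooth_field_def intro!: smooth_intros)
  have smH: "smooth_field A (H n)" for n
    unfolding smooth_field_def H_def divide_inverse
    by (intro ballI smooth_intros smooth_on_compose[OF smooth_on_open[OF open_UNIV Ck_arctan]] smM) auto
  have scH: "scalar_field A (H n)" for n
    unfolding H_def by (intro scalar_fun[of _ "\<lambda>z. \<epsilon> n * arctan (z / \<epsilon> n)"] scalars)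
  define r where "r n c x = K c x * (grad (cimg c) (H n c) x \<bullet> ?W c x)" for n c x
  define r' where "r' n c x = H n c x * (grad (cimg c) (K c) x \<bullet> ?W c x)" for n c x
  have req: "I (r n) = - I (r' n)" for n
    unfolding r_def r'_def
    by (rule I_by_parts[OF sW vector_density_of_vector[OF density_f vector_v] _ divg_fv scH smH K])
      (use tangent_v in \<open>auto simp: tangent_field_def\<close>)
  have dK: "smooth_field A (\<lambda>c x. grad (cimg c) (K c) x \<bullet> ?W c x)" "smooth_field A ?dM"
    "smooth_field A (\<lambda>c x. grad (cimg c) (H n c) x \<bullet> ?W c x)" for n
    unfolding smooth_field_def
    by (intro ballI smooth_inner smooth_grad fat_cimg smooth_fieldD[OF sW] smooth_fieldD[OF K(2)] smooth_fieldD[OF smH] smM; assumption)+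
  have li: "locally_integrable (r n)" "locally_integrable (r' n)" for n
    unfolding r_def r'_def
    by (rule smooth_locally_integrable, unfold smooth_field_def, intro ballI smooth_on_mult smooth_fieldD[OF K(2)]
        smooth_fieldD[OF smH] smooth_fieldD[OF dK(1)] smooth_fieldD[OF dK(3)]; assumption)+
  have gH: "r n c x = K c x * ?dM c x / (1 + (M c x / \<epsilon> n)\<^sup>2)" if "c \<in> A" "x \<in> cimg c" for n c x
  proof -
    have "grad (cimg c) (H n c) x = (1 / (1 + (M c x / \<epsilon> n)\<^sup>2)) *\<^sub>R grad (cimg c) (M c) x"
    proof -
      have "((\<lambda>z. \<epsilon> n * arctan (z / \<epsilon> n)) has_real_derivative 1 / (1 + (M c x / \<epsilon> n)\<^sup>2)) (at (M c x))"
        using \<epsilon>[of n] by (auto intro!: derivative_eq_intros simp: divide_inverse)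
      from partial_real_fun[OF fat_cimg[OF that(1)] smM[OF that(1)] that(2) this]
      show ?thesis by (simp add: vec_eq_iff H_def[abs_def])
    qed
    then show ?thesis by (simp add: r_def)
  qed
  have "(\<lambda>n. I (r' n)) \<longlonglongrightarrow> I (\<lambda>c x. 0)"
  proof (rule I_dominated_convergence(2)[where B="\<lambda>c x. pi / 2 * \<bar>grad (cimg c) (K c) x \<bullet> ?W c x\<bar>", OF li(2)])
    show "continuous_on (cimg c) (\<lambda>x. pi / 2 * \<bar>grad (cimg c) (K c) x \<bullet> ?W c x\<bar>)" if "c \<in> F" for c
      by (intro continuous_intros continuous_of_smooth[OF dK(1) that])
    have Hle: "\<bar>H n c x\<bar> \<le> \<epsilon> n * (pi / 2)" for n c x
    proof -
      have "\<bar>arctan y\<bar> \<le> pi / 2" for y using arctan_bounded[of y] by (auto simp: abs_le_iff)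
      from mult_left_mono[OF this, of "\<epsilon> n"] show ?thesis using \<epsilon>[of n] by (simp add: H_def abs_mult)
    qed
    moreover have "\<epsilon> n * (pi / 2) \<le> pi / 2" for n
      using mult_right_mono[of "\<epsilon> n" 1 "pi / 2"] by (simp add: \<epsilon>_def field_simps)
    ultimately have "\<bar>H n c x\<bar> \<le> pi / 2" for n c x using order_trans by blast
    then show "\<bar>r' n c x\<bar> \<le> pi / 2 * \<bar>grad (cimg c) (K c) x \<bullet> ?W c x\<bar>" for n c x
      unfolding r'_def abs_mult by (intro mult_right_mono) auto
    show "(\<lambda>n. r' n c x) \<longlonglongrightarrow> 0" for c x
    proof -
      have "(\<lambda>n. \<epsilon> n * (pi / 2)) \<longlonglongrightarrow> 0 * (pi / 2)" by (intro tendsto_intros \<epsilon>0)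
      then have lim: "(\<lambda>n. \<epsilon> n * (pi / 2)) \<longlonglongrightarrow> 0" by simp
      have "(\<lambda>n. H n c x) \<longlonglongrightarrow> 0"
        by (rule Lim_null_comparison[OF always_eventually lim]) (simp only: real_norm_def Hle simp_thms)
      then show ?thesis unfolding r'_def by (rule tendsto_mult_left_zero)
    qed
  qed
  then have r0: "(\<lambda>n. I (r n)) \<longlonglongrightarrow> 0"
    unfolding req using tendsto_minus by (fastforce simp: pou_integral_0)
  have b1: "continuous_on (cimg c) (\<lambda>x. \<bar>K c x * ?dM c x\<bar>)" if "c \<in> F" for c
    by (intro continuous_intros continuous_of_smooth[OF dK(2) that] continuous_of_smooth[OF K(2) that])
  have b2: "\<bar>r n c x\<bar> \<le> \<bar>K c x * ?dM c x\<bar>" if "c \<in> F" "x \<in> cimg c" for n c x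
  proof -
    have "\<bar>z / (1 + y\<^sup>2)\<bar> \<le> \<bar>z\<bar>" for z y :: real
    proof -
      have "\<bar>z\<bar> * 1 \<le> \<bar>z\<bar> * (1 + y\<^sup>2)" by (intro mult_left_mono) auto
      moreover have "1 + y\<^sup>2 > 0" by (simp add: add_pos_nonneg)
      ultimately show ?thesis by (simp add: divide_le_eq)
    qed
    then show ?thesis using gH[OF FA[OF that(1)] that(2)] by simp
  qed
  have b3: "(\<lambda>n. r n c x) \<longlonglongrightarrow> ?r c x" if "c \<in> F" "x \<in> cimg c" for c x
  proof (cases "M c x = 0")
    case True
    then show ?thesis using gH[OF FA[OF that(1)] that(2)] by simp
  next
    case False
    have "r n c x = K c x * ?dM c x * ((\<epsilon> n)\<^sup>2 / ((\<epsilon> n)\<^sup>2 + (M c x)\<^sup>2))" for n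
      unfolding gH[OF FA[OF that(1)] that(2)] using \<epsilon>[of n]
      by (simp add: power_divide add_divide_eq_iff field_simps)
    moreover have "(\<lambda>n. K c x * ?dM c x * ((\<epsilon> n)\<^sup>2 / ((\<epsilon> n)\<^sup>2 + (M c x)\<^sup>2)))
        \<longlonglongrightarrow> K c x * ?dM c x * (0\<^sup>2 / (0\<^sup>2 + (M c x)\<^sup>2))"
      using False by (intro tendsto_intros \<epsilon>0) auto
    ultimately show ?thesis using False by simp
  qed
  note lim = I_dominated_convergence[where r=r and r'="?r" and B="\<lambda>c x. \<bar>K c x * ?dM c x\<bar>", OF li(1) b1 b2 b3]
  show "locally_integrable ?r" using lim(1) by simp
  have "(\<lambda>n. I (r n)) \<longlonglongrightarrow> I ?r" using lim(2) by simp
  then show "I ?r = 0" using r0 LIMSEQ_unique by blast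
qed

text \<open>The pointwise identity at the zeros of \<open>M\<close> carries a factor
  \<open>N\<close>. Weighting with N/(N + \<epsilon>) lets it be applied, and nothing is lost in the
  limit: where N = 0 both a \<kappa> and the derivative of \<open>m\<close> along \<open>w\<close>
  vanish.\<close>

lemma I_zero_M:
  "locally_integrable (\<lambda>c x. if M c x = 0 then a\<kappa> c x + along_w m c x else 0)" (is "locally_integrable ?r")
  "I (\<lambda>c x. if M c x = 0 then a\<kappa> c x + along_w m c x else 0) = 0"
proof -
  define r where "r n c x = (if M c x = 0 then N c x / (N c x + inverse (real (Suc n)) * 1) * (a\<kappa> c x + along_w m c x) else 0)" for n c x
  have Npos: "N c x + inverse (real (Suc n)) > 0" if "c \<in> A" "x \<in> cimg c" for n c x
    using chart_flow.N_nonneg[OF chart[OF that(1)] that(2)] by (simp add: add_nonneg_pos)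
  have rn: "locally_integrable (r n)" "I (r n) = 0" for n
  proof -
    \<comment> \<open>Dividing \<kappa> by \<open>f\<close> gives a scalar, and \<open>f\<close>
      returns in the vector density f v. The factor -2/s comes from the pointwise identity, and the
      positive shift of \<open>N\<close> keeps \<open>K\<close> smooth where N = 0.\<close>
    define K where "K c x = - 2 * (\<kappa> c x / f c x) / (s c x * (N c x + inverse (real (Suc n))))" for c x
    have scK: "scalar_field A K"
      unfolding K_def by (intro scalar_mult scalar_divide scalar_const scalar_add scalars scalar_density_quotient density_\<kappa> density_f)
    have nz: "s c x * (N c x + inverse (real (Suc n))) \<noteq> 0" if "c \<in> A" "x \<in> cimg c" for c x
      using Npos[OF that, of n] chart_forms.s_pos[OF forms[OF that(1)] that(2)] by simp
    have smK: "smooth_field A K"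
      unfolding smooth_field_def K_def
      by (intro ballI smooth_on_divide smooth_intros smooth_on_fields) (use nz f_nz in auto)
    have eq: "(if M c x = 0 then K c x * (grad (cimg c) (M c) x \<bullet> (f c x *\<^sub>R v c x)) else 0) = r n c x"
      if "c \<in> A" "x \<in> cimg c" for c x
    proof (cases "M c x = 0")
      case True
      have id: "N c x * (a\<kappa> c x + along_w m c x) = - 2 * \<kappa> c x * (grad (cimg c) (M c) x \<bullet> v c x) / s c x"
        unfolding a\<kappa>_def by (rule chart_flow.second_order_identity[OF chart[OF that(1)] that(2) True])
      have "K c x * (grad (cimg c) (M c) x \<bullet> (f c x *\<^sub>R v c x))
          = (- 2 * \<kappa> c x * (grad (cimg c) (M c) x \<bullet> v c x) / s c x) / (N c x + inverse (real (Suc n)))"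
        using f_nz[OF that] by (simp add: K_def)
      then have "K c x * (grad (cimg c) (M c) x \<bullet> (f c x *\<^sub>R v c x))
          = N c x * (a\<kappa> c x + along_w m c x) / (N c x + inverse (real (Suc n)))"
        unfolding id .
      then show ?thesis using True by (simp add: r_def)
    qed (simp add: r_def)
    show "locally_integrable (r n)" "I (r n) = 0"
      using I_zero_M_along_v[OF scK smK] locally_integrable_cong[OF eq] I_cong[OF eq] by auto
  qed
  have b1: "continuous_on (cimg c) (\<lambda>x. \<bar>a\<kappa> c x + along_w m c x\<bar>)" if "c \<in> F" for c
    by (intro continuous_intros continuous_of_smooth[OF smooth_along_w[OF smooth_fields(3)] that] continuous_of_smooth[OF smooth_a\<kappa> that])
  have b2: "\<bar>r n c x\<bar> \<le> \<bar>a\<kappa> c x + along_w m c x\<bar>" if "c \<in> F" "x \<in> cimg c" for n c x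
    using mult_right_mono[OF quotient_tendsto_indicator(2)[of "N c x" 1 n], of "\<bar>a\<kappa> c x + along_w m c x\<bar>"]
      chart_flow.N_nonneg[OF chart[OF FA[OF that(1)]] that(2)]
    by (cases "M c x = 0") (simp_all only: r_def abs_mult if_True if_False abs_zero abs_ge_zero simp_thms mult_1 zero_le_one)
  have b3: "(\<lambda>n. r n c x) \<longlonglongrightarrow> ?r c x" if "c \<in> F" "x \<in> cimg c" for c x
  proof (cases "N c x = 0")
    case True
    have w: "w c x = 0" "\<alpha> c x = 0"
      using True chart_flow.N_zero[OF chart[OF FA[OF that(1)]] that(2)] chart_forms.\<alpha>_zero[OF forms[OF FA[OF that(1)]] that(2)] by auto
    then have "a\<kappa> c x + along_w m c x = 0"
      using chart_forms.\<kappa>_eq[OF forms[OF FA[OF that(1)]] that(2)] by (simp add: a\<kappa>_def)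
    then show ?thesis by (simp add: r_def)
  next
    case False
    have "(\<lambda>n. N c x / (N c x + inverse (real (Suc n)) * 1) * (a\<kappa> c x + along_w m c x)) \<longlonglongrightarrow> 1 * (a\<kappa> c x + along_w m c x)"
      using quotient_tendsto_indicator(1)[of "N c x" 1] False chart_flow.N_nonneg[OF chart[OF FA[OF that(1)]] that(2)]
      by (intro tendsto_mult tendsto_const) auto
    then show ?thesis by (simp add: r_def)
  qed
  note lim = I_dominated_convergence[where r=r and r'="?r" and B="\<lambda>c x. \<bar>a\<kappa> c x + along_w m c x\<bar>", OF rn(1) b1 b2 b3]
  show "locally_integrable ?r" using lim(1) by simp
  have "(\<lambda>n. I (r n)) \<longlonglongrightarrow> I ?r" using lim(2) by simp
  then show "I ?r = 0" unfolding rn(2) by (simp add: LIMSEQ_const_iff)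
qed

theorem I_a\<kappa>: "I (\<lambda>c x. a c x * \<kappa> c x) = 0"
proof -
  let ?r1 = "\<lambda>c x. if M c x = 0 then 0 else a\<kappa> c x"
  let ?r2 = "\<lambda>c x. if M c x = 0 then along_w m c x else 0"
  let ?r3 = "\<lambda>c x. if M c x = 0 then a\<kappa> c x + along_w m c x else 0"
  have "I (\<lambda>c x. (?r1 c x + ?r3 c x) - ?r2 c x) = 0"
    using I_nonzero_M I_zero_M_along_w I_zero_M by (simp add: I_diff I_add locally_integrable_add)
  moreover have "(\<lambda>c x. (?r1 c x + ?r3 c x) - ?r2 c x) = (\<lambda>c x. a c x * \<kappa> c x)"
    by (auto simp: fun_eq_iff a\<kappa>_def)
  ultimately show ?thesis by simp
qed

end

section \<open>Smooth families of fields\<close>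

definition dt :: "(real \<Rightarrow> ('a, 'b::real_normed_vector) field) \<Rightarrow> real \<Rightarrow> ('a, 'b) field" where
  "dt f t c x = vector_derivative (\<lambda>s. f s c x) (at t)"

locale timed_3manifold = compact_3manifold X A for X :: "'a topology" and A :: "'a chart set" +
  fixes T :: "real set"
  assumes open_T: "open T"
begin

lemma smooth_family_iff:
  "smooth_family T A f \<longleftrightarrow> (\<forall>c\<in>A. smooth_on (Sigma T (\<lambda>_. cimg c)) (\<lambda>z. f (fst z) c (snd z)))"
  by (simp add: smooth_family_def case_prod_unfold)

context
  fixes f g :: "real \<Rightarrow> ('a, real) field" and a b :: "real \<Rightarrow> ('a, R3) field"
begin

lemma smooth_family_const: "smooth_family T A (\<lambda>t c x. k)"
  by (simp add: smooth_family_iff smooth_on_const)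

lemma smooth_family_add: "smooth_family T A f \<Longrightarrow> smooth_family T A g \<Longrightarrow> smooth_family T A (\<lambda>t c x. f t c x + g t c x)"
  and smooth_family_diff: "smooth_family T A f \<Longrightarrow> smooth_family T A g \<Longrightarrow> smooth_family T A (\<lambda>t c x. f t c x - g t c x)"
  and smooth_family_mult: "smooth_family T A f \<Longrightarrow> smooth_family T A g \<Longrightarrow> smooth_family T A (\<lambda>t c x. f t c x * g t c x)"
  and smooth_family_minus: "smooth_family T A f \<Longrightarrow> smooth_family T A (\<lambda>t c x. - f t c x)"
  and smooth_family_scaleR: "smooth_family T A f \<Longrightarrow> smooth_family T A a \<Longrightarrow> smooth_family T A (\<lambda>t c x. f t c x *\<^sub>R a t c x)"
  and smooth_family_nth: "smooth_family T A a \<Longrightarrow> smooth_family T A (\<lambda>t c x. a t c x $ i)"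
  by (auto simp: smooth_family_iff intro!: smooth_intros)

lemma smooth_family_inner: "smooth_family T A a \<Longrightarrow> smooth_family T A b \<Longrightarrow> smooth_family T A (\<lambda>t c x. a t c x \<bullet> b t c x)"
  by (auto simp: smooth_family_iff intro!: smooth_on_bilinear[OF bounded_bilinear_inner])

lemma smooth_family_divide:
  assumes "smooth_family T A f" "smooth_family T A g" "\<And>t c x. t \<in> T \<Longrightarrow> c \<in> A \<Longrightarrow> x \<in> cimg c \<Longrightarrow> g t c x \<noteq> 0"
  shows "smooth_family T A (\<lambda>t c x. f t c x / g t c x)"
  using assms by (auto simp: smooth_family_iff intro!: smooth_on_divide)

lemma smooth_family_vec: "(\<And>i. smooth_family T A (\<lambda>t c x. a t c x $ i)) \<Longrightarrow> smooth_family T A a"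
  unfolding smooth_family_iff by (intro ballI smooth_on_vec) blast

lemma smooth_family_cross:
  assumes "smooth_family T A a" "smooth_family T A b"
  shows "smooth_family T A (\<lambda>t c x. a t c x \<times> b t c x)"
  unfolding smooth_family_iff
proof (intro ballI smooth_on_vec)
  fix c and i :: 3 assume "c \<in> A"
  let ?S = "Sigma T (\<lambda>_. cimg c)"
  have "smooth_on ?S (\<lambda>z. a (fst z) c (snd z))" "smooth_on ?S (\<lambda>z. b (fst z) c (snd z))"
    using assms \<open>c \<in> A\<close> by (auto simp: smooth_family_iff)
  then have "smooth_on ?S (\<lambda>z. a (fst z) c (snd z) $ i * b (fst z) c (snd z) $ j - b (fst z) c (snd z) $ k * a (fst z) c (snd z) $ l)"
    "smooth_on ?S (\<lambda>z. a (fst z) c (snd z) $ i * b (fst z) c (snd z) $ j - a (fst z) c (snd z) $ k * b (fst z) c (snd z) $ l)" for i j k l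
    by (auto intro!: smooth_intros)
  then show "smooth_on ?S (\<lambda>z. (a (fst z) c (snd z) \<times> b (fst z) c (snd z)) $ i)"
    using exhaust_3[of i] by (auto simp: cross_components)
qed

end

lemma smooth_family_cong:
  assumes "\<And>t c x. t \<in> T \<Longrightarrow> c \<in> A \<Longrightarrow> x \<in> cimg c \<Longrightarrow> f t c x = g t c x"
  shows "smooth_family T A f \<longleftrightarrow> smooth_family T A g"
  unfolding smooth_family_iff using assms by (intro ball_cong refl smooth_on_cong) auto

lemma smooth_family_sum:
  "(\<And>i. i \<in> J \<Longrightarrow> smooth_family T A (f i)) \<Longrightarrow> smooth_family T A (\<lambda>t c x. \<Sum>i\<in>J. f i t c x)"
  by (auto simp: smooth_family_iff intro!: smooth_on_sum)

lemma smooth_familyD: "smooth_family T A f \<Longrightarrow> c \<in> A \<Longrightarrow> smooth_on (Sigma T (\<lambda>_. cimg c)) (\<lambda>(t, x). f t c x)"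
  by (simp add: smooth_family_def)

context
  fixes f :: "real \<Rightarrow> ('a, 'b::euclidean_space) field"
  assumes f: "smooth_family T A f"
begin

lemma smooth_family_slice: "t \<in> T \<Longrightarrow> smooth_field A (f t)"
  unfolding smooth_field_def
proof
  fix c assume "t \<in> T" "c \<in> A"
  then show "smooth_on (cimg c) (f t c)"
    using family_slice[where f="\<lambda>t. f t c", OF open_T fat_cimg smooth_familyD[OF f]] by blast
qed

lemma smooth_family_partial: "smooth_family T A (\<lambda>t c x. partial (cimg c) i (f t c) x)"
  unfolding smooth_family_def
proof
  fix c assume "c \<in> A"
  then show "smooth_on (Sigma T (\<lambda>_. cimg c)) (\<lambda>(t, x). partial (cimg c) i (f t c) x)"
    unfolding partial_def using family_D_smooth[where f="\<lambda>t. f t c", OF open_T fat_cimg smooth_familyD[OF f]] by blast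
qed

lemma smooth_family_dt: "smooth_family T A (dt f)"
  unfolding smooth_family_def dt_def
proof
  fix c assume "c \<in> A"
  then show "smooth_on (Sigma T (\<lambda>_. cimg c)) (\<lambda>(t, x). vector_derivative (\<lambda>s. f s c x) (at t))"
    using family_dt_smooth[where f="\<lambda>t. f t c", OF open_T fat_cimg smooth_familyD[OF f]] by blast
qed

lemma has_dt: "t \<in> T \<Longrightarrow> c \<in> A \<Longrightarrow> x \<in> cimg c \<Longrightarrow> ((\<lambda>s. f s c x) has_vector_derivative dt f t c x) (at t)"
  unfolding dt_def using family_has_vector_derivative[where f="\<lambda>t. f t c", OF open_T fat_cimg smooth_familyD[OF f]] by blast

lemma dt_partial: "t \<in> T \<Longrightarrow> c \<in> A \<Longrightarrow> x \<in> cimg c \<Longrightarrow>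
    dt (\<lambda>t c x. partial (cimg c) i (f t c) x) t c x = partial (cimg c) i (dt f t c) x"
  unfolding dt_def[abs_def] partial_def
  using family_commute[where f="\<lambda>t. f t c", OF open_T fat_cimg smooth_familyD[OF f]] by blast

end

lemma dt_eqI: "((\<lambda>s. f s c x) has_vector_derivative d) (at t) \<Longrightarrow> dt f t c x = d"
  unfolding dt_def by (rule vector_derivative_at)

lemma smooth_family_grad:
  assumes "smooth_family T A f"
  shows "smooth_family T A (\<lambda>t c. grad (cimg c) (f t c))"
  by (rule smooth_family_vec) (use smooth_family_partial[OF assms] in simp)

lemma smooth_family_rot:
  assumes "smooth_family T A a"
  shows "smooth_family T A (\<lambda>t c. rot (cimg c) (a t c))"
proof (rule smooth_family_vec)
  fix i :: 3
  have "smooth_family T A (\<lambda>t c x. partial (cimg c) i (\<lambda>y. a t c y $ j) x - partial (cimg c) k (\<lambda>y. a t c y $ l) x)" for i j k l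
    by (intro smooth_family_diff smooth_family_partial smooth_family_nth assms)
  then show "smooth_family T A (\<lambda>t c x. rot (cimg c) (a t c) x $ i)" using exhaust_3[of i] by auto
qed

lemma dt_nth:
  fixes a :: "real \<Rightarrow> ('a, R3) field"
  assumes "smooth_family T A a" "t \<in> T" "c \<in> A" "x \<in> cimg c"
  shows "dt (\<lambda>t c x. a t c x $ i) t c x = dt a t c x $ i"
  by (rule dt_eqI, rule bounded_linear.has_vector_derivative[OF bounded_linear_vec_nth has_dt[OF assms]])

lemma dt_rot:
  assumes a: "smooth_family T A a" and "t \<in> T" "c \<in> A" "x \<in> cimg c"
  shows "dt (\<lambda>t c. rot (cimg c) (a t c)) t c x = rot (cimg c) (dt a t c) x"
proof -
  note tcx = assms(2-4)
  have p: "dt (\<lambda>t c x. partial (cimg c) i (\<lambda>y. a t c y $ j) x) t c x = partial (cimg c) i (\<lambda>y. dt a t c y $ j) x" for i j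
  proof -
    have "dt (\<lambda>t c x. partial (cimg c) i (\<lambda>y. a t c y $ j) x) t c x = partial (cimg c) i (dt (\<lambda>t c x. a t c x $ j) t c) x"
      by (rule dt_partial[OF smooth_family_nth[OF a] tcx])
    also have "\<dots> = partial (cimg c) i (\<lambda>y. dt a t c y $ j) x"
      by (rule partial_cong[OF dt_nth[OF a] tcx(3)]) (use tcx in auto)
    finally show ?thesis .
  qed
  have d: "dt (\<lambda>t c x. partial (cimg c) i (\<lambda>y. a t c y $ j) x - partial (cimg c) k (\<lambda>y. a t c y $ l) x) t c x
      = partial (cimg c) i (\<lambda>y. dt a t c y $ j) x - partial (cimg c) k (\<lambda>y. dt a t c y $ l) x" for i j k l
    using has_vector_derivative_diff[OF has_dt[OF smooth_family_partial[OF smooth_family_nth[OF a]] tcx]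
        has_dt[OF smooth_family_partial[OF smooth_family_nth[OF a]] tcx], of i j k l]
    by (intro dt_eqI) (simp add: p)
  have n: "dt (\<lambda>t c. rot (cimg c) (a t c)) t c x $ i = dt (\<lambda>t c x. rot (cimg c) (a t c) x $ i) t c x" for i
    by (rule dt_nth[OF smooth_family_rot[OF a] tcx, symmetric])
  show ?thesis unfolding vec_eq_iff forall_3 n rot_nth d by simp
qed

text \<open>The transition maps do not depend on time, so the transformation law, valid for all
  times in the open set \<open>T\<close>, can be differentiated.\<close>

lemma covector_dt:
  assumes a: "smooth_family T A a" and cov: "\<And>t. t \<in> T \<Longrightarrow> covector_field A (a t)" and t: "t \<in> T"
  shows "covector_field A (dt a t)"
  unfolding covector_field_def
proof (intro ballI allI)
  fix c d x u assume *: "c \<in> A" "d \<in> A" "x \<in> overlap c d"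
  have x: "x \<in> cimg c" using * overlap_subset by blast
  have "((\<lambda>s. a s c x \<bullet> u) has_vector_derivative dt a t c x \<bullet> u) (at t)"
    by (rule bounded_linear.has_vector_derivative[OF bounded_linear_inner_left has_dt[OF a t *(1) x]])
  moreover have "((\<lambda>s. a s d (trans_map c d x) \<bullet> jac c d x u) has_vector_derivative dt a t d (trans_map c d x) \<bullet> jac c d x u) (at t)"
    by (rule bounded_linear.has_vector_derivative[OF bounded_linear_inner_left has_dt[OF a t *(2) trans_in_cimg[OF *]]])
  then have "((\<lambda>s. a s c x \<bullet> u) has_vector_derivative dt a t d (trans_map c d x) \<bullet> jac c d x u) (at t)"
    by (rule has_vector_derivative_transform_within_open[OF _ open_T t]) (simp add: covector_fieldD[OF cov *])
  ultimately show "dt a t c x \<bullet> u = dt a t d (trans_map c d x) \<bullet> jac c d x u"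
    by (rule vector_derivative_unique_at)
qed

text \<open>Multiplied by a partition function and extended by zero, the integrand is continuous on
  a fixed box that contains the support, so differentiation under the integral over a box
  applies.\<close>

lemma Leibniz:
  assumes pou: "partition_of_unity X A F \<phi>" and r: "smooth_family T A r" and t: "t \<in> T"
  shows "((\<lambda>s. pou_integral F \<phi> (r s)) has_real_derivative pou_integral F \<phi> (dt r t)) (at t)"
  unfolding pou_integral_def
proof (rule DERIV_sum)
  fix c assume c: "c \<in> F"
  then have cA: "c \<in> A" using pou_subset[OF pou] by blast
  define K where "K = crd c ` supp (\<phi> c)"
  have K: "compact K" "K \<subseteq> cimg c"
    unfolding K_def using compact_image_support[OF cA closedin_supp pou_supp[OF pou c]] by auto
  obtain R where R: "\<And>x. x \<in> K \<Longrightarrow> norm x \<le> R" using compact_imp_bounded[OF K(1)] unfolding bounded_iff by blast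
  \<comment> \<open>The first coordinate of the box starts at 0, so the box stays in the half-space.
    Beyond the boundary an extension by zero could jump, as the partition functions need not vanish
    at boundary points.\<close>
  define lo hi :: R3 where "lo = (\<chi> i. if i = 1 then 0 else - R)" and "hi = (\<chi> i. R)"
  let ?B = "cbox lo hi"
  have KB: "K \<subseteq> ?B"
  proof
    fix x assume x: "x \<in> K"
    then have "x $ 1 \<ge> 0" using K(2) openin_imp_subset[OF openin_cimg[OF cA]] by (auto simp: half_space_def)
    moreover have "\<bar>x $ i\<bar> \<le> R" for i using component_le_norm_cart[of x i] R[OF x] by linarith
    ultimately show "x \<in> ?B" unfolding mem_box_cart lo_def hi_def by (auto simp: abs_le_iff minus_le_iff)
  qed
  have Bh: "?B \<subseteq> half_space"
  proof
    fix x assume "x \<in> ?B"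
    then have "lo $ 1 \<le> x $ 1" by (simp add: mem_box_cart)
    then show "x \<in> half_space" by (simp add: lo_def half_space_def)
  qed
  have zero: "\<phi> c (cinv c x) = 0" if "x \<in> cimg c" "x \<notin> K" for x
    using that not_in_supp[OF cinv_topspace[OF cA that(1)]] crd_cinv[OF that(1)] by (metis K_def image_eqI)
  define z where "z q x = (if x \<in> cimg c then \<phi> c (cinv c x) * q x else 0)" for q x
  have int: "integral (cimg c) (\<lambda>x. \<phi> c (cinv c x) * q x) = integral ?B (z q)" if "continuous_on (cimg c) q" for q
  proof -
    have "continuous_on K (\<lambda>x. \<phi> c (cinv c x) * q x)"
      by (rule continuous_on_subset[OF continuous_on_mult[OF pou_continuous[OF pou c cA] that] K(2)])
    moreover from this have "continuous_on K (z q)"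
      by (rule continuous_on_cong[THEN iffD1, rotated 2]) (use K(2) in \<open>auto simp: z_def\<close>)
    moreover have "z q x = 0" if "x \<in> ?B" "x \<notin> K" for x using zero that by (simp add: z_def)
    moreover have "(LINT x|lborel. indicator K x * z q x) = (LINT x|lborel. indicator K x * (\<phi> c (cinv c x) * q x))"
      using K(2) by (intro Bochner_Integration.integral_cong) (auto simp: z_def indicator_def)
    ultimately show ?thesis
      using compact_support_integral[OF K, of "\<lambda>x. \<phi> c (cinv c x) * q x"] compact_support_integral[OF K(1) KB, of "z q"] zero
      by simp
  qed
  have cont: "continuous_on (Sigma T (\<lambda>_. ?B)) (\<lambda>(s, x). z (q s) x)"
    if q: "continuous_on (Sigma T (\<lambda>_. cimg c)) (\<lambda>(s, x). q s x)" for q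
  proof -
    obtain U where U: "open U" "cimg c = half_space \<inter> U" using openin_cimg[OF cA] by (auto simp: openin_open)
    \<comment> \<open>Two relatively open pieces cover the box: one inside the chart image, where
      the product formula holds, the other off the compact support, where the extension is
      zero.\<close>
    let ?S1 = "Sigma T (\<lambda>_. ?B \<inter> U)" and ?S2 = "Sigma T (\<lambda>_. ?B - K)"
    have un: "Sigma T (\<lambda>_. ?B) = ?S1 \<union> ?S2" using K(2) U(2) by auto
    have "?S1 = Sigma T (\<lambda>_. ?B) \<inter> Sigma UNIV (\<lambda>_. U)" "?S2 = Sigma T (\<lambda>_. ?B) \<inter> Sigma UNIV (\<lambda>_. - K)" by auto
    then have op: "openin (top_of_set (?S1 \<union> ?S2)) ?S1" "openin (top_of_set (?S1 \<union> ?S2)) ?S2"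
      unfolding un[symmetric] using U(1) K(1) by (auto intro!: openin_open_Int open_Times simp: compact_imp_closed open_Compl)
    have sub: "?S1 \<subseteq> Sigma T (\<lambda>_. cimg c)" using U(2) Bh by auto
    have "continuous_on ?S1 (\<lambda>(s, x). \<phi> c (cinv c x) * q s x)"
    proof -
      have "continuous_on (Sigma T (\<lambda>_. cimg c)) (\<lambda>z. \<phi> c (cinv c (snd z)))"
        by (rule continuous_on_compose2[OF pou_continuous[OF pou c cA] continuous_on_snd[OF continuous_on_id]]) auto
      from continuous_on_mult[OF this q] show ?thesis
        using continuous_on_subset[OF _ sub] by (simp add: split_beta)
    qed
    then have "continuous_on ?S1 (\<lambda>(s, x). z (q s) x)"
      by (rule continuous_on_cong[THEN iffD1, rotated 2]) (use sub in \<open>auto simp: z_def\<close>)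
    moreover have "continuous_on ?S2 (\<lambda>(s, x). z (q s) x)"
      by (rule continuous_on_cong[THEN iffD1, rotated 2, OF continuous_on_const[of _ 0]]) (auto simp: z_def zero)
    ultimately show ?thesis unfolding un by (rule continuous_on_Un_local_open[OF op])
  qed
  have cr: "continuous_on (Sigma T (\<lambda>_. cimg c)) (\<lambda>(s, x). r s c x)" "continuous_on (Sigma T (\<lambda>_. cimg c)) (\<lambda>(s, x). dt r s c x)"
    using smooth_familyD[OF r cA] smooth_familyD[OF smooth_family_dt[OF r] cA] by (auto intro: smooth_on_imp_continuous_on)
  have slice: "continuous_on (cimg c) (r s c)" "continuous_on (cimg c) (dt r s c)" if "s \<in> T" for s
    using smooth_family_slice[OF r that] smooth_family_slice[OF smooth_family_dt[OF r] that] cA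
    by (auto simp: smooth_field_def intro: smooth_on_imp_continuous_on)
  obtain e where e: "e > 0" "ball t e \<subseteq> T" using open_T t openE by metis
  have "((\<lambda>s. integral ?B (z (r s c))) has_field_derivative integral ?B (z (dt r t c))) (at t within ball t e)"
  proof (rule leibniz_rule_field_derivative[where fx="\<lambda>s. z (dt r s c)"])
    fix s x assume s: "s \<in> ball t e"
    show "((\<lambda>s. z (r s c) x) has_field_derivative z (dt r s c) x) (at s within ball t e)"
    proof (cases "x \<in> cimg c")
      case True
      have "((\<lambda>s. r s c x) has_field_derivative dt r s c x) (at s)"
        using has_dt[OF r _ cA True] s e(2) by (auto simp: has_real_derivative_iff_has_vector_derivative)
      from has_field_derivative_at_within[OF DERIV_cmult[OF this, of "\<phi> c (cinv c x)"]]
      show ?thesis using True by (simp add: z_def)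
    qed (simp add: z_def)
  next
    fix s assume s: "s \<in> ball t e"
    then have "s \<in> T" using e by auto
    moreover have "continuous_on ?B (Pair s)" by (intro continuous_intros)
    ultimately have "continuous_on ?B (z (r s c))"
      using continuous_on_compose2[OF cont[OF cr(1)], of ?B "\<lambda>x. (s, x)"] by auto
    then show "z (r s c) integrable_on ?B" by (rule integrable_continuous)
  next
    show "continuous_on (Sigma (ball t e) (\<lambda>_. ?B)) (\<lambda>(s, x). z (dt r s c) x)"
      by (rule continuous_on_subset[OF cont[OF cr(2)]]) (use e in auto)
  qed (use e in auto)
  then have "((\<lambda>s. integral ?B (z (r s c))) has_field_derivative integral ?B (z (dt r t c))) (at t)"
    using at_within_open[of t "ball t e"] e(1) by simp
  then have "((\<lambda>s. integral (cimg c) (\<lambda>x. \<phi> c (cinv c x) * r s c x)) has_field_derivative integral ?B (z (dt r t c))) (at t)"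
    by (rule has_field_derivative_transform_within_open[OF _ open_T t]) (simp add: int slice)
  then show "((\<lambda>s. integral (cimg c) (\<lambda>x. \<phi> c (cinv c x) * r s c x)) has_real_derivative
      integral (cimg c) (\<lambda>x. \<phi> c (cinv c x) * dt r t c x)) (at t)"
    by (simp add: int slice t)
qed

end

section \<open>Aristotelian fluids\<close>

lemma trilinear_alternating:
  assumes "trilinear \<rho>" "alternating3 \<rho>"
  shows "\<rho> a b e = \<rho> (axis 1 1) (axis 2 1) (axis 3 1) * (a \<bullet> (b \<times> e))"
proof -
  have l1: "linear (\<lambda>u. \<rho> u b e)" and l2: "linear (\<lambda>u. \<rho> a u e)" and l3: "linear (\<lambda>u. \<rho> a b u)" for a b e
    using assms(1) by (auto simp: trilinear_def)
  have z: "\<rho> a a b = 0" "\<rho> a b a = 0" "\<rho> b a a = 0" for a b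
    using assms(2) by (auto simp: alternating3_def)
  have s12: "\<rho> a b e = - \<rho> b a e" for a b e
  proof -
    have "\<rho> (a + b) (a + b) e = (\<rho> a a e + \<rho> a b e) + (\<rho> b a e + \<rho> b b e)"
      by (simp only: linear_add[OF l1] linear_add[OF l2])
    then show ?thesis using z by simp
  qed
  have s23: "\<rho> a b e = - \<rho> a e b" for a b e
  proof -
    have "\<rho> a (b + e) (b + e) = (\<rho> a b b + \<rho> a b e) + (\<rho> a e b + \<rho> a e e)"
      by (simp only: linear_add[OF l2] linear_add[OF l3])
    then show ?thesis using z by simp
  qed
  define r where "r = \<rho> (axis 1 1) (axis 2 1) (axis 3 1)"
  have c: "\<rho> (axis 2 1) (axis 3 1) (axis 1 1) = r" "\<rho> (axis 3 1) (axis 1 1) (axis 2 1) = r"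
    "\<rho> (axis 2 1) (axis 1 1) (axis 3 1) = - r" "\<rho> (axis 1 1) (axis 3 1) (axis 2 1) = - r"
    "\<rho> (axis 3 1) (axis 2 1) (axis 1 1) = - r"
    unfolding r_def by (metis s12 s23 minus_minus)+
  have L1: "\<rho> a b e = a $ 1 * \<rho> (axis 1 1) b e + a $ 2 * \<rho> (axis 2 1) b e + a $ 3 * \<rho> (axis 3 1) b e"
    using linear_R3[OF l1, of a b e] by simp
  have L2: "\<rho> (axis i 1) b e = b $ 1 * \<rho> (axis i 1) (axis 1 1) e + b $ 2 * \<rho> (axis i 1) (axis 2 1) e + b $ 3 * \<rho> (axis i 1) (axis 3 1) e" for i
    using linear_R3[OF l2, of "axis i 1" b e] by simp
  have L3: "\<rho> (axis i 1) (axis j 1) e = e $ 1 * \<rho> (axis i 1) (axis j 1) (axis 1 1) + e $ 2 * \<rho> (axis i 1) (axis j 1) (axis 2 1) + e $ 3 * \<rho> (axis i 1) (axis j 1) (axis 3 1)" for i j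
    using linear_R3[OF l3, of "axis i 1" "axis j 1" e] by simp
  show ?thesis
    by (simp add: L1 L2 L3 z c r_def[symmetric] inner_vec_def sum_3 cross_components algebra_simps)
qed

text \<open>With a two-form written as its pairing with cross products, this is the wedge product of
  a one-form and a two-form. It reflects the linear dependence of \<open>y\<close>,
  \<open>a\<close>, \<open>b\<close>, \<open>e\<close> in three dimensions, as in Cramer's
  rule.\<close>

lemma wedge12_inner_cross:
  "(a0 \<bullet> a) * (y \<bullet> (b \<times> e)) + (a0 \<bullet> b) * (y \<bullet> (e \<times> a)) + (a0 \<bullet> e) * (y \<bullet> (a \<times> b)) = (a0 \<bullet> y) * (a \<bullet> (b \<times> e))"
  for a0 y a b e :: R3
  by (simp add: cross3_simps)

lemma D_inner:
  assumes "fat C" "smooth_on C a" "x \<in> C" "\<And>y. y \<in> C \<Longrightarrow> q y = a y \<bullet> w"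
  shows "D C q x u = D C a x u \<bullet> w"
proof -
  have "D C q x u = D C (\<lambda>y. a y \<bullet> w) x u"
    by (rule fun_cong[OF frechet_derivative_within_cong]) (use assms in auto)
  then show ?thesis by (simp add: frechet_bounded_linear[OF bounded_linear_inner_left assms(1-3)])
qed

lemma ext_deriv1_rot:
  assumes C: "fat C" "smooth_on C a" "x \<in> C" and eq: "\<And>y u. y \<in> C \<Longrightarrow> \<omega> y u = a y \<bullet> u"
  shows "ext_deriv1 C \<omega> x u w = rot C a x \<bullet> (u \<times> w)"
  unfolding ext_deriv1_def rot_inner_cross[OF C]
  using D_inner[OF C, of "\<lambda>y. \<omega> y w" w u] D_inner[OF C, of "\<lambda>y. \<omega> y u" u w] eq by simp

lemma wedge12_density:
  assumes C: "fat C" "smooth_on C a" "smooth_on C b" "x \<in> C"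
    and eq: "\<And>y u. y \<in> C \<Longrightarrow> \<omega> y u = a y \<bullet> u" "\<And>y u. y \<in> C \<Longrightarrow> \<sigma> y u = b y \<bullet> u"
  shows "wedge12 \<omega> (ext_deriv1 C \<sigma>) x u w z = (a x \<bullet> rot C b x) * (u \<bullet> (w \<times> z))"
proof -
  have "ext_deriv1 C \<sigma> x u w = rot C b x \<bullet> (u \<times> w)" for u w
    by (rule ext_deriv1_rot[OF C(1,3,4)]) (simp add: eq)
  then show ?thesis unfolding wedge12_def by (simp only: eq(1)[OF C(4)] wedge12_inner_cross)
qed

text \<open>For a three-form the Lie derivative is the exterior derivative of the contraction with
  \<open>v\<close>. In coordinates, the three terms that differentiate \<open>v\<close> add up to
  the trace of its derivative.\<close>

lemma lie3_divg:
  assumes C: "fat C" "smooth_on C r" "smooth_on C v" "x \<in> C"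
    and eq: "\<And>y a b e. y \<in> C \<Longrightarrow> \<rho> y a b e = r y * (a \<bullet> (b \<times> e))"
  shows "lie3 C v \<rho> x (axis 1 1) (axis 2 1) (axis 3 1) = divg C (\<lambda>y. r y *\<^sub>R v y) x"
proof -
  have "D C (\<lambda>y. \<rho> y (axis 1 1) (axis 2 1) (axis 3 1)) x (v x) = D C r x (v x)"
    by (rule fun_cong[OF frechet_derivative_within_cong]) (use C in \<open>auto simp: eq cross_basis inner_axis\<close>)
  also have "\<dots> = grad C r x \<bullet> v x" by (simp add: grad_inner C)
  finally have 1: "D C (\<lambda>y. \<rho> y (axis 1 1) (axis 2 1) (axis 3 1)) x (v x) = grad C r x \<bullet> v x" .
  have ax: "(axis i 1 :: R3) $ j = (if i = j then 1 else 0)" for i j by (auto simp: axis_def)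
  have 2: "divg C v x = D C v x (axis 1 1) $ 1 + D C v x (axis 2 1) $ 2 + D C v x (axis 3 1) $ 3"
    by (simp add: divg_def sum_3 partial_component[OF C(1,3,4)])
  show ?thesis
    unfolding lie3_def divg_scaleR[OF C] 1 2
    by (simp add: eq C(4) inner_vec_def sum_3 cross_components ax algebra_simps)
qed

text \<open>Positive definiteness makes lowering the index injective, hence bijective by dimension.
  This gives meaning to the definite descriptions behind both \<open>sharp\<close> and
  \<open>christoffel\<close>.\<close>

lemma sharp_eq:
  assumes "bilinear b" "\<And>u. u \<noteq> 0 \<Longrightarrow> b u u > 0" "linear \<theta>"
  shows "\<exists>!w. \<forall>u. b w u = \<theta> u" "b (sharp b \<theta>) u = \<theta> u"
proof -
  have l1: "linear (\<lambda>w. b w u)" and l2: "linear (b w)" for u w using assms(1) by (auto simp: bilinear_def)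
  define L where "L w = (\<chi> i. b w (axis i 1))" for w
  have "linear L"
    unfolding L_def by (rule linearI) (simp_all add: vec_eq_iff linear_add[OF l1] linear_cmul[OF l1])
  have ext: "b w u = \<theta>' u" if "linear \<theta>'" "\<And>i. b w (axis i 1) = \<theta>' (axis i 1)" for w u \<theta>'
    using linear_R3[OF l2, of w u] linear_R3[OF that(1), of u] that(2) by simp
  have inj: "inj L"
  proof (rule linear_injective_0[THEN iffD2, OF \<open>linear L\<close>], intro allI impI)
    fix w assume "L w = 0"
    then have "b w (axis i 1) = 0" for i by (simp add: L_def vec_eq_iff)
    then have "b w w = 0" using ext[of "\<lambda>_. 0" w w] by (simp add: linear_zero)
    then show "w = 0" using assms(2)[of w] by force
  qed
  then have "surj L" using \<open>linear L\<close> linear_injective_imp_surjective by blast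
  then obtain w where "L w = (\<chi> i. \<theta> (axis i 1))" by (metis surjD)
  then have "b w (axis i 1) = \<theta> (axis i 1)" for i by (simp add: L_def vec_eq_iff)
  then have w: "\<forall>u. b w u = \<theta> u" using ext[OF assms(3)] by blast
  moreover have "w' = w" if "\<forall>u. b w' u = \<theta> u" for w'
    using inj w that by (auto simp: L_def inj_def)
  ultimately show ex: "\<exists>!w. \<forall>u. b w u = \<theta> u" by blast
  show "b (sharp b \<theta>) u = \<theta> u" unfolding sharp_def using theI'[OF ex] by blast
qed

locale aristotelian =
  fixes X :: "'a topology" and A :: "'a chart set" and T :: "real set"
    and \<mu> :: "('a, form3) field" and \<tau> :: "real \<Rightarrow> ('a, form1) field"
    and v :: "real \<Rightarrow> ('a, R3) field" and g :: "('a, form2) field"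
    and p :: "real \<Rightarrow> 'a \<Rightarrow> real"
    and h :: "real \<Rightarrow> ('a, form2) field"
    and \<gamma> :: "real \<Rightarrow> ('a, covector \<Rightarrow> covector \<Rightarrow> real) field"
  assumes compact: "compact_space X"
    and fluid: "aristotelian_fluid X A T \<mu> \<tau> v g p h \<gamma>"
    and curl_parallel: "mfd_boundary X A \<noteq> {} \<Longrightarrow> \<forall>t\<in>T. parallel_to_boundary A \<mu> (curl \<mu> g (v t))"
begin

lemma ideal: "ideal_fluid X A T \<mu> v g p"
  using fluid by (simp add: aristotelian_fluid_def)

sublocale timed_3manifold X A T
  using compact ideal by unfold_locales (auto simp: ideal_fluid_def)

lemma smooth_family_UNIV: "smooth_family UNIV A q \<Longrightarrow> smooth_family T A q"
  unfolding smooth_family_def by (meson Sigma_mono smooth_on_subset subset_refl top_greatest)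

lemma
  assumes "c \<in> A" "x \<in> cimg c"
  shows g_bilinear: "bilinear (g c x)" and g_sym: "g c x u w = g c x w u" and g_pos: "u \<noteq> 0 \<Longrightarrow> g c x u u > 0"
  using ideal assms by (auto simp: ideal_fluid_def riemannian_metric_def sym_cov2_family_def sym_bilinear_def)

lemma g_smooth: "smooth_family T A (\<lambda>_ c x. g c x u w)"
  using ideal by (intro smooth_family_UNIV) (auto simp: ideal_fluid_def riemannian_metric_def sym_cov2_family_def)

lemma g_transform: "c \<in> A \<Longrightarrow> d \<in> A \<Longrightarrow> x \<in> overlap c d \<Longrightarrow>
    g c x u w = g d (trans_map c d x) (jac c d x u) (jac c d x w)"
  using ideal by (auto simp: ideal_fluid_def riemannian_metric_def sym_cov2_family_def)

lemma g_linear: "c \<in> A \<Longrightarrow> x \<in> cimg c \<Longrightarrow> linear (g c x u)" "c \<in> A \<Longrightarrow> x \<in> cimg c \<Longrightarrow> linear (\<lambda>u. g c x u w)"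
  using g_bilinear by (auto simp: bilinear_def)

lemmas g_expand = bilinear_R3[OF g_bilinear]

lemma smooth_family_g:
  assumes "smooth_family T A a" "smooth_family T A b"
  shows "smooth_family T A (\<lambda>t c x. g c x (a t c x) (b t c x))"
  by (rule smooth_family_cong[THEN iffD1, OF g_expand[symmetric]])
    (auto intro!: smooth_family_sum smooth_family_mult smooth_family_nth g_smooth assms)

lemma v_smooth: "smooth_family T A v" and v_vector: "t \<in> T \<Longrightarrow> vector_field A (v t)"
  using ideal by (auto simp: ideal_fluid_def vector_family_def vector_field_def)

lemma p_smooth: "smooth_family T A (\<lambda>t c x. p t (cinv c x))"
  using ideal by (auto simp: ideal_fluid_def function_family_def)

definition f :: "('a, real) field" where "f c x = \<mu> c x (axis 1 1) (axis 2 1) (axis 3 1)"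
definition s :: "real \<Rightarrow> ('a, real) field" where "s t c x = g c x (v t c x) (v t c x)"
definition \<theta> :: "real \<Rightarrow> ('a, R3) field" where "\<theta> t c x = (\<chi> i. g c x (v t c x) (axis i 1))"
definition \<sigma> :: "real \<Rightarrow> ('a, R3) field" where "\<sigma> t c x = (\<chi> i. \<tau> t c x (axis i 1))"
definition w :: "real \<Rightarrow> ('a, R3) field" where "w t c = rot (cimg c) (\<theta> t c)"
definition \<alpha> :: "real \<Rightarrow> ('a, R3) field" where "\<alpha> t c x = (1 / s t c x) *\<^sub>R (w t c x \<times> v t c x)"
definition \<beta> :: "real \<Rightarrow> ('a, R3) field" where "\<beta> t c x = (1 / s t c x) *\<^sub>R (rot (cimg c) (\<alpha> t c) x \<times> v t c x)"
definition \<kappa> :: "real \<Rightarrow> ('a, real) field" where "\<kappa> t c x = \<alpha> t c x \<bullet> rot (cimg c) (\<alpha> t c) x"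
definition P :: "real \<Rightarrow> ('a, real) field" where "P t c x = s t c x * (1 / 2) - p t (cinv c x)"
definition a :: "real \<Rightarrow> ('a, real) field" where "a t c x = grad (cimg c) (P t c) x \<bullet> v t c x / s t c x"
definition m :: "real \<Rightarrow> ('a, real) field" where "m t c x = grad (cimg c) (a t c) x \<bullet> v t c x / s t c x"

lemma \<mu>_eq: "c \<in> A \<Longrightarrow> x \<in> cimg c \<Longrightarrow> \<mu> c x u y z = f c x * (u \<bullet> (y \<times> z))"
  unfolding f_def by (rule trilinear_alternating)
    (use ideal in \<open>auto simp: ideal_fluid_def volume_form_def form3_family_def\<close>)

lemma f_smooth: "smooth_family T A (\<lambda>_. f)"
  using ideal unfolding f_def[abs_def] by (intro smooth_family_UNIV) (auto simp: ideal_fluid_def volume_form_def form3_family_def)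

lemma f_nz: "c \<in> A \<Longrightarrow> x \<in> cimg c \<Longrightarrow> f c x \<noteq> 0"
proof -
  assume c: "c \<in> A" "x \<in> cimg c"
  then obtain u y z where "\<mu> c x u y z \<noteq> 0" using ideal by (force simp: ideal_fluid_def volume_form_def)
  then show ?thesis using \<mu>_eq[OF c] by auto
qed

lemma f_density: "density_field A f"
  unfolding density_field_def
proof (intro ballI)
  fix c d x assume *: "c \<in> A" "d \<in> A" "x \<in> overlap c d"
  have "f c x = \<mu> d (trans_map c d x) (jac c d x (axis 1 1)) (jac c d x (axis 2 1)) (jac c d x (axis 3 1))"
    unfolding f_def using ideal * by (auto simp: ideal_fluid_def volume_form_def form3_family_def)
  also have "\<dots> = f d (trans_map c d x) * det (matrix (jac c d x))"
    using jac_cross[OF *, of "axis 1 1" "axis 2 1" "axis 3 1"]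
    by (simp add: \<mu>_eq[OF *(2) trans_in_cimg[OF *]] cross_basis inner_axis)
  finally show "f c x = det (matrix (jac c d x)) * f d (trans_map c d x)" by simp
qed

lemma \<theta>_inner: "c \<in> A \<Longrightarrow> x \<in> cimg c \<Longrightarrow> \<theta> t c x \<bullet> u = g c x (v t c x) u"
  using linear_R3[OF g_linear(1), of c x "v t c x" u] by (simp add: \<theta>_def inner_vec_def sum_3 mult.commute)

lemma \<tau>_linear: "t \<in> T \<Longrightarrow> c \<in> A \<Longrightarrow> x \<in> cimg c \<Longrightarrow> linear (\<tau> t c x)"
  using fluid by (auto simp: aristotelian_fluid_def form1_family_def)

lemma \<sigma>_inner: "t \<in> T \<Longrightarrow> c \<in> A \<Longrightarrow> x \<in> cimg c \<Longrightarrow> \<tau> t c x u = \<sigma> t c x \<bullet> u"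
  using linear_R3[OF \<tau>_linear, of t c x u] by (simp add: \<sigma>_def inner_vec_def sum_3 mult.commute)

lemma \<sigma>_smooth: "smooth_family T A \<sigma>"
  by (rule smooth_family_vec) (use fluid in \<open>simp add: \<sigma>_def aristotelian_fluid_def form1_family_def\<close>)

lemma
  assumes "t \<in> T" "c \<in> A" "x \<in> cimg c"
  shows \<tau>v: "\<tau> t c x (v t c x) = 1" and ker_\<tau>: "\<tau> t c x u = 0 \<Longrightarrow> g c x (v t c x) u = 0"
    and \<tau>_integrable: "wedge12 (\<tau> t c) (ext_deriv1 (cimg c) (\<tau> t c)) x u y z = 0"
  using fluid assms by (auto simp: aristotelian_fluid_def)

lemma s_smooth: "smooth_family T A s"
  unfolding s_def[abs_def] by (intro smooth_family_g v_smooth)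

lemma s_pos: "t \<in> T \<Longrightarrow> c \<in> A \<Longrightarrow> x \<in> cimg c \<Longrightarrow> s t c x > 0"
  using \<tau>v[of t c x] \<tau>_linear[of t c x] g_pos[of c x "v t c x"] by (cases "v t c x = 0") (auto simp: s_def linear_0)

lemma \<theta>_smooth: "smooth_family T A \<theta>"
proof (rule smooth_family_vec)
  fix i
  have "smooth_family T A (\<lambda>t c x. axis i 1 :: R3)" by (simp add: smooth_family_iff smooth_on_const)
  from smooth_family_g[OF v_smooth this] show "smooth_family T A (\<lambda>t c x. \<theta> t c x $ i)" by (simp add: \<theta>_def)
qed

text \<open>The vector u - \<tau>(u) v lies in the kernel of \<tau> and is therefore orthogonal to
  \<open>v\<close>.\<close>

lemma \<theta>\<sigma>:
  assumes "t \<in> T" "c \<in> A" "x \<in> cimg c"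
  shows "\<theta> t c x = s t c x *\<^sub>R \<sigma> t c x"
proof (rule vector_eq_ldot[THEN iffD1], rule allI)
  fix u
  have l: "linear (g c x (v t c x))" by (rule g_linear(1)[OF assms(2,3)])
  have "\<tau> t c x (u - \<tau> t c x u *\<^sub>R v t c x) = 0"
    using \<tau>v[OF assms] by (simp add: linear_diff[OF \<tau>_linear[OF assms]] linear_cmul[OF \<tau>_linear[OF assms]])
  from ker_\<tau>[OF assms this] have "g c x (v t c x) u = \<tau> t c x u * s t c x"
    by (simp add: linear_diff[OF l] linear_cmul[OF l] s_def)
  then show "u \<bullet> \<theta> t c x = u \<bullet> (s t c x *\<^sub>R \<sigma> t c x)"
    by (simp add: inner_commute[of u] \<theta>_inner[OF assms(2,3)] \<sigma>_inner[OF assms])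
qed

lemma \<theta>v: "c \<in> A \<Longrightarrow> x \<in> cimg c \<Longrightarrow> \<theta> t c x \<bullet> v t c x = s t c x"
  by (simp add: \<theta>_inner s_def)

lemma slices:
  assumes "t \<in> T" "c \<in> A"
  shows "smooth_on (cimg c) (s t c)" "smooth_on (cimg c) (\<theta> t c)" "smooth_on (cimg c) (v t c)" "smooth_on (cimg c) (\<sigma> t c)"
    "smooth_on (cimg c) (\<lambda>x. p t (cinv c x))" "smooth_on (cimg c) (f c)" "smooth_on (cimg c) (\<lambda>x. g c x u y)"
  using smooth_family_slice[OF s_smooth assms(1)] smooth_family_slice[OF \<theta>_smooth assms(1)] smooth_family_slice[OF v_smooth assms(1)]
    smooth_family_slice[OF \<sigma>_smooth assms(1)] smooth_family_slice[OF p_smooth assms(1)] smooth_family_slice[OF f_smooth assms(1)]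
    smooth_family_slice[OF g_smooth assms(1)] assms(2) by (auto simp: smooth_field_def)

lemma w_\<sigma>:
  assumes "t \<in> T" "c \<in> A" "x \<in> cimg c"
  shows "w t c x = grad (cimg c) (s t c) x \<times> \<sigma> t c x + s t c x *\<^sub>R rot (cimg c) (\<sigma> t c) x"
proof -
  have "w t c x = rot (cimg c) (\<lambda>y. s t c y *\<^sub>R \<sigma> t c y) x"
    unfolding w_def by (rule rot_cong[OF \<theta>\<sigma>]) (use assms in auto)
  then show ?thesis using slices[OF assms(1,2)] by (simp add: rot_scaleR[OF fat_cimg[OF assms(2)]] assms)
qed

text \<open>Integrability is unaffected by rescaling the one-form: in \<theta> \<and> d\<theta> with
  \<theta> = s \<tau>, the term containing ds has \<tau> twice.\<close>

lemma \<theta>w: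
  assumes "t \<in> T" "c \<in> A" "x \<in> cimg c"
  shows "\<theta> t c x \<bullet> w t c x = 0"
proof -
  have "(\<sigma> t c x \<bullet> rot (cimg c) (\<sigma> t c) x) * (axis 1 1 \<bullet> (axis 2 1 \<times> axis 3 1)) = 0"
    using \<tau>_integrable[OF assms] slices[OF assms(1,2)] assms
      wedge12_density[OF fat_cimg[OF assms(2)], of "\<sigma> t c" "\<sigma> t c" x "\<tau> t c" "\<tau> t c"] \<sigma>_inner by metis
  then have "\<sigma> t c x \<bullet> rot (cimg c) (\<sigma> t c) x = 0" by (simp add: cross_basis inner_axis)
  then show ?thesis by (simp add: w_\<sigma>[OF assms] \<theta>\<sigma>[OF assms] inner_add_right dot_cross_self)
qed

lemma forms:
  assumes "t \<in> T" "c \<in> A"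
  shows "chart_forms (cimg c) (s t c) (\<kappa> t c) (\<theta> t c) (v t c) (w t c) (\<alpha> t c) (\<beta> t c)"
  using assms slices[OF assms] fat_cimg s_pos \<theta>v \<theta>w
  by unfold_locales (auto simp: w_def \<alpha>_def \<beta>_def \<kappa>_def)

text \<open>The tangency hypotheses are conditional on a nonempty boundary; a chart point with
  vanishing first coordinate discharges that condition.\<close>

lemma boundary_point: "c \<in> A \<Longrightarrow> x \<in> cimg c \<Longrightarrow> x $ 1 = 0 \<Longrightarrow> mfd_boundary X A \<noteq> {}"
  unfolding mfd_boundary_def using cinv_topspace cinv_in crd_cinv by (smt (verit, best) empty_iff mem_Collect_eq)

lemma tangent_v: "t \<in> T \<Longrightarrow> tangent_field A (v t)"
  unfolding tangent_field_def
proof (intro ballI impI)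
  fix c x assume t: "t \<in> T" and c: "c \<in> A" "x \<in> cimg c" "x $ 1 = 0"
  then have "parallel_to_boundary A \<mu> (v t)" using ideal boundary_point by (auto simp: ideal_fluid_def)
  then have "\<mu> c x (v t c x) (axis 2 1) (axis 3 1) = 0"
    using c by (auto simp: parallel_to_boundary_def axis_def)
  then show "v t c x $ 1 = 0" using f_nz c by (simp add: \<mu>_eq cross_basis inner_axis)
qed

text \<open>The curl is w/f, and contracting the volume form with it on the two boundary directions
  leaves the first component of \<open>w\<close>.\<close>

lemma tangent_w: "t \<in> T \<Longrightarrow> tangent_field A (w t)"
  unfolding tangent_field_def
proof (intro ballI impI)
  fix c x assume t: "t \<in> T" and c: "c \<in> A" "x \<in> cimg c" "x $ 1 = 0"
  have ext: "ext_deriv1 (cimg c) (flat (g c) (v t c)) x u y = w t c x \<bullet> (u \<times> y)" for u y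
    unfolding w_def by (rule ext_deriv1_rot[OF fat_cimg[OF c(1)] slices(2)[OF t c(1)] c(2)]) (simp add: flat_def \<theta>_inner c)
  have "curl \<mu> g (v t) c x = w t c x /\<^sub>R f c x"
    unfolding curl_def
  proof (rule the_equality)
    show "\<forall>u y. \<mu> c x (w t c x /\<^sub>R f c x) u y = ext_deriv1 (cimg c) (flat (g c) (v t c)) x u y"
      using f_nz[OF c(1,2)] by (simp add: ext \<mu>_eq c)
  next
    fix \<xi> assume *: "\<forall>u y. \<mu> c x \<xi> u y = ext_deriv1 (cimg c) (flat (g c) (v t c)) x u y"
    have "f c x *\<^sub>R \<xi> = w t c x"
      by (rule eq_if_inner_cross) (use * in \<open>simp add: ext \<mu>_eq c\<close>)
    then show "\<xi> = w t c x /\<^sub>R f c x" using f_nz[OF c(1,2)] by (metis divideR_right)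
  qed
  moreover have "parallel_to_boundary A \<mu> (curl \<mu> g (v t))" using curl_parallel boundary_point c t by blast
  moreover have "(axis 2 1 :: R3) $ 1 = 0" "(axis 3 1 :: R3) $ 1 = 0" by (simp_all add: axis_def)
  ultimately have "\<mu> c x (w t c x /\<^sub>R f c x) (axis 2 1) (axis 3 1) = 0"
    using c unfolding parallel_to_boundary_def by metis
  then show "w t c x $ 1 = 0" using f_nz c by (simp add: \<mu>_eq cross_basis inner_axis)
qed

end

text \<open>Adding k \<theta> to \<alpha> changes \<alpha> \<and> d\<alpha> by dk \<and> d\<theta>,
  which is exact. All other terms vanish because the wedge products of \<theta> with d\<theta>, of
  \<theta> with d\<alpha> and of \<alpha> with d\<theta> are zero.\<close>

lemma (in chart_forms) gauge_shift:
  assumes k: "smooth_on C k" and x: "x \<in> C"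
  shows "(\<alpha> x + k x *\<^sub>R \<theta> x) \<bullet> rot C (\<lambda>y. \<alpha> y + k y *\<^sub>R \<theta> y) x = \<kappa> x + grad C k x \<bullet> w x"
proof -
  have "rot C (\<lambda>y. \<alpha> y + k y *\<^sub>R \<theta> y) x = rot C \<alpha> x + (grad C k x \<times> \<theta> x + k x *\<^sub>R w x)"
    using k x by (simp add: rot_add[OF fat] rot_scaleR[OF fat] smooth_on_scaleR smooth_\<alpha> smooth_\<theta> w_eq)
  moreover have "\<alpha> x \<bullet> (grad C k x \<times> \<theta> x) = grad C k x \<bullet> w x"
    by (simp add: \<theta>\<alpha>[OF x, symmetric] cross3_simps)
  ultimately show ?thesis
    by (simp add: inner_add_left inner_add_right \<kappa>_eq[OF x] \<theta>_rot_\<alpha>[OF x] \<theta>w[OF x] dot_cross_self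
        inner_commute[of "\<alpha> x" "w x"] w\<alpha>[OF x])
qed

section \<open>The Euler equation for one-forms and the Godbillon-Vey density\<close>

context aristotelian
begin

text \<open>Product rule that isolates the derivative of the metric with its arguments frozen at
  \<open>x\<close>; this is the form in which the Christoffel symbols contain it.\<close>

lemma g_derivative:
  assumes c: "c \<in> A" "x \<in> cimg c" and y: "smooth_on (cimg c) y" and z: "smooth_on (cimg c) z"
  shows "D (cimg c) (\<lambda>q. g c q (y q) (z q)) x u = D (cimg c) (\<lambda>q. g c q (y x) (z x)) x u
    + g c x (D (cimg c) y x u) (z x) + g c x (y x) (D (cimg c) z x u)"
proof -
  let ?C = "cimg c" and ?G = "\<lambda>i j q. g c q (axis i 1) (axis j 1)"
  have T: "T \<noteq> {}" using ideal by (simp add: ideal_fluid_def)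
  then have sG: "smooth_on ?C (?G i j)" for i j using slices(7)[OF _ c(1)] by blast
  have hd: "D ?C (\<lambda>q. g c q (y q) (z q)) x u = (\<Sum>i\<in>UNIV. \<Sum>j\<in>UNIV. D ?C (?G i j) x u * (y x $ i * z x $ j)
      + ?G i j x * (D ?C y x u $ i * z x $ j + y x $ i * D ?C z x u $ j))"
    if y: "smooth_on ?C y" and z: "smooth_on ?C z" for y z
  proof -
    have sa: "smooth_on ?C (\<lambda>q. y q $ i)" "smooth_on ?C (\<lambda>q. z q $ i)" for i using y z by (auto intro: smooth_on_component)
    have Da: "D ?C (\<lambda>q. y q $ i) x u = D ?C y x u $ i" "D ?C (\<lambda>q. z q $ i) x u = D ?C z x u $ i" for i
      by (simp_all add: frechet_bounded_linear[OF bounded_linear_vec_nth fat_cimg[OF c(1)] _ c(2)] y z)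
    have "D ?C (\<lambda>q. g c q (y q) (z q)) x u = D ?C (\<lambda>q. \<Sum>i\<in>UNIV. \<Sum>j\<in>UNIV. ?G i j q * (y q $ i * z q $ j)) x u"
      by (rule fun_cong[OF frechet_derivative_within_cong]) (use c g_expand in auto)
    also have "\<dots> = (\<Sum>i\<in>UNIV. \<Sum>j\<in>UNIV. ?G i j x * (y x $ i * D ?C (\<lambda>q. z q $ j) x u + D ?C (\<lambda>q. y q $ i) x u * z x $ j)
        + D ?C (?G i j) x u * (y x $ i * z x $ j))"
      by (rule fun_cong[OF frechet_fat[OF fat_cimg[OF c(1)] c(2)]])
        (intro has_derivative_sum has_derivative_mult smooth_on_has_derivative sG sa c(2))
    finally show ?thesis by (simp add: Da algebra_simps)
  qed
  have const: "D ?C (\<lambda>q. r :: R3) x u = 0" for r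
    using frechet_fat[OF fat_cimg[OF c(1)] c(2) has_derivative_const[of r]] by (metis (no_types))
  show ?thesis
    unfolding hd[OF y z] hd[OF smooth_on_const[where c="y x"] smooth_on_const[where c="z x"]] const
      g_expand[OF c, of "D ?C y x u" "z x"] g_expand[OF c, of "y x" "D ?C z x u"]
    by (simp add: sum.distrib distrib_left)
qed

text \<open>The definite description can be evaluated once the Koszul expression is known to be
  linear in \<open>y\<close>. Equal arguments suffice, since the Euler equation differentiates
  \<open>v\<close> along itself.\<close>

lemma christoffel_eq:
  assumes c: "c \<in> A" "x \<in> cimg c"
  shows "2 * g c x (christoffel (cimg c) (g c) x u u) y
    = 2 * D (cimg c) (\<lambda>q. g c q u y) x u - D (cimg c) (\<lambda>q. g c q u u) x y"
proof -
  let ?C = "cimg c"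
  define \<Phi> where "\<Phi> y = D ?C (\<lambda>q. g c q u y) x u + D ?C (\<lambda>q. g c q u y) x u - D ?C (\<lambda>q. g c q u u) x y" for y
  have T: "T \<noteq> {}" using ideal by (simp add: ideal_fluid_def)
  then have sG: "smooth_on ?C (\<lambda>q. g c q u y)" for u y using slices(7)[OF _ c(1)] by blast
  have l1: "linear (\<lambda>y. D ?C (\<lambda>q. g c q u y) x u)"
  proof (rule linearI)
    fix y z :: R3 and k :: real
    have "D ?C (\<lambda>q. g c q u (y + z)) x u = D ?C (\<lambda>q. g c q u y + g c q u z) x u"
      by (rule fun_cong[OF frechet_derivative_within_cong]) (simp_all add: linear_add[OF g_linear(1)[OF c(1)]] c)
    also have "\<dots> = D ?C (\<lambda>q. g c q u y) x u + D ?C (\<lambda>q. g c q u z) x u"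
      by (rule fun_cong[OF frechet_fat[OF fat_cimg[OF c(1)] c(2)]]) (intro has_derivative_add smooth_on_has_derivative sG c(2))
    finally show "D ?C (\<lambda>q. g c q u (y + z)) x u = D ?C (\<lambda>q. g c q u y) x u + D ?C (\<lambda>q. g c q u z) x u" .
    have "D ?C (\<lambda>q. g c q u (k *\<^sub>R y)) x u = D ?C (\<lambda>q. k *\<^sub>R g c q u y) x u"
      by (rule fun_cong[OF frechet_derivative_within_cong]) (simp_all add: linear_cmul[OF g_linear(1)[OF c(1)]] c)
    also have "\<dots> = k *\<^sub>R D ?C (\<lambda>q. g c q u y) x u"
      by (rule fun_cong[OF frechet_fat[OF fat_cimg[OF c(1)] c(2)]]) (intro has_derivative_scaleR_right smooth_on_has_derivative sG c(2))
    finally show "D ?C (\<lambda>q. g c q u (k *\<^sub>R y)) x u = k *\<^sub>R D ?C (\<lambda>q. g c q u y) x u" .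
  qed
  have l2: "linear (D ?C (\<lambda>q. g c q u u) x)" by (rule linear_D[OF sG c(2)])
  have "linear (\<lambda>y. (1 / 2) *\<^sub>R \<Phi> y)"
    unfolding \<Phi>_def by (intro linear_compose_scale_right linear_compose_sub linear_compose_add l1 l2)
  from sharp_eq(1)[OF g_bilinear[OF c] g_pos[OF c] this]
  have "\<exists>!z. \<forall>y. 2 * g c x z y = \<Phi> y" by (simp add: field_simps)
  from theI'[OF this] have "\<forall>y. 2 * g c x (christoffel ?C (g c) x u u) y = \<Phi> y"
    unfolding christoffel_def \<Phi>_def .
  then show ?thesis by (simp add: \<Phi>_def)
qed

text \<open>Lowering the index, the covector of \<nabla>v along \<open>v\<close> is the contraction
  of d\<theta> with \<open>v\<close> plus ds/2, and that contraction is s \<alpha>. Moving the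
  pressure term over gives the Euler equation in the form (\<partial>t + L_v) \<theta> = dP.\<close>

lemma dt_\<theta>:
  assumes t: "t \<in> T" and c: "c \<in> A" "x \<in> cimg c"
  shows "dt \<theta> t c x = grad (cimg c) (P t c) x - grad (cimg c) (s t c) x - s t c x *\<^sub>R \<alpha> t c x"
proof (rule vector_eq_ldot[THEN iffD1], rule allI)
  fix u :: R3
  let ?C = "cimg c" and ?v = "v t c x"
  note sl = slices[OF t c(1)] and fatC = fat_cimg[OF c(1)]
  have vu: "smooth_on ?C (\<lambda>_. u)" by (rule smooth_on_const)
  have const: "D ?C (\<lambda>q. u) x z = 0" for z
    using frechet_fat[OF fatC c(2) has_derivative_const[of u]] by (metis (no_types))
  have l: "linear (\<lambda>z. g c x z u)" and lb: "bounded_linear (\<lambda>z. g c x z u)"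
    using g_linear(2)[OF c] by (auto simp: linear_conv_bounded_linear)
  have "dt v t c x + cov_deriv ?C (g c) (v t c) (v t c) x = - sharp (g c x) (D ?C (\<lambda>y. p t (cinv c y)) x)"
    using ideal t c by (simp add: ideal_fluid_def dt_def)
  then have "g c x (dt v t c x + cov_deriv ?C (g c) (v t c) (v t c) x) u = g c x (- sharp (g c x) (D ?C (\<lambda>y. p t (cinv c y)) x)) u"
    by simp
  then have 1: "g c x (dt v t c x) u + g c x (cov_deriv ?C (g c) (v t c) (v t c) x) u = - D ?C (\<lambda>y. p t (cinv c y)) x u"
    using sharp_eq(2)[OF g_bilinear[OF c] g_pos[OF c] linear_D[OF sl(5) c(2)], of u]
    by (simp add: linear_add[OF l] linear_neg[OF l])
  have 2: "dt \<theta> t c x \<bullet> u = g c x (dt v t c x) u"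
  proof -
    have "((\<lambda>s. \<theta> s c x \<bullet> u) has_vector_derivative dt \<theta> t c x \<bullet> u) (at t)"
      by (rule bounded_linear.has_vector_derivative[OF bounded_linear_inner_left has_dt[OF \<theta>_smooth t c]])
    moreover have "((\<lambda>s. \<theta> s c x \<bullet> u) has_vector_derivative g c x (dt v t c x) u) (at t)"
      using bounded_linear.has_vector_derivative[OF lb has_dt[OF v_smooth t c]] by (simp add: \<theta>_inner c)
    ultimately show ?thesis by (rule vector_derivative_unique_at)
  qed
  have \<theta>u: "D ?C (\<theta> t c) x z \<bullet> u = D ?C (\<lambda>q. g c q ?v u) x z + g c x (D ?C (v t c) x z) u" for z
  proof -
    have "D ?C (\<theta> t c) x z \<bullet> u = D ?C (\<lambda>q. g c q (v t c q) u) x z"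
      by (rule D_inner[symmetric, OF fatC sl(2) c(2)]) (simp add: \<theta>_inner c)
    then show ?thesis
      using g_derivative[OF c sl(3) vu] const by (simp add: linear_0[OF g_linear(1)[OF c]])
  qed
  have su: "D ?C (s t c) x u = D ?C (\<lambda>q. g c q ?v ?v) x u + 2 * g c x (D ?C (v t c) x u) ?v"
    unfolding s_def[abs_def] using g_derivative[OF c sl(3) sl(3), of u] g_sym[OF c, of ?v] by simp
  have gv: "g c x (D ?C (v t c) x u) ?v = \<theta> t c x \<bullet> D ?C (v t c) x u"
    using g_sym[OF c] by (simp add: \<theta>_inner[OF c])
  have s\<theta>v: "D ?C (s t c) x u = D ?C (\<theta> t c) x u \<bullet> ?v + \<theta> t c x \<bullet> D ?C (v t c) x u"
  proof -
    have "D ?C (s t c) x u = D ?C (\<lambda>y. \<theta> t c y \<bullet> v t c y) x u"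
      by (rule fun_cong[OF frechet_derivative_within_cong]) (use c in \<open>auto simp: \<theta>v\<close>)
    also have "\<dots> = \<theta> t c x \<bullet> D ?C (v t c) x u + D ?C (\<theta> t c) x u \<bullet> v t c x"
      by (rule fun_cong[OF frechet_fat[OF fatC c(2)]]) (intro has_derivative_inner smooth_on_has_derivative sl c(2))
    finally show ?thesis by simp
  qed
  have "g c x (cov_deriv ?C (g c) (v t c) (v t c) x) u = g c x (D ?C (v t c) x ?v) u + g c x (christoffel ?C (g c) x ?v ?v) u"
    by (simp add: cov_deriv_def linear_add[OF l])
  also have "\<dots> = D ?C (\<theta> t c) x ?v \<bullet> u - D ?C (\<theta> t c) x u \<bullet> ?v + D ?C (s t c) x u / 2"
    using christoffel_eq[OF c, of ?v u] \<theta>u[of ?v] su gv s\<theta>v by linarith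
  also have "D ?C (\<theta> t c) x ?v \<bullet> u - D ?C (\<theta> t c) x u \<bullet> ?v = w t c x \<bullet> (?v \<times> u)"
    by (simp add: w_def rot_inner_cross[OF fatC sl(2) c(2)])
  also have "\<dots> = (s t c x *\<^sub>R \<alpha> t c x) \<bullet> u"
    using s_pos[OF t c] by (simp add: \<alpha>_def triple_rotate)
  finally have 3: "g c x (cov_deriv ?C (g c) (v t c) (v t c) x) u = (s t c x *\<^sub>R \<alpha> t c x) \<bullet> u + D ?C (s t c) x u / 2" .
  have 4: "grad ?C (P t c) x \<bullet> u = D ?C (s t c) x u / 2 - D ?C (\<lambda>y. p t (cinv c y)) x u"
  proof -
    have "smooth_on ?C (P t c)" unfolding P_def[abs_def] by (intro smooth_intros sl)
    then have "grad ?C (P t c) x \<bullet> u = D ?C (P t c) x u" using c(2) by (rule grad_inner)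
    also have "\<dots> = D ?C (s t c) x u * (1 / 2) - D ?C (\<lambda>y. p t (cinv c y)) x u"
      unfolding P_def[abs_def]
      by (rule fun_cong[OF frechet_fat[OF fatC c(2)]]) (intro has_derivative_diff has_derivative_mult_left smooth_on_has_derivative sl c(2))
    finally show ?thesis by simp
  qed
  have 5: "grad ?C (s t c) x \<bullet> u = D ?C (s t c) x u" by (rule grad_inner[OF sl(1) c(2)])
  have "dt \<theta> t c x \<bullet> u = (grad (cimg c) (P t c) x - grad (cimg c) (s t c) x - s t c x *\<^sub>R \<alpha> t c x) \<bullet> u"
    unfolding inner_diff_left 2 4 5 using 1 3 by simp
  then show "u \<bullet> dt \<theta> t c x = u \<bullet> (grad (cimg c) (P t c) x - grad (cimg c) (s t c) x - s t c x *\<^sub>R \<alpha> t c x)"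
    by (simp add: inner_commute)
qed

text \<open>The factor for which \<alpha> + k \<theta> is the form \<open>alpha_form\<close>.
  Evaluate on \<open>v\<close>: \<alpha> vanishes, \<theta>(v) = s, the Lie derivative of \<tau>
  gives 0 since \<tau>(v) = 1, and d log s gives v(s)/s.\<close>

definition k :: "real \<Rightarrow> ('a, real) field" where
  "k t c x = - (grad (cimg c) (s t c) x \<bullet> v t c x) / (s t c x * s t c x)"

definition gv_density :: "real \<Rightarrow> ('a, real) field" where
  "gv_density t c x = \<kappa> t c x + grad (cimg c) (k t c) x \<bullet> w t c x"

lemma k_smooth: "smooth_family T A k"
  unfolding k_def[abs_def] using s_pos
  by (intro smooth_family_divide smooth_family_minus smooth_family_inner smooth_family_mult smooth_family_grad s_smooth v_smooth) force

lemma w_smooth: "smooth_family T A w"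
  unfolding w_def by (rule smooth_family_rot[OF \<theta>_smooth])

lemma \<alpha>_smooth: "smooth_family T A \<alpha>"
  unfolding \<alpha>_def[abs_def] using s_pos
  by (intro smooth_family_scaleR smooth_family_divide smooth_family_cross smooth_family_const w_smooth v_smooth s_smooth) force

lemma \<kappa>_smooth: "smooth_family T A \<kappa>"
  unfolding \<kappa>_def[abs_def] by (intro smooth_family_inner smooth_family_rot \<alpha>_smooth)

lemma gv_density_smooth: "smooth_family T A gv_density"
  unfolding gv_density_def[abs_def] by (intro smooth_family_add smooth_family_inner smooth_family_grad \<kappa>_smooth k_smooth w_smooth)

lemma P_smooth: "smooth_family T A P"
  unfolding P_def[abs_def] by (intro smooth_family_diff smooth_family_mult smooth_family_const s_smooth p_smooth)

text \<open>Because \<tau>(v) = 1, Cartan's formula reduces the Lie derivative of \<tau> to the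
  contraction of d\<tau> with \<open>v\<close>. Inserting \<theta> = s \<tau> into \<alpha> produces
  this contraction, the term -ds/s, and a multiple of \<tau> that k \<theta> removes.\<close>

lemma alpha_form_eq:
  assumes t: "t \<in> T" and c: "c \<in> A" "x \<in> cimg c"
  shows "alpha_form (\<tau> t) (v t) g c x u = (\<alpha> t c x + k t c x *\<^sub>R \<theta> t c x) \<bullet> u"
proof -
  let ?C = "cimg c" and ?v = "v t c x"
  note sl = slices[OF t c(1)] and fatC = fat_cimg[OF c(1)] and sp = s_pos[OF t c]
  have \<sigma>v: "\<sigma> t c y \<bullet> v t c y = 1" if "y \<in> ?C" for y
    using \<tau>v[OF t c(1) that] \<sigma>_inner[OF t c(1) that] by simp
  have "0 = D ?C (\<lambda>y. \<sigma> t c y \<bullet> v t c y) x u"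
  proof -
    have "D ?C (\<lambda>y. \<sigma> t c y \<bullet> v t c y) x u = D ?C (\<lambda>y. 1 :: real) x u"
      by (rule fun_cong[OF frechet_derivative_within_cong]) (use c \<sigma>v in auto)
    then show ?thesis using frechet_fat[OF fatC c(2) has_derivative_const[of "1 :: real"]] by simp
  qed
  also have "\<dots> = \<sigma> t c x \<bullet> D ?C (v t c) x u + D ?C (\<sigma> t c) x u \<bullet> v t c x"
    by (rule fun_cong[OF frechet_fat[OF fatC c(2)]]) (intro has_derivative_inner smooth_on_has_derivative sl c(2))
  finally have dv: "\<sigma> t c x \<bullet> D ?C (v t c) x u = - (D ?C (\<sigma> t c) x u \<bullet> ?v)" by simp
  have lie: "lie1 ?C (v t c) (\<tau> t c) x u = (rot ?C (\<sigma> t c) x \<times> ?v) \<bullet> u"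
  proof -
    have "lie1 ?C (v t c) (\<tau> t c) x u = D ?C (\<sigma> t c) x ?v \<bullet> u + \<sigma> t c x \<bullet> D ?C (v t c) x u"
      unfolding lie1_def using D_inner[OF fatC sl(4) c(2), of "\<lambda>y. \<tau> t c y u" u] \<sigma>_inner[OF t c(1)] c by simp
    then show ?thesis
      by (simp add: dv triple_rotate rot_inner_cross[OF fatC sl(4) c(2)])
  qed
  have ln: "D ?C (\<lambda>y. ln (g c y (v t c y) (v t c y))) x u = (grad ?C (s t c) x \<bullet> u) / s t c x"
  proof -
    have "((\<lambda>y. ln (s t c y)) has_derivative (\<lambda>u. inverse (s t c x) * D ?C (s t c) x u)) (at x within ?C)"
      using has_derivative_compose[OF smooth_on_has_derivative[OF sl(1) c(2)] DERIV_ln[OF sp, unfolded has_field_derivative_def]] .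
    from frechet_fat[OF fatC c(2) this] show ?thesis
      by (simp add: s_def[symmetric] s_def[abs_def, symmetric] grad_inner[OF sl(1) c(2)] divide_inverse)
  qed
  have "\<alpha> t c x + k t c x *\<^sub>R \<theta> t c x = rot ?C (\<sigma> t c) x \<times> ?v - (1 / s t c x) *\<^sub>R grad ?C (s t c) x"
  proof -
    let ?g = "grad ?C (s t c) x" and ?s = "s t c x" and ?\<sigma> = "\<sigma> t c x"
    have "(?g \<times> ?\<sigma>) \<times> ?v = (?g \<bullet> ?v) *\<^sub>R ?\<sigma> - (?\<sigma> \<bullet> ?v) *\<^sub>R ?g"
      using cross_skew[of "?g \<times> ?\<sigma>" ?v] cross_cross_left[of ?v ?g ?\<sigma>] by (simp add: inner_commute)
    then have "(?g \<times> ?\<sigma>) \<times> ?v = (?g \<bullet> ?v) *\<^sub>R ?\<sigma> - ?g" using \<sigma>v[OF c(2)] by simp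
    then have "\<alpha> t c x = (1 / ?s) *\<^sub>R ((?g \<bullet> ?v) *\<^sub>R ?\<sigma> - ?g) + rot ?C (\<sigma> t c) x \<times> ?v"
      using sp by (simp add: \<alpha>_def w_\<sigma>[OF t c] cross_add_left cross_mult_left scaleR_add_right)
    moreover have "k t c x *\<^sub>R \<theta> t c x = - ((1 / ?s) *\<^sub>R (?g \<bullet> ?v) *\<^sub>R ?\<sigma>)"
      using sp by (simp add: k_def \<theta>\<sigma>[OF t c])
    ultimately show ?thesis by (simp add: scaleR_diff_right)
  qed
  then show ?thesis
    unfolding alpha_form_def lie ln by (simp add: inner_diff_left)
qed

lemma gv_form_eq:
  assumes t: "t \<in> T" and c: "c \<in> A" "x \<in> cimg c"
  shows "gv_form (\<tau> t) (v t) g c x u y z = gv_density t c x * (u \<bullet> (y \<times> z))"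
proof -
  let ?a = "\<lambda>x. \<alpha> t c x + k t c x *\<^sub>R \<theta> t c x"
  have sk: "smooth_on (cimg c) (k t c)" and s\<alpha>: "smooth_on (cimg c) (\<alpha> t c)"
    using smooth_family_slice[OF k_smooth t] smooth_family_slice[OF \<alpha>_smooth t] c by (auto simp: smooth_field_def)
  have sa: "smooth_on (cimg c) ?a" by (intro smooth_intros sk s\<alpha> slices(2)[OF t c(1)])
  show ?thesis
    unfolding gv_form_def gv_density_def chart_forms.gauge_shift[OF forms[OF t c(1)] sk c(2), symmetric]
    by (rule wedge12_density[OF fat_cimg[OF c(1)] sa sa c(2)]) (simp_all add: alpha_form_eq[OF t c(1)])
qed

end

section \<open>Time evolution of the Godbillon-Vey density and conservation\<close>

context aristotelian
begin

text \<open>Dividing by the square of the density of \<open>\<mu>\<close> turns the metric into a form on vector densities.\<close>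

definition gf :: "('a, form2) field" where "gf c x u y = g c x u y / (f c x * f c x)"
definition N :: "real \<Rightarrow> ('a, real) field" where "N t c x = gf c x (w t c x) (w t c x)"
definition M :: "real \<Rightarrow> ('a, real) field" where
  "M t c x = gf c x (\<theta> t c x \<times> grad (cimg c) (P t c) x) (w t c x)"

lemma smooth_slice: "smooth_family T A q \<Longrightarrow> t \<in> T \<Longrightarrow> c \<in> A \<Longrightarrow> smooth_on (cimg c) (q t c)"
  for q :: "real \<Rightarrow> ('a, 'b::euclidean_space) field"
  using smooth_family_slice by (auto simp: smooth_field_def)

context
  fixes t assumes t: "t \<in> T"
begin

lemma dt_w:
  assumes c: "c \<in> A" "x \<in> cimg c"
  shows "dt w t c x = - (grad (cimg c) (s t c) x \<times> \<alpha> t c x) - s t c x *\<^sub>R rot (cimg c) (\<alpha> t c) x"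
proof -
  let ?C = "cimg c"
  note sl = smooth_slice[OF _ t c(1)] and fatC = fat_cimg[OF c(1)]
  have sm: "smooth_on ?C (grad ?C (P t c))" "smooth_on ?C (grad ?C (s t c))" "smooth_on ?C (\<alpha> t c)" "smooth_on ?C (s t c)" "smooth_on ?C (P t c)"
    using sl[OF P_smooth] sl[OF s_smooth] sl[OF \<alpha>_smooth] by (auto intro: smooth_grad fatC)
  have "dt w t c x = rot ?C (dt \<theta> t c) x"
    unfolding w_def by (rule dt_rot[OF \<theta>_smooth t c])
  also have "\<dots> = rot ?C (\<lambda>x. (grad ?C (P t c) x - grad ?C (s t c) x) - s t c x *\<^sub>R \<alpha> t c x) x"
    by (rule rot_cong[OF dt_\<theta>[OF t c(1)] c(2)])
  also have "\<dots> = - (grad ?C (s t c) x \<times> \<alpha> t c x + s t c x *\<^sub>R rot ?C (\<alpha> t c) x)"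
    using sm c(2) by (simp add: rot_diff[OF fatC] rot_scaleR[OF fatC] rot_grad[OF fatC] smooth_on_diff smooth_on_scaleR)
  finally show ?thesis by simp
qed

text \<open>The relation \<theta> \<and> d\<theta> = 0 holds at all times, so its time derivative
  vanishes. Inserting the evolution of \<theta> and \<open>w\<close>, the two terms with ds cancel,
  those with \<alpha> are zero, and only dP on \<open>w\<close> survives.\<close>

lemma grad_P_w:
  assumes c: "c \<in> A" "x \<in> cimg c"
  shows "grad (cimg c) (P t c) x \<bullet> w t c x = 0"
proof -
  note fm = forms[OF t c(1)]
  have "((\<lambda>s. \<theta> s c x \<bullet> w s c x) has_vector_derivative \<theta> t c x \<bullet> dt w t c x + dt \<theta> t c x \<bullet> w t c x) (at t)"
    using has_dt[OF \<theta>_smooth t c] has_dt[OF w_smooth t c]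
    by (rule bounded_bilinear.has_vector_derivative[OF bounded_bilinear_inner])
  moreover have "((\<lambda>s. \<theta> s c x \<bullet> w s c x) has_vector_derivative 0) (at t)"
    by (rule has_vector_derivative_transform_within_open[OF has_vector_derivative_const open_T t]) (simp add: \<theta>w c)
  ultimately have "\<theta> t c x \<bullet> dt w t c x + dt \<theta> t c x \<bullet> w t c x = 0"
    by (rule vector_derivative_unique_at)
  moreover have "\<theta> t c x \<bullet> (grad (cimg c) (s t c) x \<times> \<alpha> t c x) = - (grad (cimg c) (s t c) x \<bullet> w t c x)"
    by (simp add: chart_forms.\<theta>\<alpha>[OF fm c(2), symmetric] cross3_simps)
  ultimately show ?thesis
    by (simp add: dt_w[OF c] dt_\<theta>[OF t c] inner_diff_right inner_diff_left chart_forms.\<theta>_rot_\<alpha>[OF fm c(2)]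
        inner_commute[of "\<alpha> t c x"] chart_forms.w\<alpha>[OF fm c(2)])
qed

lemma flow:
  assumes c: "c \<in> A"
  shows "chart_flow (cimg c) (s t c) (\<kappa> t c) (\<theta> t c) (v t c) (w t c) (\<alpha> t c) (\<beta> t c) (P t c) (a t c) (m t c) (M t c) (N t c) (gf c)"
proof (intro chart_flow.intro forms t c chart_flow_axioms.intro)
  show "smooth_on (cimg c) (P t c)" by (rule smooth_slice[OF P_smooth t c])
  show "smooth_on (cimg c) (\<lambda>x. gf c x u y)" for u y
    unfolding gf_def using f_nz[OF c] by (intro smooth_on_divide smooth_on_mult slices[OF t c]) auto
  show "bilinear (gf c x)" if "x \<in> cimg c" for x
    using g_bilinear[OF c that] by (auto simp: gf_def[abs_def] bilinear_def linear_iff add_divide_distrib)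
  show "gf c x u u > 0" if "x \<in> cimg c" "u \<noteq> 0" for x u
    using g_pos[OF c that] f_nz[OF c that(1)] by (simp add: gf_def zero_less_mult_iff linorder_neq_iff disj_commute)
qed (use grad_P_w c in \<open>auto simp: a_def m_def N_def M_def\<close>)

lemma s_scalar: "scalar_field A (s t)"
  unfolding scalar_field_def s_def using g_transform vector_fieldD[OF v_vector[OF t]] by simp

lemma k_scalar: "scalar_field A (k t)"
proof -
  have "scalar_field A (\<lambda>c x. (-1) * (grad (cimg c) (s t c) x \<bullet> v t c x) / (s t c x * s t c x))"
    by (intro scalar_divide scalar_mult scalar_const scalar_inner covector_grad s_scalar smooth_family_slice[OF s_smooth t] v_vector t)
  then show ?thesis by (simp add: k_def[abs_def])
qed

lemma \<theta>_covector: "covector_field A (\<theta> t)"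
  unfolding covector_field_def
proof (intro ballI allI)
  fix c d x u assume *: "c \<in> A" "d \<in> A" "x \<in> overlap c d"
  then show "\<theta> t c x \<bullet> u = \<theta> t d (trans_map c d x) \<bullet> jac c d x u"
    using overlap_subset[of c d] trans_in_cimg[OF *]
    by (auto simp: \<theta>_inner vector_fieldD[OF v_vector[OF t] *] g_transform[OF *])
qed

lemma fields:
  "vector_density A (w t)" "covector_field A (\<alpha> t)" "vector_density A (\<lambda>c. rot (cimg c) (\<alpha> t c))" "density_field A (\<kappa> t)"
  "scalar_field A (P t)" "scalar_field A (a t)" "scalar_field A (m t)" "density_field A (gv_density t)"
proof -
  note sm = smooth_family_slice[OF _ t]
  show w: "vector_density A (w t)"
    unfolding w_def by (rule vector_density_rot[OF \<theta>_covector sm[OF \<theta>_smooth]])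
  show \<alpha>: "covector_field A (\<alpha> t)"
    unfolding \<alpha>_def by (intro covector_scaleR scalar_divide scalar_const s_scalar covector_density_cross_vector w v_vector t)
  show r\<alpha>: "vector_density A (\<lambda>c. rot (cimg c) (\<alpha> t c))"
    by (rule vector_density_rot[OF \<alpha> sm[OF \<alpha>_smooth]])
  show \<kappa>: "density_field A (\<kappa> t)" unfolding \<kappa>_def by (rule density_inner[OF \<alpha> r\<alpha>])
  show P: "scalar_field A (P t)"
    unfolding P_def by (intro scalar_diff scalar_mult s_scalar scalar_const) (simp add: scalar_field_def cinv_trans)
  show a: "scalar_field A (a t)"
    unfolding a_def by (intro scalar_divide scalar_inner covector_grad P sm[OF P_smooth] s_scalar v_vector t)
  have "smooth_family T A a"
    unfolding a_def[abs_def] using s_pos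
    by (intro smooth_family_divide smooth_family_inner smooth_family_grad P_smooth v_smooth s_smooth) force
  then show "scalar_field A (m t)"
    unfolding m_def by (intro scalar_divide scalar_inner covector_grad a sm s_scalar v_vector t)
  show "density_field A (gv_density t)"
    unfolding gv_density_def by (intro density_add \<kappa> density_inner covector_grad k_scalar sm[OF k_smooth] w)
qed

lemma scalar_gf:
  assumes "vector_density A y" "vector_density A z"
  shows "scalar_field A (\<lambda>c x. gf c x (y c x) (z c x))"
  unfolding scalar_field_def
proof (intro ballI)
  fix c d x assume *: "c \<in> A" "d \<in> A" "x \<in> overlap c d"
  have x: "x \<in> cimg c" using * overlap_subset by blast
  let ?d = "det (matrix (jac c d x))"
  note l = g_linear[OF *(2) trans_in_cimg[OF *]]
  have "g c x (y c x) (z c x) = ?d * (?d * g d (trans_map c d x) (y d (trans_map c d x)) (z d (trans_map c d x)))"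
    by (simp add: g_transform[OF *] vector_densityD[OF assms(1) *] vector_densityD[OF assms(2) *]
        linear_cmul[OF l(1)] linear_cmul[OF l(2)])
  moreover have "f c x = ?d * f d (trans_map c d x)" by (rule density_fieldD[OF f_density *])
  ultimately show "gf d (trans_map c d x) (y d (trans_map c d x)) (z d (trans_map c d x)) = gf c x (y c x) (z c x)"
    using det_jac_pos[OF *] by (simp add: gf_def)
qed

lemma divg_fv:
  assumes c: "c \<in> A" "x \<in> cimg c"
  shows "divg (cimg c) (\<lambda>x. f c x *\<^sub>R v t c x) x = 0"
proof -
  have "lie3 (cimg c) (v t c) (\<mu> c) x (axis 1 1) (axis 2 1) (axis 3 1) = 0"
    using ideal t c by (simp add: ideal_fluid_def)
  then show ?thesis
    using lie3_divg[OF fat_cimg[OF c(1)] slices(6)[OF t c(1)] slices(3)[OF t c(1)] c(2) \<mu>_eq[OF c(1)]] by simp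
qed

lemma manifold_flow:
  assumes "partition_of_unity X A F \<phi>"
  shows "manifold_flow X A F \<phi> (s t) (P t) (a t) (m t) (\<kappa> t) (M t) (N t) f (\<theta> t) (v t) (w t) (\<alpha> t) (\<beta> t) gf"
proof (intro manifold_flow.intro partitioned_3manifold.intro partitioned_3manifold_axioms.intro
    manifold_flow_axioms.intro compact_3manifold_axioms assms)
  show "scalar_field A (M t)"
    unfolding M_def using scalar_gf[OF vector_density_cross[OF \<theta>_covector covector_grad[OF fields(5) smooth_family_slice[OF P_smooth t]]] fields(1)]
    by simp
  show "scalar_field A (N t)" unfolding N_def by (rule scalar_gf[OF fields(1) fields(1)])
  show "smooth_field A f" using slices(6)[OF t] by (simp add: smooth_field_def)
qed (use assms flow s_scalar fields f_density f_nz v_vector tangent_v tangent_w divg_fv t in auto)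

text \<open>The time derivative of \<alpha> \<and> d\<alpha> is twice the wedge of the time
  derivative of \<alpha> with d\<alpha>, up to an exact form. Since d\<alpha> = \<theta> \<and>
  \<beta>, the wedge reduces to dP \<and> \<alpha> \<and> \<beta>, which is known.\<close>

lemma dt_\<kappa>:
  assumes c: "c \<in> A" "x \<in> cimg c"
  shows "dt \<kappa> t c x = - 2 * (a t c x * \<kappa> t c x) + divg (cimg c) (\<lambda>x. dt \<alpha> t c x \<times> \<alpha> t c x) x"
proof -
  let ?C = "cimg c" and ?\<alpha> = "\<alpha> t c x" and ?\<alpha>' = "dt \<alpha> t c x"
  let ?r = "rot ?C (\<alpha> t c) x"
  note fm = forms[OF t c(1)] and fatC = fat_cimg[OF c(1)]
  have "((\<lambda>s. \<alpha> s c x \<bullet> rot ?C (\<alpha> s c) x) has_vector_derivative ?\<alpha> \<bullet> dt (\<lambda>t c. rot (cimg c) (\<alpha> t c)) t c x + ?\<alpha>' \<bullet> ?r) (at t)"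
    using has_dt[OF \<alpha>_smooth t c] has_dt[OF smooth_family_rot[OF \<alpha>_smooth] t c]
    by (rule bounded_bilinear.has_vector_derivative[OF bounded_bilinear_inner])
  then have "dt \<kappa> t c x = ?\<alpha> \<bullet> rot ?C (dt \<alpha> t c) x + ?\<alpha>' \<bullet> ?r"
    unfolding \<kappa>_def dt_rot[OF \<alpha>_smooth t c] by (rule dt_eqI)
  moreover have "divg ?C (\<lambda>x. dt \<alpha> t c x \<times> \<alpha> t c x) x = rot ?C (dt \<alpha> t c) x \<bullet> ?\<alpha> - ?\<alpha>' \<bullet> ?r"
    by (rule divg_cross[OF fatC smooth_slice[OF smooth_family_dt[OF \<alpha>_smooth] t c(1)] smooth_slice[OF \<alpha>_smooth t c(1)] c(2)])
  ultimately have 1: "dt \<kappa> t c x = 2 * (?\<alpha>' \<bullet> ?r) + divg ?C (\<lambda>x. dt \<alpha> t c x \<times> \<alpha> t c x) x"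
    by (simp add: inner_commute)
  \<comment> \<open>Differentiating \<theta> \<times> \<alpha> = w determines the time derivative of
    \<alpha> only modulo \<theta>. This is enough, as it is paired with \<theta> \<times>
    \<beta>.\<close>
  have "((\<lambda>s. \<theta> s c x \<times> \<alpha> s c x) has_vector_derivative \<theta> t c x \<times> ?\<alpha>' + dt \<theta> t c x \<times> ?\<alpha>) (at t)"
    using has_dt[OF \<theta>_smooth t c] has_dt[OF \<alpha>_smooth t c]
    by (rule bounded_bilinear.has_vector_derivative[OF bilinear_conv_bounded_bilinear[THEN iffD1, OF bilinear_cross]])
  then have "((\<lambda>s. w s c x) has_vector_derivative \<theta> t c x \<times> ?\<alpha>' + dt \<theta> t c x \<times> ?\<alpha>) (at t)"
    by (rule has_vector_derivative_transform_within_open[OF _ open_T t])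
      (rule chart_forms.\<theta>\<alpha>[OF forms[OF _ c(1)] c(2)])
  then have "dt w t c x = \<theta> t c x \<times> ?\<alpha>' + dt \<theta> t c x \<times> ?\<alpha>" by (rule dt_eqI)
  then have "\<theta> t c x \<times> ?\<alpha>' = dt w t c x - dt \<theta> t c x \<times> ?\<alpha>" by simp
  then have 2: "\<theta> t c x \<times> ?\<alpha>' = - (grad ?C (P t c) x \<times> ?\<alpha>) - s t c x *\<^sub>R ?r"
    by (simp add: dt_w[OF c] dt_\<theta>[OF t c] Cross3.left_diff_distrib cross_mult_left)
  have r: "?r = \<theta> t c x \<times> \<beta> t c x" using chart_forms.\<theta>\<beta>[OF fm c(2)] by simp
  have "?\<alpha>' \<bullet> ?r = - ((\<theta> t c x \<times> ?\<alpha>') \<bullet> \<beta> t c x)" unfolding r by (simp add: cross3_simps)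
  also have "\<dots> = grad ?C (P t c) x \<bullet> (?\<alpha> \<times> \<beta> t c x) + s t c x * (?r \<bullet> \<beta> t c x)"
    unfolding 2 by (simp add: inner_diff_left triple_rotate)
  also have "?r \<bullet> \<beta> t c x = 0" unfolding r by (simp add: dot_cross_self)
  also have "grad ?C (P t c) x \<bullet> (?\<alpha> \<times> \<beta> t c x) = - (a t c x * \<kappa> t c x)"
    by (rule chart_flow.triple_P[OF flow[OF c(1)] c(2)])
  finally show ?thesis unfolding 1 by simp
qed

lemma I_dt_\<kappa>:
  assumes pou: "partition_of_unity X A F \<phi>"
  shows "pou_integral F \<phi> (dt \<kappa> t) = 0"
proof -
  let ?W = "\<lambda>c x. dt \<alpha> t c x \<times> \<alpha> t c x"
  interpret mf: manifold_flow X A F \<phi> "s t" "P t" "a t" "m t" "\<kappa> t" "M t" "N t" f "\<theta> t" "v t" "w t" "\<alpha> t" "\<beta> t" gf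
    by (rule manifold_flow[OF pou])
  note sd = smooth_slice[OF smooth_family_dt[OF \<alpha>_smooth] t] and s\<alpha> = smooth_slice[OF \<alpha>_smooth t]
  have sW: "smooth_on (cimg c) (?W c)" if "c \<in> A" for c
    by (intro smooth_cross fat_cimg sd s\<alpha> that)
  \<comment> \<open>The transformation law of \<alpha> is needed for every time in \<open>T\<close>,
    not only for the fixed one, hence the generalised form of \<open>fields\<close>.\<close>
  have "covector_field A (dt \<alpha> t)" by (rule covector_dt[OF \<alpha>_smooth _ t]) (rule aristotelian.fields, unfold_locales)
  then have W: "vector_density A ?W" by (rule vector_density_cross[OF _ fields(2)])
  \<comment> \<open>On the boundary \<open>v\<close> and \<open>w\<close> are both tangent, so their
    cross product, and with it \<alpha>, has only a first component. The first component of the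
    cross product below then vanishes whatever the time derivative of \<alpha> is.\<close>
  have tW: "tangent_field A ?W"
    unfolding tangent_field_def
  proof (intro ballI impI)
    fix c x assume c: "c \<in> A" "x \<in> cimg c" "x $ 1 = 0"
    then have "v t c x $ 1 = 0" "w t c x $ 1 = 0"
      using tangent_v[OF t] tangent_w[OF t] by (auto simp: tangent_field_def)
    then have "\<alpha> t c x $ 2 = 0" "\<alpha> t c x $ 3 = 0" by (simp_all add: \<alpha>_def cross_components)
    then show "?W c x $ 1 = 0" by (simp add: cross_components)
  qed
  have li: "mf.locally_integrable (\<lambda>c x. - 2 * (a t c x * \<kappa> t c x))" "mf.locally_integrable (\<lambda>c. divg (cimg c) (?W c))"
    using mf.smooth_on_fields sW
    by (auto intro!: mf.smooth_locally_integrable smooth_on_mult smooth_divg fat_cimg smooth_on_const smooth_on_minus simp: smooth_field_def)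
  have "pou_integral F \<phi> (dt \<kappa> t) = pou_integral F \<phi> (\<lambda>c x. - 2 * (a t c x * \<kappa> t c x) + divg (cimg c) (?W c) x)"
    by (rule mf.I_cong) (rule dt_\<kappa>)
  also have "\<dots> = pou_integral F \<phi> (\<lambda>c x. - 2 * (a t c x * \<kappa> t c x)) + pou_integral F \<phi> (\<lambda>c. divg (cimg c) (?W c))"
    by (rule mf.I_add[OF li])
  also have "\<dots> = - 2 * pou_integral F \<phi> (\<lambda>c x. a t c x * \<kappa> t c x) + 0"
    using Stokes[OF pou _ W tW] sW pou_integral_cmult[of F \<phi> "- 2" "\<lambda>c x. a t c x * \<kappa> t c x"] by (simp add: smooth_field_def)
  finally show ?thesis by (simp add: mf.I_a\<kappa>)
qed

text \<open>The gauge term is the derivative of \<open>k\<close> along \<open>w\<close>; integrating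
  it by parts against the constant 1 gives zero.\<close>

lemma I_gv_density:
  assumes pou: "partition_of_unity X A F \<phi>"
  shows "pou_integral F \<phi> (gv_density t) = pou_integral F \<phi> (\<kappa> t)"
proof -
  interpret mf: manifold_flow X A F \<phi> "s t" "P t" "a t" "m t" "\<kappa> t" "M t" "N t" f "\<theta> t" "v t" "w t" "\<alpha> t" "\<beta> t" gf
    by (rule manifold_flow[OF pou])
  let ?W = "\<lambda>c x. k t c x *\<^sub>R w t c x"
  have sk: "smooth_on (cimg c) (k t c)" if "c \<in> A" for c by (rule smooth_slice[OF k_smooth t that])
  have li: "mf.locally_integrable (\<kappa> t)" "mf.locally_integrable (mf.along_w (k t))"
    using mf.smooth_fields sk by (auto intro!: mf.smooth_locally_integrable mf.smooth_along_w simp: smooth_field_def)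
  have "pou_integral F \<phi> (mf.along_w (k t)) = pou_integral F \<phi> (\<lambda>c x. 1 * mf.along_w (k t) c x)" by simp
  also have "\<dots> = - pou_integral F \<phi> (\<lambda>c x. k t c x * mf.along_w (\<lambda>c x. 1) c x)"
    using mf.I_along_w[OF k_scalar _ scalar_const[of 1]] sk smooth_on_const by (auto simp: smooth_field_def)
  also have "\<dots> = - pou_integral F \<phi> (\<lambda>c x. 0)"
  proof -
    have "pou_integral F \<phi> (\<lambda>c x. k t c x * mf.along_w (\<lambda>c x. 1) c x) = pou_integral F \<phi> (\<lambda>c x. 0)"
    proof (rule mf.I_cong)
      fix c x assume c: "c \<in> A" "x \<in> cimg c"
      have "grad (cimg c) (\<lambda>x. 1) x = 0" using c by (simp add: vec_eq_iff partial_const[OF fat_cimg])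
      then show "k t c x * mf.along_w (\<lambda>c x. 1) c x = 0" by simp
    qed
    then show ?thesis by simp
  qed
  finally have "pou_integral F \<phi> (mf.along_w (k t)) = 0" by (simp add: pou_integral_0)
  then show ?thesis unfolding gv_density_def using mf.I_add[OF li] by simp
qed

lemma gv_number_eq:
  assumes "partition_of_unity X A F \<phi>"
  shows "gv_number X A (\<tau> t) (v t) g = pou_integral F \<phi> (gv_density t)"
  unfolding gv_number_def
proof (rule mfd_integral_eq[OF assms fields(8)])
  show "continuous_on (cimg c) (gv_density t c)" if "c \<in> A" for c
    by (rule smooth_on_imp_continuous_on[OF smooth_slice[OF gv_density_smooth t that]])
  show "gv_form (\<tau> t) (v t) g c x (axis 1 1) (axis 2 1) (axis 3 1) = gv_density t c x" if "c \<in> A" "x \<in> cimg c" for c x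
    using gv_form_eq[OF t that] by (simp add: cross_basis inner_axis)
qed

end

text \<open>The gauge term is removed at every time before differentiating, so only \<kappa> has to
  be differentiated under the integral.\<close>

lemma gv_number_derivative:
  assumes t: "t \<in> T"
  shows "((\<lambda>s. gv_number X A (\<tau> s) (v s) g) has_real_derivative 0) (at t)"
proof -
  obtain F \<phi> where pou: "partition_of_unity X A F \<phi>" using partition_of_unity_exists by blast
  have "((\<lambda>s. pou_integral F \<phi> (\<kappa> s)) has_real_derivative 0) (at t)"
    using Leibniz[OF pou \<kappa>_smooth t] I_dt_\<kappa>[OF t pou] by simp
  then show ?thesis
    by (rule has_field_derivative_transform_within_open[OF _ open_T t]) (simp add: gv_number_eq[OF _ pou] I_gv_density[OF _ pou])
qed

text \<open>The time part integrates to the derivative of the number, and the Lie part is the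
  divergence of the density times \<open>v\<close>, which Stokes kills since \<open>v\<close> is
  tangent to the boundary. Both values are obtained for an arbitrary partition of unity, as
  evaluating the definite description requires.\<close>

lemma gv_rate_zero:
  assumes t: "t \<in> T"
  shows "gv_rate X A \<tau> v g t = 0"
proof -
  obtain F \<phi> where pou: "partition_of_unity X A F \<phi>" using partition_of_unity_exists by blast
  let ?W = "\<lambda>c x. gv_density t c x *\<^sub>R v t c x"
  have sW: "smooth_on (cimg c) (?W c)" if "c \<in> A" for c
    by (intro smooth_on_scaleR smooth_slice[OF gv_density_smooth t that] slices(3)[OF t that])
  show ?thesis
    unfolding gv_rate_def
  proof (rule mfd_integral_eqI[OF pou, where r="\<lambda>c x. dt gv_density t c x + divg (cimg c) (?W c) x"])
    fix G \<psi> assume G: "partition_of_unity X A G \<psi>"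
    have "((\<lambda>s. pou_integral G \<psi> (gv_density s)) has_real_derivative 0) (at t)"
      by (rule has_field_derivative_transform_within_open[OF gv_number_derivative[OF t] open_T t]) (simp add: gv_number_eq[OF _ G])
    then have 1: "pou_integral G \<psi> (dt gv_density t) = 0"
      using Leibniz[OF G gv_density_smooth t] DERIV_unique by blast
    have 2: "pou_integral G \<psi> (\<lambda>c. divg (cimg c) (?W c)) = 0"
    proof (rule Stokes[OF G])
      show "vector_density A ?W" by (rule vector_density_of_vector[OF fields(8)[OF t] v_vector[OF t]])
      show "tangent_field A ?W" using tangent_v[OF t] by (simp add: tangent_field_def)
    qed (use sW in \<open>simp add: smooth_field_def\<close>)
    show "pou_integral G \<psi> (\<lambda>c x. dt gv_density t c x + divg (cimg c) (?W c) x) = 0"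
      using 1 2 smooth_slice[OF smooth_family_dt[OF gv_density_smooth] t] sW
      by (subst pou_integral_add[OF G]) (auto intro!: smooth_on_imp_continuous_on smooth_divg fat_cimg)
  next
    fix c x assume c: "c \<in> A" "x \<in> cimg c"
    have form: "gv_form (\<tau> s) (v s) g c y (axis 1 1) (axis 2 1) (axis 3 1) = gv_density s c y" if "s \<in> T" "y \<in> cimg c" for s y
      using gv_form_eq[OF that(1) c(1) that(2)] by (simp add: cross_basis inner_axis)
    have "((\<lambda>s. gv_density s c x) has_real_derivative dt gv_density t c x) (at t)"
      using has_dt[OF gv_density_smooth t c] by (simp add: has_real_derivative_iff_has_vector_derivative)
    then have "((\<lambda>s. gv_form (\<tau> s) (v s) g c x (axis 1 1) (axis 2 1) (axis 3 1)) has_real_derivative dt gv_density t c x) (at t)"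
      by (rule has_field_derivative_transform_within_open[OF _ open_T t]) (simp add: form c)
    then have "deriv (\<lambda>s. gv_form (\<tau> s) (v s) g c x (axis 1 1) (axis 2 1) (axis 3 1)) t = dt gv_density t c x"
      by (rule DERIV_imp_deriv)
    moreover have "lie3 (cimg c) (v t c) (gv_form (\<tau> t) (v t) g c) x (axis 1 1) (axis 2 1) (axis 3 1) = divg (cimg c) (?W c) x"
      by (rule lie3_divg[OF fat_cimg[OF c(1)] smooth_slice[OF gv_density_smooth t c(1)] slices(3)[OF t c(1)] c(2) gv_form_eq[OF t c(1)]])
    ultimately show "material_deriv3 v (\<lambda>s. gv_form (\<tau> s) (v s) g) t c x (axis 1 1) (axis 2 1) (axis 3 1)
        = dt gv_density t c x + divg (cimg c) (?W c) x"
      by (simp add: material_deriv3_def)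
  qed
qed

end

theorem proposition4p76:
  fixes X :: "'a topology" and A :: "'a chart set" and T :: "real set"
    and \<mu> :: "('a, form3) field" and \<tau> :: "real \<Rightarrow> ('a, form1) field"
    and v :: "real \<Rightarrow> ('a, R3) field" and g :: "('a, form2) field"
    and p :: "real \<Rightarrow> 'a \<Rightarrow> real"
    and h :: "real \<Rightarrow> ('a, form2) field"
    and \<gamma> :: "real \<Rightarrow> ('a, covector \<Rightarrow> covector \<Rightarrow> real) field"
  assumes "compact_space X"
    and "aristotelian_fluid X A T \<mu> \<tau> v g p h \<gamma>"
    and "mfd_boundary X A \<noteq> {} \<Longrightarrow> \<forall>t\<in>T. parallel_to_boundary A \<mu> (curl \<mu> g (v t))"
  shows "\<forall>t\<in>T. gv_rate X A \<tau> v g t = 0 \<and>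
    ((\<lambda>s. gv_number X A (\<tau> s) (v s) g) has_real_derivative 0) (at t)"
proof -
  interpret aristotelian X A T \<mu> \<tau> v g p h \<gamma>
    by unfold_locales (use assms in auto)
  show ?thesis using gv_rate_zero gv_number_derivative by blast
qed

end
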